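(* Let $0<\epsilon_J<1$, $G\ge 32$ and $\epsilon_J G\le 1/8$. Then the Melnikov potential is given by $$\mathcal{L}(\alpha,G,s;\epsilon_J)=\mathcal{L}_0(\alpha,G;\epsilon_J)+\mathcal{L}_1(\alpha,G,s;\epsilon_J)+\mathcal{L}_{\ge 2}(\alpha,G,s;\epsilon_J)$$ with $$\mathcal{L}_0=L_{0,0}+2L_{0,1}\cos\alpha+\mathcal{E}_0(\alpha,G;\epsilon_J),$$ $$\mathcal{L}_1=2L_{1,-1}\cos(s-\alpha)+2L_{1,-2}\cos(s-2\alpha)+2L_{1,-3}\cos(s-3\alpha)+\mathcal{E}_1(\alpha,G,s;\epsilon_J),$$ where the harmonics are given by $$L_{0,0}=\frac{\pi}{2G^3}(1+E_{0,0}),\qquad 2L_{0,1}=-\frac{15\pi\epsilon_J}{8G^5}(1+E_{0,1}),$$ $$2L_{1,-1}=\sqrt{\frac{\pi}{8G}}\,\mathrm{e}^{-G^3/3}(1+E_{1,-1}),\qquad 2L_{1,-2}=-3\sqrt{2\pi}\,\epsilon_J G^{3/2}\mathrm{e}^{-G^3/3}(1+E_{1,-2}),$$ $$2L_{1,-3}=\frac{19}{8}\sqrt{2\pi}\,\epsilon_J^2G^{5/2}\mathrm{e}^{-G^3/3}(1+E_{1,-3}),$$ and the error functions satisfy $$|E_{0,0}|\le 2^{12}G^{-4}+2^2\cdot 49\,\epsilon_J^2,\quad |E_{0,1}|\le 2^{13}G^{-4}+\epsilon_J^2,\quad |E_{1,-1}|\le 2^{21}G^{-1}+2\cdot 49\,\epsilon_J^2,$$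 $$|E_{1,-2}|\le 2^{17}G^{-1}+\tfrac{49}{3}\epsilon_J,\quad |E_{1,-3}|\le 2^{17}G^{-1}+15\epsilon_J,\quad |\mathcal{E}_0|\le 2^{14}\epsilon_J^2G^{-7},$$ $$|\mathcal{E}_1|\le 2^{18}\epsilon_J\,\mathrm{e}^{-G^3/3}\left[\epsilon_J^2G^{7/2}+G^{-3/2}\right],\qquad |\mathcal{L}_{\ge2}|\le 2^{28}G^{3/2}\mathrm{e}^{-2G^3/3}.$$
   Context: For $0<\epsilon_J<1$ let $f=f(t)$ solve $\frac{df}{dt}=\frac{(1+\epsilon_J\cos f)^2}{(1-\epsilon_J^2)^{3/2}}$, $f(0)=0$, and let $r=\frac{1-\epsilon_J^2}{1+\epsilon_J\cos f}$ (both regarded as functions of time; $r$ is $2\pi$-periodic). For $G>0$, $\alpha\in\mathbb{T}=\mathbb{R}/2\pi\mathbb{Z}$, let $\tau=\tau(t)$ be defined by $t=\frac{G^3}{2}\left(\tau+\frac{\tau^3}{3}\right)$ and put $x_h(t)=\frac{2}{G(1+\tau^2)^{1/2}}$, $\alpha_h(t)=\alpha+\pi+2\arctan\tau$. The Melnikov potential is $$\mathcal{L}(\alpha,G,s;\epsilon_J)=\int_{-\infty}^{\infty}\left[\frac{x_h^2}{\left[4+x_h^4r^2+4x_h^2r\cos(\alpha_h-f)\right]^{1/2}}+\left(\frac{x_h^2}{2}\right)^2r\cos(\alpha_h-f)-\frac{x_h^2}{2}\right]dt,$$ with $x_h,\alpha_h$ evaluated at $t$ and $r,f$ evaluated at $s+t$.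 It is even under $(\alpha,s)\mapsto(-\alpha,-s)$, and its Fourier coefficients $L_{q,k}=L_{q,k}(G;\epsilon_J)$, defined by $\mathcal{L}=\sum_{q,k\in\mathbb{Z}}L_{q,k}\mathrm{e}^{i(qs+k\alpha)}$, are real, so that $$\mathcal{L}=L_{0,0}+2\sum_{k\ge1}L_{0,k}\cos k\alpha+2\sum_{q\ge1}\sum_{k\in\mathbb{Z}}L_{q,k}\cos(qs+k\alpha).$$ Notation: $\mathcal{L}_0=L_{0,0}+2\sum_{k\ge1}L_{0,k}\cos k\alpha$, $\mathcal{L}_q=2\sum_{k\in\mathbb{Z}}L_{q,k}\cos(qs+k\alpha)$ for $q\ge1$, and $\mathcal{L}_{\ge2}=\sum_{q\ge2}\mathcal{L}_q$. *)

theory Defs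
  imports "HOL-Analysis.Analysis"
begin

text \<open>The angles \<open>\<alpha>\<close> and \<open>s\<close> live on the circle; they are represented by real numbers, and all
  functions of them below are \<open>2\<pi>\<close>-periodic.\<close>

definition is_true_anomaly :: "real \<Rightarrow> (real \<Rightarrow> real) \<Rightarrow> bool" where
  "is_true_anomaly eJ f \<longleftrightarrow>
     f 0 = 0 \<and>
     (\<forall>t. (f has_real_derivative (1 + eJ * cos (f t))\<^sup>2 / (1 - eJ\<^sup>2) powr (3/2)) (at t))"

definition primary_radius :: "real \<Rightarrow> (real \<Rightarrow> real) \<Rightarrow> real \<Rightarrow> real" where
  "primary_radius eJ f t = (1 - eJ\<^sup>2) / (1 + eJ * cos (f t))"

text \<open>For \<open>G > 0\<close> the cubic is an increasing bijection of the reals, so the description is unique.\<close>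

definition tau_h :: "real \<Rightarrow> real \<Rightarrow> real" where
  "tau_h G t = (THE \<tau>. t = G^3 / 2 * (\<tau> + \<tau>^3 / 3))"

definition x_h :: "real \<Rightarrow> real \<Rightarrow> real" where
  "x_h G t = 2 / (G * sqrt (1 + (tau_h G t)\<^sup>2))"

definition alpha_h :: "real \<Rightarrow> real \<Rightarrow> real \<Rightarrow> real" where
  "alpha_h \<alpha> G t = \<alpha> + pi + 2 * arctan (tau_h G t)"

definition melnikov_integrand ::
    "(real \<Rightarrow> real) \<Rightarrow> real \<Rightarrow> real \<Rightarrow> real \<Rightarrow> real \<Rightarrow> real \<Rightarrow> real" where
  "melnikov_integrand f \<alpha> G s eJ t =
     (let x = x_h G t; r = primary_radius eJ f (s + t); c = cos (alpha_h \<alpha> G t - f (s + t))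
      in x\<^sup>2 / sqrt (4 + x^4 * r\<^sup>2 + 4 * x\<^sup>2 * r * c) + (x\<^sup>2 / 2)\<^sup>2 * r * c - x\<^sup>2 / 2)"

definition melnikov :: "(real \<Rightarrow> real) \<Rightarrow> real \<Rightarrow> real \<Rightarrow> real \<Rightarrow> real \<Rightarrow> real" where
  "melnikov f \<alpha> G s eJ = (LBINT t. melnikov_integrand f \<alpha> G s eJ t)"

definition melnikov_fourier :: "(real \<Rightarrow> real) \<Rightarrow> real \<Rightarrow> real \<Rightarrow> int \<Rightarrow> int \<Rightarrow> complex" where
  "melnikov_fourier f G eJ q k =
     1 / (4 * pi\<^sup>2) *
       integral {0..2*pi} (\<lambda>s. integral {0..2*pi} (\<lambda>\<alpha>.
         complex_of_real (melnikov f \<alpha> G s eJ) * cis (- (of_int q * s + of_int k * \<alpha>))))"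

text \<open>The potential is even under \<open>(\<alpha>, s) \<mapsto> (-\<alpha>, -s)\<close>, so the Fourier coefficients are real and
  taking the real part loses nothing.\<close>

definition melnikov_coeff :: "(real \<Rightarrow> real) \<Rightarrow> real \<Rightarrow> real \<Rightarrow> int \<Rightarrow> int \<Rightarrow> real" where
  "melnikov_coeff f G eJ q k = Re (melnikov_fourier f G eJ q k)"

definition melnikov_0 :: "(real \<Rightarrow> real) \<Rightarrow> real \<Rightarrow> real \<Rightarrow> real \<Rightarrow> real" where
  "melnikov_0 f \<alpha> G eJ =
     melnikov_coeff f G eJ 0 0
     + 2 * (\<Sum>\<^sub>\<infinity>k\<in>{1..}. melnikov_coeff f G eJ 0 k * cos (of_int k * \<alpha>))"

text \<open>Used for \<open>q \<ge> 1\<close> only.\<close>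

definition melnikov_harmonic ::
    "(real \<Rightarrow> real) \<Rightarrow> int \<Rightarrow> real \<Rightarrow> real \<Rightarrow> real \<Rightarrow> real \<Rightarrow> real" where
  "melnikov_harmonic f q \<alpha> G s eJ =
     2 * (\<Sum>\<^sub>\<infinity>k. melnikov_coeff f G eJ q k * cos (of_int q * s + of_int k * \<alpha>))"

definition melnikov_ge2 :: "(real \<Rightarrow> real) \<Rightarrow> real \<Rightarrow> real \<Rightarrow> real \<Rightarrow> real \<Rightarrow> real" where
  "melnikov_ge2 f \<alpha> G s eJ = (\<Sum>\<^sub>\<infinity>q\<in>{2..}. melnikov_harmonic f q \<alpha> G s eJ)"

end

theory Submission
  imports Defs "HOL-Complex_Analysis.Complex_Analysis" "HOL-Probability.Probability"
begin

text \<open>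
  Write the interaction in complex form. With \<open>p\<close> the position of the primary on its ellipse and \<open>\<tau>\<close> the
  parameter of the parabola, the Melnikov integrand times \<open>dt/d\<tau>\<close> is \<open>G * (1 / \<bar>1 + X\<bar> - 1 + Re X)\<close> with
  \<open>X = - 2 / G\<^sup>2 * cis \<alpha> * conj(p) * inverse (1 - \<i> \<tau>)\<^sup>2\<close>. The binomial series
  (\<open>has_sum_inverse_norm_tail\<close>) expands it in \<open>X^l * conj(X)^m\<close> with \<open>l + m \<ge> 2\<close>, and the Fourier series in
  time of \<open>conj(p)^l * p^m\<close> (\<open>orbit_monomial_has_sum\<close>) separates the variables. Everything converges
  absolutely, so \<open>L\<^sub>q\<^sub>,\<^sub>k\<close> is the sum over \<open>l - m = k\<close> of products of three factors: an explicit weight, the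
  \<open>q\<close>-th Fourier coefficient of the orbit monomial, and the integral over the real line of
  \<open>exp (\<i> w (z + z^3 / 3)) / ((1 - \<i> z)^(2 l) * (1 + \<i> z)^(2 m))\<close> with \<open>w = q G^3 / 2\<close>.

  The orbit coefficients are means over a circle, by Kepler's equation. Shrinking or enlarging the circle
  shows that they are of order \<open>e\<close> to the power \<open>\<bar>m - l - q\<bar>\<close> (\<open>orbit_coeff_bound\<close>). The few that enter the
  principal terms are evaluated: exactly for \<open>q = 0\<close>, and through Taylor coefficients for \<open>q = 1\<close>.

  The phase \<open>z + z^3 / 3\<close> has the critical point \<open>\<i>\<close>, with critical value \<open>2 \<i> / 3\<close>. Moving the line of integration
  close to \<open>\<i>\<close> gives the factor \<open>exp (- q G^3 / 3)\<close> (\<open>parab_integral_bound\<close>). The pole of order \<open>2 m\<close> sits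
  exactly at the critical point; comparison with the moments of a Gaussian along a line below its pole
  (\<open>parab_integral_saddle_error\<close>) yields the asymptotics with relative error at most \<open>4 / G\<close>. For \<open>q = 0\<close> the integrals
  are elementary.

  The estimates then rest on two gains. For \<open>q \<ge> 1\<close> a step \<open>k \<mapsto> k - 1\<close> beyond \<open>- q\<close> multiplies the terms by a
  factor of order \<open>e G\<close>, where \<open>e G \<le> 1/8\<close>, and a step in both \<open>l\<close> and \<open>m\<close> multiplies them by a factor of
  order \<open>1 / G\<close>, or \<open>1 / G^4\<close> when \<open>q = 0\<close>. So each named harmonic is governed by its first nonzero term,
  the others form geometric series, and the harmonics with \<open>q \<ge> 2\<close> carry at least the square of
  \<open>exp (- G^3 / 3)\<close>.
\<close>

section \<open>Integration term by term and along lines\<close>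

text \<open>Weierstrass' test in product form: the majorant splits into a summable factor \<open>b\<close> in the index and
  an integrable factor \<open>g\<close> in the variable, so the tail after a finite index set \<open>F\<close> is at most
  \<open>g x\<close> times the tail of \<open>b\<close>, and integrating this bound gives the convergence.\<close>

lemma has_sum_integral_dominated:
  fixes f :: "'i \<Rightarrow> 'a::euclidean_space \<Rightarrow> 'b::{banach, second_countable_topology}"
  assumes sum: "\<And>x. x \<in> space M \<Longrightarrow> ((\<lambda>i. f i x) has_sum S x) A"
    and int: "\<And>i. i \<in> A \<Longrightarrow> integrable M (f i)"
    and S: "S \<in> borel_measurable M"
    and g: "integrable M g" and g0: "\<And>x. 0 \<le> g x"
    and b: "b summable_on A" and b0: "\<And>i. i \<in> A \<Longrightarrow> 0 \<le> b i"
    and bd: "\<And>i x. i \<in> A \<Longrightarrow> x \<in> space M \<Longrightarrow> norm (f i x) \<le> b i * g x"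
  shows "integrable M S" and "((\<lambda>i. integral\<^sup>L M (f i)) has_sum integral\<^sup>L M S) A"
proof -
  define B where "B = infsum b A"
  have B: "(b has_sum B) A" unfolding B_def using b by (rule has_sum_infsum)
  have rest: "norm (S x - (\<Sum>i\<in>F. f i x)) \<le> (B - sum b F) * g x"
    if F: "finite F" "F \<subseteq> A" and x: "x \<in> space M" for F x
  proof -
    have 1: "((\<lambda>i. f i x) has_sum (S x - (\<Sum>i\<in>F. f i x))) (A - F)"
      using has_sum_Diff[OF sum[OF x] has_sum_finite[OF F(1)] F(2)] .
    have 2: "((\<lambda>i. b i * g x) has_sum ((B - sum b F) * g x)) (A - F)"
      using has_sum_Diff[OF B has_sum_finite[OF F(1)] F(2)] by (rule has_sum_cmult_left)
    show ?thesis
    proof (rule norm_infsum_le[OF 1 2])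
      fix i assume "i \<in> A - F" then show "norm (f i x) \<le> b i * g x" using bd x by auto
    qed
  qed
  show intS: "integrable M S"
  proof (rule Bochner_Integration.integrable_bound[OF integrable_mult_right[OF g, of B] S])
    show "AE x in M. norm (S x) \<le> norm (B * g x)"
    proof (rule AE_I2)
      fix x assume x: "x \<in> space M"
      have "norm (S x) \<le> B * g x" using rest[of "{}" x] x by simp
      then show "norm (S x) \<le> norm (B * g x)" by simp
    qed
  qed
  show "((\<lambda>i. integral\<^sup>L M (f i)) has_sum integral\<^sup>L M S) A"
    unfolding has_sum_def
  proof (rule Lim_transform2)
    show "((\<lambda>F. integral\<^sup>L M S) \<longlongrightarrow> integral\<^sup>L M S) (finite_subsets_at_top A)" by simp
    show "((\<lambda>F. integral\<^sup>L M S - (\<Sum>i\<in>F. integral\<^sup>L M (f i))) \<longlongrightarrow> 0) (finite_subsets_at_top A)"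
    proof (rule Lim_null_comparison)
      show "\<forall>\<^sub>F F in finite_subsets_at_top A.
          norm (integral\<^sup>L M S - (\<Sum>i\<in>F. integral\<^sup>L M (f i))) \<le> (B - sum b F) * integral\<^sup>L M g"
      proof (rule eventually_finite_subsets_at_top_weakI)
        fix F assume F: "finite F" "F \<subseteq> A"
        have intF: "integrable M (\<lambda>x. \<Sum>i\<in>F. f i x)" using int F by (intro Bochner_Integration.integrable_sum) auto
        have "integral\<^sup>L M S - (\<Sum>i\<in>F. integral\<^sup>L M (f i)) = integral\<^sup>L M (\<lambda>x. S x - (\<Sum>i\<in>F. f i x))"
          using int F intS intF by (subst Bochner_Integration.integral_diff) (auto simp: Bochner_Integration.integral_sum subset_iff)
        also have "norm \<dots> \<le> integral\<^sup>L M (\<lambda>x. (B - sum b F) * g x)"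
          using intS intF g rest[OF F]
          by (intro Bochner_Integration.integral_norm_bound_integral Bochner_Integration.integrable_diff integrable_mult_right) simp_all
        finally show "norm (integral\<^sup>L M S - (\<Sum>i\<in>F. integral\<^sup>L M (f i))) \<le> (B - sum b F) * integral\<^sup>L M g"
          by simp
      qed
      have "((\<lambda>F. (B - sum b F) * integral\<^sup>L M g) \<longlongrightarrow> (B - B) * integral\<^sup>L M g) (finite_subsets_at_top A)"
        using B unfolding has_sum_def by (intro tendsto_intros)
      then show "((\<lambda>F. (B - sum b F) * integral\<^sup>L M g) \<longlongrightarrow> 0) (finite_subsets_at_top A)" by simp
    qed
  qed
qed

text \<open>The uniform limit of the partial sums is continuous, and the constant function 1 is an integrable
  second factor of the majorant on a compact interval.\<close>

lemma has_sum_integral_interval: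
  fixes f :: "'i \<Rightarrow> real \<Rightarrow> complex"
  assumes sum: "\<And>x. x \<in> {u..v} \<Longrightarrow> ((\<lambda>i. f i x) has_sum S x) A"
    and cont: "\<And>i. i \<in> A \<Longrightarrow> continuous_on {u..v} (f i)"
    and b: "b summable_on A" and bd: "\<And>i x. i \<in> A \<Longrightarrow> x \<in> {u..v} \<Longrightarrow> norm (f i x) \<le> b i"
    and b0: "\<And>i. i \<in> A \<Longrightarrow> 0 \<le> b i"
  shows "continuous_on {u..v} S" and "((\<lambda>i. integral {u..v} (f i)) has_sum integral {u..v} S) A"
proof -
  have ul: "uniform_limit {u..v} (\<lambda>X y. \<Sum>i\<in>X. f i y) S (finite_subsets_at_top A)"
    using Weierstrass_m_test_general'[of A "{u..v}" f b S] bd sum b by blast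
  have ev: "\<forall>\<^sub>F X in finite_subsets_at_top A. continuous_on {u..v} (\<lambda>y. \<Sum>i\<in>X. f i y)"
  proof (rule eventually_finite_subsets_at_top_weakI)
    fix X assume X: "finite X" "X \<subseteq> A"
    show "continuous_on {u..v} (\<lambda>y. \<Sum>i\<in>X. f i y)"
      by (rule continuous_on_sum, rule cont) (use X in blast)
  qed
  show c: "continuous_on {u..v} S"
    using uniform_limit_theorem[OF ev ul finite_subsets_at_top_neq_bot] .
  have *: "((\<lambda>i. integral\<^sup>L (lebesgue_on {u..v}) (f i)) has_sum integral\<^sup>L (lebesgue_on {u..v}) S) A"
  proof (rule has_sum_integral_dominated(2)[where b=b and g="\<lambda>_. 1"])
    show "integrable (lebesgue_on {u..v}) (\<lambda>_. 1::real)"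
      by (rule continuous_imp_integrable_real) simp
    show "S \<in> borel_measurable (lebesgue_on {u..v})"
      using continuous_imp_integrable_real[OF c] by (rule borel_measurable_integrable)
  qed (use b b0 bd sum cont in \<open>simp_all add: continuous_imp_integrable_real\<close>)
  have e: "integral\<^sup>L (lebesgue_on {u..v}) h = integral {u..v} h" if "continuous_on {u..v} h" for h :: "real \<Rightarrow> complex"
    by (rule lebesgue_integral_eq_integral) (use that in \<open>auto intro: continuous_imp_integrable_real\<close>)
  have "((\<lambda>i. integral\<^sup>L (lebesgue_on {u..v}) (f i)) has_sum integral {u..v} S) A
    \<longleftrightarrow> ((\<lambda>i. integral {u..v} (f i)) has_sum integral {u..v} S) A" 
    by (rule has_sum_cong) (use e cont in auto)
  then show "((\<lambda>i. integral {u..v} (f i)) has_sum integral {u..v} S) A"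
    using * e[OF c] by simp
qed

lemma integral_FTC_line:
  fixes F :: "real \<Rightarrow> complex"
  assumes F: "\<And>x. (F has_vector_derivative f x) (at x)"
    and f: "continuous_on UNIV f" and int: "integrable lborel f"
    and A: "(F \<longlongrightarrow> A) at_bot" and B: "(F \<longlongrightarrow> B) at_top"
  shows "integral\<^sup>L lborel f = B - A"
proof -
  have "(LBINT x=-\<infinity>..\<infinity>. f x) = B - A"
  proof (rule interval_integral_FTC_integrable)
    show "isCont f x" for x using f by (simp add: continuous_on_eq_continuous_at)
    show "set_integrable lborel (einterval (-\<infinity>) \<infinity>) f"
      using int by (simp add: set_integrable_def einterval_def)
    show "((F \<circ> real_of_ereal) \<longlongrightarrow> A) (at_right (-\<infinity>))"
      using A by (simp add: ereal_tendsto_simps)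
    show "((F \<circ> real_of_ereal) \<longlongrightarrow> B) (at_left \<infinity>)"
      using B by (simp add: ereal_tendsto_simps)
  qed (use F in auto)
  then show ?thesis
    by (simp add: interval_lebesgue_integral_def set_lebesgue_integral_def einterval_def)
qed

text \<open>Cauchy's theorem for two parallel lines without a limit of rectangles: a primitive \<open>P\<close> of \<open>F\<close> exists
  on the convex strip, and the difference of the integrands is the derivative of
  \<open>P (x + i d) - P (x + i c)\<close>, which tends to 0 at both ends because it is the integral of \<open>F\<close> over a
  short vertical segment.\<close>

lemma integral_horizontal_line_shift:
  fixes F :: "complex \<Rightarrow> complex" and B :: "real \<Rightarrow> real"
  assumes hol: "F holomorphic_on {z. lo < Im z \<and> Im z < hi}"
    and c: "lo < c" "c \<le> d" "d < hi"
    and int: "integrable lborel (\<lambda>x. F (Complex x c))" "integrable lborel (\<lambda>x. F (Complex x d))"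
    and decay: "\<And>x y. c \<le> y \<Longrightarrow> y \<le> d \<Longrightarrow> norm (F (Complex x y)) \<le> B \<bar>x\<bar>" and B: "(B \<longlongrightarrow> 0) at_top"
  shows "(LBINT x. F (Complex x d)) = (LBINT x. F (Complex x c))"
proof -
  define S where "S = {z. lo < Im z \<and> Im z < hi}"
  have S: "convex S" "open S"
  proof -
    have "S = {z. Im z > lo} \<inter> {z. Im z < hi}" by (auto simp: S_def)
    then show "convex S" "open S"
      by (simp_all add: convex_Int convex_halfspace_Im_gt convex_halfspace_Im_lt open_Int open_halfspace_Im_gt open_halfspace_Im_lt)
  qed
  have hol': "F holomorphic_on S" using hol by (simp add: S_def)
  obtain P where P: "\<And>z. z \<in> S \<Longrightarrow> (P has_field_derivative F z) (at z within S)"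
    by (rule holomorphic_convex_primitive'[OF S hol']) (rule that)
  have P': "(P has_field_derivative F z) (at z)" if "z \<in> S" for z
    using P[OF that] unfolding at_within_open[OF that S(2)] .
  define D where "D = (\<lambda>x. P (Complex x d) - P (Complex x c))"
  have derline: "((\<lambda>x. P (Complex x y)) has_vector_derivative F (Complex x y)) (at x)"
    if "c \<le> y" "y \<le> d" for x y
  proof -
    have "((\<lambda>x. complex_of_real x + \<i> * of_real y) has_vector_derivative of_real 1 + 0) (at x)"
      by (intro has_vector_derivative_add has_vector_derivative_const has_vector_derivative_of_real DERIV_ident)
    then have "((P \<circ> (\<lambda>x. complex_of_real x + \<i> * of_real y)) has_vector_derivative (of_real 1 + 0) * F (complex_of_real x + \<i> * of_real y)) (at x)"
      by (rule field_vector_diff_chain_at) (rule P', use that c in \<open>auto simp: S_def\<close>)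
    then show ?thesis by (simp add: o_def Complex_eq)
  qed
  have cline: "continuous_on UNIV (\<lambda>x. F (Complex x y))" if "c \<le> y" "y \<le> d" for y
  proof -
    have "continuous_on UNIV (F \<circ> (\<lambda>x. complex_of_real x + \<i> * complex_of_real y))"
    proof (rule continuous_on_compose)
      show "continuous_on UNIV (\<lambda>x. complex_of_real x + \<i> * complex_of_real y)"
        by (intro continuous_intros)
      show "continuous_on (range (\<lambda>x. complex_of_real x + \<i> * complex_of_real y)) F"
        by (rule continuous_on_subset[OF holomorphic_on_imp_continuous_on[OF hol]]) (use that c in auto)
    qed
    then show ?thesis by (simp add: o_def Complex_eq)
  qed
  have Dle: "norm (D x) \<le> B \<bar>x\<bar> * \<bar>d - c\<bar>" for x
  proof -
    have "norm (P (Complex x d) - P (Complex x c)) \<le> B \<bar>x\<bar> * norm (Complex x d - Complex x c)"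
    proof (rule field_differentiable_bound[where f'=F and S="closed_segment (Complex x c) (Complex x d)"])
      fix z assume z: "z \<in> closed_segment (Complex x c) (Complex x d)"
      then have "z = Complex x (Im z)" "c \<le> Im z" "Im z \<le> d"
        using c by (auto simp: closed_segment_same_Re closed_segment_eq_real_ivl complex_eq_iff)
      then show "norm (F z) \<le> B \<bar>x\<bar>" using decay[of "Im z" x] by simp
      show "(P has_field_derivative F z) (at z within closed_segment (Complex x c) (Complex x d))"
        by (rule has_field_derivative_at_within[OF P']) (use \<open>c \<le> Im z\<close> \<open>Im z \<le> d\<close> c in \<open>auto simp: S_def\<close>)
    qed auto
    moreover have "norm (Complex x d - Complex x c) = \<bar>d - c\<bar>" by (simp add: cmod_def)
    ultimately show ?thesis by (simp add: D_def)
  qed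
  have lim: "((\<lambda>x. B \<bar>x\<bar> * \<bar>d - c\<bar>) \<longlongrightarrow> 0) at_top" "((\<lambda>x. B \<bar>x\<bar> * \<bar>d - c\<bar>) \<longlongrightarrow> 0) at_bot"
  proof -
    have 1: "((\<lambda>x. B \<bar>x\<bar>) \<longlongrightarrow> 0) at_top"
      by (rule Lim_transform_eventually[OF B]) (use eventually_ge_at_top[of 0] in eventually_elim, simp)
    moreover have "((\<lambda>x. B \<bar>x\<bar>) \<longlongrightarrow> 0) at_bot"
      unfolding filterlim_at_bot_mirror using 1 by simp
    ultimately show "((\<lambda>x. B \<bar>x\<bar> * \<bar>d - c\<bar>) \<longlongrightarrow> 0) at_top" "((\<lambda>x. B \<bar>x\<bar> * \<bar>d - c\<bar>) \<longlongrightarrow> 0) at_bot"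
      by (auto intro: tendsto_mult_left_zero)
  qed
  define H where "H = (\<lambda>x. F (Complex x d) - F (Complex x c))"
  have Dder: "(D has_vector_derivative H x) (at x)" for x
    unfolding D_def H_def by (rule has_vector_derivative_diff[OF derline derline]) (use c in auto)
  have Hcont: "continuous_on UNIV H"
    unfolding H_def by (rule continuous_on_diff[OF cline cline]) (use c in auto)
  have Hint: "integrable lborel H"
    unfolding H_def using int by simp
  have Dbot: "(D \<longlongrightarrow> 0) at_bot"
    by (rule Lim_null_comparison[OF _ lim(2)]) (simp add: Dle)
  have Dtop: "(D \<longlongrightarrow> 0) at_top"
    by (rule Lim_null_comparison[OF _ lim(1)]) (simp add: Dle)
  have "integral\<^sup>L lborel H = 0"
    using integral_FTC_line[OF Dder Hcont Hint Dbot Dtop] by simp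
  then show ?thesis
    using int by (simp add: H_def)
qed

section \<open>Means over circles\<close>

text \<open>The constant Laurent coefficient of a function that is holomorphic off the origin.\<close>

definition circle_mean :: "(complex \<Rightarrow> complex) \<Rightarrow> complex" where
  "circle_mean F = integral {0..2*pi} (\<lambda>E. F (cis E)) / of_real (2 * pi)"

lemma continuous_on_cis_circle:
  assumes "continuous_on (sphere 0 1) F"
  shows "continuous_on A (\<lambda>E. F (cis E))"
proof (rule continuous_on_compose2[OF assms])
  show "continuous_on A cis" unfolding cis_conv_exp by (intro continuous_intros)
qed auto

lemma circle_mean_add:
  assumes "continuous_on (sphere 0 1) F" "continuous_on (sphere 0 1) H"
  shows "circle_mean (\<lambda>z. F z + H z) = circle_mean F + circle_mean H"
  unfolding circle_mean_def using assms
  by (subst Henstock_Kurzweil_Integration.integral_add)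
     (auto intro!: integrable_continuous_real continuous_on_cis_circle simp: add_divide_distrib)

lemma circle_mean_diff:
  assumes "continuous_on (sphere 0 1) F" "continuous_on (sphere 0 1) H"
  shows "circle_mean (\<lambda>z. F z - H z) = circle_mean F - circle_mean H"
  unfolding circle_mean_def using assms
  by (subst Henstock_Kurzweil_Integration.integral_diff)
     (auto intro!: integrable_continuous_real continuous_on_cis_circle simp: diff_divide_distrib)

lemma circle_mean_mult_left: "circle_mean (\<lambda>z. c * F z) = c * circle_mean F"
  unfolding circle_mean_def by simp

lemma circle_mean_cong: "(\<And>z. norm z = 1 \<Longrightarrow> F z = H z) \<Longrightarrow> circle_mean F = circle_mean H"
  unfolding circle_mean_def by (intro arg_cong2[where f="(/)"] integral_cong refl) auto

lemma circle_mean_norm_le: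
  assumes "continuous_on (sphere 0 1) F" and "\<And>z. norm z = 1 \<Longrightarrow> norm (F z) \<le> B"
  shows "norm (circle_mean F) \<le> B"
proof -
  have "norm (integral {0..2*pi} (\<lambda>E. F (cis E))) \<le> B * (2 * pi - 0)"
    by (rule integral_bound) (auto intro: assms continuous_on_cis_circle)
  then show ?thesis by (simp add: circle_mean_def norm_divide norm_mult field_simps)
qed

lemma circle_mean_inverse: "circle_mean (\<lambda>z. F (inverse z)) = circle_mean F"
proof -
  have per: "cis (x + 2 * pi) = cis x" for x by (simp add: complex_eq_iff)
  have inv: "inverse (cis (- x)) = cis x" for x by (simp only: cis_inverse minus_minus)
  have "integral {0..2*pi} (\<lambda>E. F (inverse (cis E))) = integral {-(2*pi)..-0} (\<lambda>E. F (inverse (cis (- E))))"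
    by (rule Henstock_Kurzweil_Integration.integral_reflect_real[symmetric])
  also have "\<dots> = integral {0-2*pi..2*pi-2*pi} (\<lambda>E. F (cis (E + 2*pi)))"
    by (simp only: per inv) simp
  also have "\<dots> = integral {0..2*pi} (\<lambda>E. F (cis E))"
    by (rule integral_shift_real_ivl)
  finally show ?thesis by (simp add: circle_mean_def)
qed

lemma circle_mean_cnj: "cnj (circle_mean F) = circle_mean (\<lambda>z. cnj (F z))"
  unfolding circle_mean_def complex_cnj_divide Henstock_Kurzweil_Integration.integral_cnj by simp

lemma circle_mean_real:
  assumes "\<And>z. norm z = 1 \<Longrightarrow> cnj (F z) = F (cnj z)"
  shows "Im (circle_mean F) = 0"
proof -
  have inv: "cnj z = inverse z" if "norm z = 1" for z :: complex
    using inverse_unique[of z "cnj z"] complex_norm_square[of z] that by simp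
  have "cnj (circle_mean F) = circle_mean (\<lambda>z. F (inverse z))"
    unfolding circle_mean_cnj by (rule circle_mean_cong) (simp add: assms inv)
  then have "cnj (circle_mean F) = circle_mean F" by (simp only: circle_mean_inverse)
  then show ?thesis by (simp add: complex_eq_iff)
qed

lemma contour_integral_circle_mean:
  assumes "0 < \<rho>"
  shows "contour_integral (circlepath 0 \<rho>) (\<lambda>z. F z / z) = 2 * pi * \<i> * circle_mean (\<lambda>z. F (\<rho> * z))"
proof -
  have "contour_integral (circlepath 0 \<rho>) (\<lambda>z. F z / z)
     = integral {0..2*pi} (\<lambda>t. F (\<rho> * cis t) / (\<rho> * cis t) * \<rho> * \<i> * cis t)"
    unfolding circlepath_def by (subst contour_integral_part_circlepath_eq) auto
  also have "\<dots> = integral {0..2*pi} (\<lambda>t. \<i> * F (\<rho> * cis t))"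
    using assms by (intro integral_cong) (auto simp: field_simps)
  also have "\<dots> = 2 * pi * \<i> * circle_mean (\<lambda>z. F (\<rho> * z))"
    by (simp add: circle_mean_def)
  finally show ?thesis .
qed

text \<open>The circles of all radii are homotopic in the punctured plane. Choosing the radius freely is what
  produces powers of the eccentricity in the bounds below.\<close>

lemma circle_mean_radius:
  assumes hol: "F holomorphic_on -{0}" and "0 < \<rho>"
  shows "circle_mean (\<lambda>z. F (of_real \<rho> * z)) = circle_mean F"
proof -
  have "contour_integral (circlepath 0 \<rho>) (\<lambda>z. F z / z) = contour_integral (circlepath 0 1) (\<lambda>z. F z / z)"
  proof (rule Cauchy_theorem_homotopic_loops[where S="-{0}"])
    show "homotopic_loops (- {0}) (circlepath 0 \<rho>) (circlepath 0 1)"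
    proof (rule homotopic_loops_linear)
      fix t :: real assume "t \<in> {0..1}"
      define e where "e = exp (2 * of_real pi * \<i> * of_real t)"
      have e: "e \<noteq> 0" by (simp add: e_def)
      have "(1 - u) *\<^sub>R (\<rho> * e) + u *\<^sub>R e \<noteq> 0" if "0 \<le> u" "u \<le> 1" for u
      proof -
        have "(1 - u) * \<rho> + u > 0"
          using that \<open>0 < \<rho>\<close> by (cases "u = 1") (auto intro!: add_pos_nonneg)
        moreover have "(1 - u) *\<^sub>R (\<rho> * e) + u *\<^sub>R e = of_real ((1 - u) * \<rho> + u) * e"
          by (simp add: scaleR_conv_of_real algebra_simps)
        ultimately show ?thesis using e by (simp del: of_real_add of_real_mult)
      qed
      then show "closed_segment (circlepath 0 \<rho> t) (circlepath 0 1 t) \<subseteq> - {0}"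
        by (auto simp: closed_segment_def circlepath e_def)
    qed auto
    show "(\<lambda>z. F z / z) holomorphic_on - {0}" by (intro holomorphic_intros hol) auto
  qed auto
  then show ?thesis
    using contour_integral_circle_mean[OF \<open>0 < \<rho>\<close>, of F] contour_integral_circle_mean[of 1 F] by simp
qed

lemma circle_mean_radius_bound:
  assumes hol: "F holomorphic_on -{0}" and \<rho>: "0 < \<rho>" and B: "\<And>z. norm z = \<rho> \<Longrightarrow> norm (F z) \<le> B"
  shows "norm (circle_mean F) \<le> B"
proof -
  have "norm (circle_mean (\<lambda>z. F (of_real \<rho> * z))) \<le> B"
  proof (rule circle_mean_norm_le)
    show "continuous_on (sphere 0 1) (\<lambda>z. F (complex_of_real \<rho> * z))"
      by (rule continuous_on_compose2[OF holomorphic_on_imp_continuous_on[OF hol]])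
         (use \<rho> in \<open>auto intro!: continuous_intros\<close>)
  qed (use B \<rho> in \<open>auto simp: norm_mult\<close>)
  then show ?thesis using circle_mean_radius[OF hol \<rho>] by simp
qed

lemma circle_mean_taylor_coeff:
  assumes "F holomorphic_on UNIV"
  shows "circle_mean (\<lambda>z. F z / z ^ n) = (deriv ^^ n) F 0 / fact n"
proof -
  have "((\<lambda>u. F u / (u - 0) ^ Suc n) has_contour_integral (2 * pi * \<i>) / fact n * (deriv ^^ n) F 0) (circlepath 0 1)"
    by (rule Cauchy_has_contour_integral_higher_derivative_circlepath)
       (auto intro: holomorphic_on_subset[OF assms] holomorphic_on_imp_continuous_on)
  then have "contour_integral (circlepath 0 1) (\<lambda>z. (F z / z ^ n) / z) = (2 * pi * \<i>) / fact n * (deriv ^^ n) F 0"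
    by (intro contour_integral_unique) (simp add: mult.commute)
  then show ?thesis using contour_integral_circle_mean[of 1 "\<lambda>z. F z / z ^ n"] by (simp add: field_simps)
qed

section \<open>Fourier series with summable coefficients\<close>

lemma integral_cis_period:
  fixes q :: int
  shows "integral {0..2*pi} (\<lambda>t. cis (of_int q * t)) = (if q = 0 then of_real (2 * pi) else 0)"
proof (cases "q = 0")
  case False
  have "((\<lambda>t. cis (of_int q * t)) has_integral cis (of_int q * (2*pi)) / (\<i> * of_int q) - cis (of_int q * 0) / (\<i> * of_int q)) {0..2*pi}"
  proof (rule fundamental_theorem_of_calculus)
    fix x assume "x \<in> {0..2*pi}"
    have "((\<lambda>w. exp (\<i> * of_int q * w) / (\<i> * of_int q)) has_field_derivative exp (\<i> * of_int q * of_real x)) (at (of_real x))"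
      using False by (auto intro!: derivative_eq_intros)
    from has_vector_derivative_real_field[OF this, of "{0..2*pi}"]
    show "((\<lambda>a. cis (of_int q * a) / (\<i> * of_int q)) has_vector_derivative cis (of_int q * x)) (at x within {0..2*pi})"
      by (simp add: cis_conv_exp mult.assoc)
  qed auto
  moreover have "cis (of_int q * (2*pi)) = 1"
    by (metis cis_multiple_2pi mult.commute Ints_of_int)
  ultimately show ?thesis using False by (simp add: integral_unique)
qed (simp add: scaleR_conv_of_real)

lemma summable_on_dominated:
  fixes f :: "'a \<Rightarrow> 'b::banach"
  assumes b: "b summable_on A" and le: "\<And>x. x \<in> A \<Longrightarrow> norm (f x) \<le> b x"
  shows "f summable_on A"
proof (rule abs_summable_summable)
  have b0: "0 \<le> b x" if "x \<in> A" for x using le[OF that] norm_ge_zero[of "f x"] by linarith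
  show "(\<lambda>x. norm (f x)) summable_on A"
  proof (rule nonneg_bdd_above_summable_on)
    show "bdd_above (sum (\<lambda>x. norm (f x)) ` {F. F \<subseteq> A \<and> finite F})"
    proof (rule bdd_aboveI2)
      fix F assume F: "F \<in> {F. F \<subseteq> A \<and> finite F}"
      have "sum (\<lambda>x. norm (f x)) F \<le> sum b F" using F le by (intro sum_mono) auto
      also have "\<dots> \<le> infsum b A" using F b0 by (intro finite_sum_le_infsum b) auto
      finally show "sum (\<lambda>x. norm (f x)) F \<le> infsum b A" .
    qed
  qed auto
qed

lemma has_sum_geometric_nat:
  fixes x :: real
  assumes "0 \<le> x" "x < 1"
  shows "((\<lambda>j::nat. x ^ j) has_sum 1 / (1 - x)) UNIV"
  using geometric_sums[of x] assms by (intro sums_nonneg_imp_has_sum) auto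

text \<open>The two-sided geometric majorant of all Fourier series below.\<close>

lemma has_sum_geometric_int:
  fixes x :: real and c :: int
  assumes "0 \<le> x" "x < 1"
  shows "((\<lambda>k. x ^ nat \<bar>k - c\<bar>) has_sum (1 + x) / (1 - x)) UNIV"
proof -
  have 1: "((\<lambda>k. x ^ nat \<bar>k - c\<bar>) has_sum 1 / (1 - x)) {c..}"
  proof -
    have bij: "bij_betw (\<lambda>j::nat. c + int j) UNIV {c..}"
      by (rule bij_betwI[where g="\<lambda>k. nat (k - c)"]) auto
    show ?thesis
      using has_sum_reindex_bij_betw[OF bij, of "\<lambda>k. x ^ nat \<bar>k - c\<bar>"] has_sum_geometric_nat[OF assms] by simp
  qed
  have 2: "((\<lambda>k. x ^ nat \<bar>k - c\<bar>) has_sum x * (1 / (1 - x))) {..<c}"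
  proof -
    have bij: "bij_betw (\<lambda>j::nat. c - 1 - int j) UNIV {..<c}"
      by (rule bij_betwI[where g="\<lambda>k. nat (c - 1 - k)"]) auto
    have "nat \<bar>c - 1 - int j - c\<bar> = Suc j" for j by auto
    then show ?thesis
      using has_sum_reindex_bij_betw[OF bij, of "\<lambda>k. x ^ nat \<bar>k - c\<bar>"]
        has_sum_cmult_right[OF has_sum_geometric_nat[OF assms], of x] by simp
  qed
  have "((\<lambda>k. x ^ nat \<bar>k - c\<bar>) has_sum (1 / (1 - x) + x * (1 / (1 - x)))) ({c..} \<union> {..<c})"
    by (rule has_sum_Un_disjoint[OF 1 2]) auto
  moreover have "{c..} \<union> {..<c} = UNIV" by auto
  moreover have "1 / (1 - x) + x * (1 / (1 - x)) = (1 + x) / (1 - x)"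
    by (simp add: add_divide_distrib)
  ultimately show ?thesis by simp
qed

text \<open>Folds a sum over all integers into the sum over the positive ones.\<close>

lemma has_sum_int_even:
  fixes g :: "int \<Rightarrow> real"
  assumes g: "(g has_sum S) UNIV" and even: "\<And>k. g (- k) = g k"
  shows "(g has_sum (S - g 0) / 2) {1..}"
proof -
  define a where "a = infsum g {1..}"
  have "g summable_on {1..}" using has_sum_imp_summable[OF g] summable_on_subset_banach by blast
  then have a: "(g has_sum a) {1..}" unfolding a_def by (rule has_sum_infsum)
  have bij: "bij_betw uminus {1..} {..- 1 :: int}"
    by (rule bij_betwI[where g=uminus]) auto
  have b: "(g has_sum a) {..- 1}"
    using has_sum_reindex_bij_betw[OF bij, of g a] a by (simp add: even)
  have ab: "(g has_sum a + a) ({1..} \<union> {..- 1})"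
    by (rule has_sum_Un_disjoint[OF a b]) auto
  have z: "(g has_sum g 0) {0}" using has_sum_finite[of "{0}" g] by simp
  have "(g has_sum g 0 + (a + a)) ({0} \<union> ({1..} \<union> {..- 1}))"
    by (rule has_sum_Un_disjoint[OF z ab]) auto
  moreover have "{0} \<union> ({1..} \<union> {..- 1}) = (UNIV :: int set)" by auto
  ultimately have "S = g 0 + (a + a)" using has_sum_unique[OF g] by simp
  then show ?thesis using a by simp
qed

text \<open>Separates the leading terms of a series from a geometrically dominated rest.\<close>

lemma abs_has_sum_nat_tail_le:
  fixes t :: "nat \<Rightarrow> real"
  assumes S: "(t has_sum S) UNIV" and t: "\<And>j. \<bar>t (j + n)\<bar> \<le> C * x ^ j" and x: "0 \<le> x" "x < 1"
  shows "\<bar>S - (\<Sum>j<n. t j)\<bar> \<le> C / (1 - x)"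
proof -
  have 1: "(\<lambda>j. t (j + n)) sums (S - (\<Sum>j<n. t j))"
    using sums_split_initial_segment[OF has_sum_imp_sums[OF S]] .
  have 2: "(\<lambda>j. C * x ^ j) sums (C * (1 / (1 - x)))"
    by (intro sums_mult geometric_sums) (use x in simp)
  have "norm (S - (\<Sum>j<n. t j)) \<le> C * (1 / (1 - x))"
    by (rule norm_sums_le[OF 1 2]) (use t in simp)
  then show ?thesis by simp
qed

lemma abs_has_sum_int_le:
  fixes g :: "int \<Rightarrow> real"
  assumes S: "(g has_sum S) A" and g: "\<And>k. k \<in> A \<Longrightarrow> \<bar>g k\<bar> \<le> C * x ^ nat \<bar>k - c\<bar>" and x: "0 \<le> x" "x < 1" and C: "0 \<le> C"
  shows "\<bar>S\<bar> \<le> C * ((1 + x) / (1 - x))"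
proof -
  have 1: "((\<lambda>k. if k \<in> A then g k else 0) has_sum S) UNIV"
  proof -
    have "(g has_sum S) A \<longleftrightarrow> ((\<lambda>k. if k \<in> A then g k else 0) has_sum S) UNIV"
      by (rule has_sum_cong_neutral) auto
    then show ?thesis using S by blast
  qed
  have 2: "((\<lambda>k. C * x ^ nat \<bar>k - c\<bar>) has_sum C * ((1 + x) / (1 - x))) UNIV"
    by (intro has_sum_cmult_right has_sum_geometric_int) (use x in auto)
  have "norm S \<le> C * ((1 + x) / (1 - x))"
    by (rule norm_infsum_le[OF 1 2]) (use g C x in auto)
  then show ?thesis by simp
qed

lemma relative_error_le:
  fixes x y c :: real
  assumes "c \<noteq> 0" "\<bar>x - y\<bar> \<le> B" "\<bar>y - c\<bar> \<le> D" "B + D \<le> \<epsilon> * \<bar>c\<bar>"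
  shows "\<bar>x / c - 1\<bar> \<le> \<epsilon>"
proof -
  have "\<bar>x / c - 1\<bar> = \<bar>x - c\<bar> / \<bar>c\<bar>" using assms(1) by (simp add: diff_divide_distrib flip: abs_divide)
  also have "\<dots> \<le> (\<epsilon> * \<bar>c\<bar>) / \<bar>c\<bar>" by (rule divide_right_mono) (use assms in linarith)+
  finally show ?thesis using assms(1) by simp
qed

text \<open>The form of all main harmonics: \<open>t\<close> is the principal term, \<open>M\<close> its claimed size, \<open>u\<close> the relative
  error of the orbit factor, \<open>1 + \<delta>\<close> that of the oscillatory integral, and \<open>r\<close> bounds the other terms.\<close>

lemma relative_error_product:
  fixes A t rest M u \<delta> a d r :: real
  assumes M: "M \<noteq> 0" and A: "\<bar>A - t\<bar> \<le> r * \<bar>M\<bar>" and t: "t = M * (u * (1 + \<delta>))"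
    and u: "\<bar>u - 1\<bar> \<le> a" and d: "\<bar>\<delta>\<bar> \<le> d" and "a \<le> 1"
  shows "\<bar>A / M - 1\<bar> \<le> a + 2 * d + r"
proof (rule relative_error_le)
  show "\<bar>A - t\<bar> \<le> r * \<bar>M\<bar>" by fact
  have "\<bar>u * (1 + \<delta>) - 1\<bar> = \<bar>(u - 1) + u * \<delta>\<bar>" by (simp add: algebra_simps)
  also have "\<dots> \<le> \<bar>u - 1\<bar> + \<bar>u\<bar> * \<bar>\<delta>\<bar>" unfolding abs_mult[symmetric] by (rule abs_triangle_ineq)
  also have "\<dots> \<le> a + 2 * d"
    using u d assms(6) by (intro add_mono mult_mono) auto
  finally have "\<bar>M\<bar> * \<bar>u * (1 + \<delta>) - 1\<bar> \<le> \<bar>M\<bar> * (a + 2 * d)" by (intro mult_left_mono) auto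
  moreover have "t - M = M * (u * (1 + \<delta>) - 1)" by (simp add: t algebra_simps)
  ultimately show "\<bar>t - M\<bar> \<le> (a + 2 * d) * \<bar>M\<bar>" by (simp add: abs_mult mult.commute)
  show "r * \<bar>M\<bar> + (a + 2 * d) * \<bar>M\<bar> \<le> (a + 2 * d + r) * \<bar>M\<bar>" by (simp add: algebra_simps)
qed fact

text \<open>A continuous periodic function that is orthogonal to all characters. The aim is that it vanishes.\<close>

definition fourier_null :: "(real \<Rightarrow> complex) \<Rightarrow> bool" where
  "fourier_null g \<longleftrightarrow> continuous_on UNIV g \<and> (\<forall>t. g (t + 2*pi) = g t) \<and>
     (\<forall>q::int. integral {0..2*pi} (\<lambda>t. g t * cis (of_int q * t)) = 0)"

lemma continuous_on_cis_mult: "continuous_on A (\<lambda>t. cis (c * t))"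
  unfolding cis_conv_exp by (intro continuous_intros)

lemma fourier_null_add:
  assumes "fourier_null g" "fourier_null h"
  shows "fourier_null (\<lambda>t. g t + h t)"
proof -
  have "integral {0..2*pi} (\<lambda>t. (g t + h t) * cis (of_int q * t)) = 0" for q :: int
  proof -
    have "(\<lambda>t. g t * cis (of_int q * t)) integrable_on {0..2*pi}" "(\<lambda>t. h t * cis (of_int q * t)) integrable_on {0..2*pi}"
      using assms unfolding fourier_null_def
      by (auto intro!: integrable_continuous_real continuous_intros continuous_on_cis_mult elim: continuous_on_subset)
    then show ?thesis
      using assms by (simp add: fourier_null_def distrib_right Henstock_Kurzweil_Integration.integral_add)
  qed
  then show ?thesis using assms unfolding fourier_null_def by (auto intro!: continuous_intros)
qed

lemma fourier_null_cmult: "fourier_null g \<Longrightarrow> fourier_null (\<lambda>t. c * g t)"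
  unfolding fourier_null_def by (auto intro!: continuous_intros simp: mult.assoc)

lemma fourier_null_cis_mult:
  assumes "fourier_null g"
  shows "fourier_null (\<lambda>t. cis (of_int p * t) * g t)"
proof -
  have "(cis (of_int p * t) * g t) * cis (of_int q * t) = g t * cis (of_int (p + q) * t)" for q :: int and t
  proof -
    have "of_int (p + q) * t = of_int p * t + of_int q * t" by (simp add: distrib_right)
    then show ?thesis by (simp only: cis_mult[symmetric] mult_ac)
  qed
  then have "integral {0..2*pi} (\<lambda>t. (cis (of_int p * t) * g t) * cis (of_int q * t)) = 0" for q :: int
    using assms by (simp only: fourier_null_def)
  moreover have "cis (of_int p * (t + 2*pi)) = cis (of_int p * t)" for t
  proof -
    have "cis (of_int p * (2*pi)) = 1" by (metis cis_multiple_2pi mult.commute Ints_of_int)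
    then show ?thesis by (simp add: distrib_left cis_mult[symmetric])
  qed
  ultimately show ?thesis
    using assms unfolding fourier_null_def
    by (auto intro!: continuous_intros continuous_on_cis_mult)
qed

text \<open>Since \<open>cos t\<close> and \<open>sin t\<close> are combinations of \<open>cis t\<close> and \<open>cis (- t)\<close>, multiplication by a polynomial
  on the circle permutes and combines the vanishing Fourier integrals.\<close>

lemma fourier_null_real_polynomial:
  fixes p :: "complex \<Rightarrow> real"
  assumes "real_polynomial_function p"
  shows "\<forall>g. fourier_null g \<longrightarrow> fourier_null (\<lambda>t. of_real (p (cis t)) * g t)"
  using assms
proof (induction rule: real_polynomial_function.induct)
  case (linear p)
  interpret p: bounded_linear p by fact
  have p: "complex_of_real (p (cis t)) =
      (of_real (p 1) - \<i> * of_real (p \<i>)) / 2 * cis t + (of_real (p 1) + \<i> * of_real (p \<i>)) / 2 * cis (- t)" for t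
  proof -
    have "cis t = cos t *\<^sub>R 1 + sin t *\<^sub>R \<i>" by (simp add: complex_eq_iff)
    then have "p (cis t) = cos t * p 1 + sin t * p \<i>" by (metis p.add p.scaleR real_scaleR_def)
    then show ?thesis by (simp add: complex_eq_iff field_simps)
  qed
  show ?case
  proof (intro allI impI)
    fix g assume g: "fourier_null g"
    have "fourier_null (\<lambda>t. (of_real (p 1) - \<i> * of_real (p \<i>)) / 2 * (cis (of_int 1 * t) * g t)
       + (of_real (p 1) + \<i> * of_real (p \<i>)) / 2 * (cis (of_int (-1) * t) * g t))"
      by (intro fourier_null_add fourier_null_cmult fourier_null_cis_mult g)
    then show "fourier_null (\<lambda>t. of_real (p (cis t)) * g t)"
      by (simp add: p distrib_right mult.assoc)
  qed
next
  case (const c)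
  then show ?case using fourier_null_cmult by blast
next
  case (add p1 p2)
  then show ?case using fourier_null_add by (simp add: distrib_right)
next
  case (mult p1 p2)
  show ?case
  proof (intro allI impI)
    fix g assume "fourier_null g"
    with mult.IH have "fourier_null (\<lambda>t. of_real (p1 (cis t)) * (of_real (p2 (cis t)) * g t))" by blast
    then show "fourier_null (\<lambda>t. of_real (p1 (cis t) * p2 (cis t)) * g t)" by (simp add: mult.assoc)
  qed
qed

text \<open>Continuity of the function on the circle follows from compactness of its graph, which is the image of
  a period; this avoids the cut of the argument function.\<close>

lemma periodic_on_circle:
  fixes u :: "real \<Rightarrow> real"
  assumes cont: "continuous_on UNIV u" and per: "\<And>t. u (t + 2*pi) = u t"
  obtains U where "continuous_on (sphere 0 1) U" "\<And>t. t \<in> {0..2*pi} \<Longrightarrow> U (cis t) = u t"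
proof
  define U where "U = (\<lambda>z. u (Arg2pi z))"
  show U: "U (cis t) = u t" if "t \<in> {0..2*pi}" for t
  proof (cases "t = 2*pi")
    case True
    have "Arg2pi 1 = 0" by (rule Arg2pi_unique[of 1]) auto
    then show ?thesis using True per[of 0] by (simp add: U_def)
  next
    case False
    then have "Arg2pi (cis t) = t" using that by (intro Arg2pi_unique[of 1]) (auto simp: cis_conv_exp)
    then show ?thesis by (simp add: U_def)
  qed
  have surj: "\<exists>t\<in>{0..2*pi}. z = cis t" if "z \<in> sphere 0 1" for z
  proof -
    have "z = cis (Arg2pi z)" using that Arg2pi_eq[of z] by (simp add: cis_conv_exp)
    then show ?thesis using Arg2pi[of z] by (intro bexI[of _ "Arg2pi z"]) auto
  qed
  have graph: "(\<lambda>z. (z, U z)) ` sphere 0 1 = (\<lambda>t. (cis t, u t)) ` {0..2*pi}"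
  proof (rule set_eqI, rule iffI)
    fix w assume "w \<in> (\<lambda>z. (z, U z)) ` sphere 0 1"
    then obtain z where z: "z \<in> sphere 0 1" "w = (z, U z)" by blast
    with surj obtain t where "t \<in> {0..2*pi}" "z = cis t" by blast
    then show "w \<in> (\<lambda>t. (cis t, u t)) ` {0..2*pi}" using z U by auto
  next
    fix w assume "w \<in> (\<lambda>t. (cis t, u t)) ` {0..2*pi}"
    then obtain t where "t \<in> {0..2*pi}" "w = (cis t, u t)" by blast
    then show "w \<in> (\<lambda>z. (z, U z)) ` sphere 0 1" using U by (intro image_eqI[of _ _ "cis t"]) auto
  qed
  have cu: "continuous_on A u" for A using cont continuous_on_subset by blast
  have "continuous_on {0..2*pi} (\<lambda>t. (cis t, u t))"
    using continuous_on_cis_mult[of "{0..2*pi}" 1] by (intro continuous_on_Pair cu) simp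
  then have "compact ((\<lambda>z. (z, U z)) ` sphere 0 1)"
    unfolding graph by (rule compact_continuous_image) simp
  then have cl: "closed ((\<lambda>z. (z, U z)) ` sphere 0 1)" by (rule compact_imp_closed)
  have "U \<in> sphere 0 1 \<rightarrow> u ` {0..2*pi}"
  proof
    fix z :: complex assume "z \<in> sphere 0 1"
    with surj U show "U z \<in> u ` {0..2*pi}" by (metis image_eqI)
  qed
  moreover have "compact (u ` {0..2*pi})" by (rule compact_continuous_image[OF cu]) simp
  ultimately show "continuous_on (sphere 0 1) U"
    using cl by (intro continuous_from_closed_graph)
qed

text \<open>By Stone-Weierstrass the real part \<open>u\<close> is a uniform limit of polynomials on the circle, and \<open>u\<close> is
  orthogonal to each of them; hence the integral of \<open>u\<^sup>2\<close> is arbitrarily small.\<close>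

lemma fourier_null_Re:
  assumes g: "fourier_null g" and t: "t \<in> {0..2*pi}"
  shows "Re (g t) = 0"
proof -
  define u where "u = (\<lambda>t. Re (g t))"
  have gc: "continuous_on UNIV g" using g by (simp add: fourier_null_def)
  have uc: "continuous_on UNIV u" unfolding u_def by (intro continuous_intros gc)
  have uc': "continuous_on A u" for A using uc continuous_on_subset by blast
  have "u (t + 2*pi) = u t" for t using g by (simp add: fourier_null_def u_def)
  then obtain U where U: "continuous_on (sphere 0 1) U" "\<And>t. t \<in> {0..2*pi} \<Longrightarrow> U (cis t) = u t"
    using periodic_on_circle[OF uc] by blast
  have cis01: "cis s \<in> sphere 0 1" for s by simp
  obtain M where M: "\<And>s. s \<in> {0..2*pi} \<Longrightarrow> \<bar>u s\<bar> \<le> M" "0 \<le> M"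
  proof -
    have "bounded (u ` {0..2*pi})" by (rule compact_imp_bounded[OF compact_continuous_image[OF uc']]) simp
    then obtain M where "\<forall>x\<in>u ` {0..2*pi}. norm x \<le> M" by (auto simp: bounded_iff)
    then have "\<bar>u s\<bar> \<le> \<bar>M\<bar>" if "s \<in> {0..2*pi}" for s using that by force
    then show ?thesis by (intro that[of "\<bar>M\<bar>"]) auto
  qed
  have le: "integral {0..2*pi} (\<lambda>s. (u s)\<^sup>2) \<le> (M * e) * (2*pi - 0)" if e: "0 < e" for e
  proof -
    obtain p where p: "real_polynomial_function p" "\<And>x. x \<in> sphere 0 1 \<Longrightarrow> \<bar>U x - p x\<bar> < e"
      using Stone_Weierstrass_real_polynomial_function[OF compact_sphere U(1) e] by blast
    have pc: "continuous_on A (\<lambda>s. p (cis s))" for A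
    proof (rule continuous_on_compose2[of UNIV p])
      show "continuous_on UNIV p"
        using p(1) by (intro continuous_on_polymonial_function) (simp add: real_polynomial_function_eq)
      show "continuous_on A cis" using continuous_on_cis_mult[of A 1] by simp
    qed auto
    have "fourier_null (\<lambda>s. of_real (p (cis s)) * g s)" using fourier_null_real_polynomial[OF p(1)] g by blast
    then have 0: "integral {0..2*pi} (\<lambda>s. of_real (p (cis s)) * g s) = 0"
      unfolding fourier_null_def by (auto dest!: spec[of _ "0::int"])
    have "(\<lambda>s. complex_of_real (p (cis s)) * g s) integrable_on {0..2*pi}"
      by (intro integrable_continuous_real continuous_intros pc continuous_on_subset[OF gc]) auto
    then have "integral {0..2*pi} (\<lambda>s. Re (of_real (p (cis s)) * g s)) = 0"
      using 0 integral_linear[OF _ bounded_linear_Re, of "\<lambda>s. complex_of_real (p (cis s)) * g s" "{0..2*pi}"]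
      by (simp add: o_def)
    then have 1: "integral {0..2*pi} (\<lambda>s. p (cis s) * u s) = 0" by (simp add: u_def)
    have "integral {0..2*pi} (\<lambda>s. (u s)\<^sup>2) = integral {0..2*pi} (\<lambda>s. u s * (u s - p (cis s)) + p (cis s) * u s)"
      by (simp add: power2_eq_square algebra_simps)
    also have "\<dots> = integral {0..2*pi} (\<lambda>s. u s * (u s - p (cis s)))"
      by (subst Henstock_Kurzweil_Integration.integral_add) (auto intro!: integrable_continuous_real continuous_intros pc uc' simp: 1)
    also have "\<dots> \<le> norm \<dots>" by simp
    also have "\<dots> \<le> (M * e) * (2*pi - 0)"
    proof (rule integral_bound)
      fix s assume s: "s \<in> {0..2*pi}"
      have "\<bar>u s - p (cis s)\<bar> \<le> e" using p(2)[OF cis01[of s]] U(2)[OF s] by simp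
      then show "norm (u s * (u s - p (cis s))) \<le> M * e"
        using M(1)[OF s] M(2) by (auto simp: abs_mult intro!: mult_mono)
    qed (auto intro!: continuous_intros pc uc')
    finally show ?thesis .
  qed
  have "integral {0..2*pi} (\<lambda>s. (u s)\<^sup>2) \<le> 0"
  proof (rule field_le_epsilon)
    fix d :: real assume "0 < d"
    have "integral {0..2*pi} (\<lambda>s. (u s)\<^sup>2) \<le> (M * (d / (2*pi*(M+1)))) * (2*pi - 0)"
      by (rule le) (use \<open>0 < d\<close> M(2) in auto)
    also have "\<dots> = d * (M / (M + 1))"
    proof -
      have "M + 1 \<noteq> 0" using M(2) by simp
      then show ?thesis by (simp add: divide_simps)
    qed
    also have "\<dots> \<le> d * 1" using M(2) \<open>0 < d\<close> by (intro mult_left_mono) auto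
    finally show "integral {0..2*pi} (\<lambda>s. (u s)\<^sup>2) \<le> 0 + d" by simp
  qed
  moreover have "integral {0..2*pi} (\<lambda>s. (u s)\<^sup>2) \<ge> 0"
    by (intro integral_nonneg integrable_continuous_real continuous_intros uc') auto
  ultimately have "integral {0..2*pi} (\<lambda>s. (u s)\<^sup>2) = 0" by simp
  moreover have "(\<lambda>s. (u s)\<^sup>2) integrable_on {0..2*pi}"
    by (intro integrable_continuous_real continuous_intros uc')
  ultimately have i0: "((\<lambda>s. (u s)\<^sup>2) has_integral 0) (cbox 0 (2*pi))"
    using integrable_integral by fastforce
  have "(u t)\<^sup>2 = 0"
    by (rule has_integral_0_cbox_imp_0[OF _ _ i0]) (use t pi_gt_zero in \<open>auto intro!: continuous_intros uc' simp: not_le\<close>)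
  then show ?thesis by (simp add: u_def)
qed

text \<open>The imaginary part of \<open>g\<close> is the real part of \<open>- \<i> g\<close>, and the class is closed under constant
  multiples.\<close>

lemma fourier_null_imp_zero:
  assumes g: "fourier_null g"
  shows "g t = 0"
proof -
  have *: "g t = 0" if "t \<in> {0..2*pi}" for t
    using fourier_null_Re[OF g that] fourier_null_Re[OF fourier_null_cmult[OF g, of "- \<i>"] that]
    by (simp add: complex_eq_iff)
  interpret periodic_fun_simple g "2*pi"
    by unfold_locales (use g in \<open>simp add: fourier_null_def\<close>)
  define k where "k = \<lfloor>t / (2*pi)\<rfloor>"
  have "of_int k \<le> t / (2*pi)" "t / (2*pi) < of_int k + 1" unfolding k_def by linarith+
  then have "t - of_int k * (2*pi) \<in> {0..2*pi}" by (auto simp: field_simps)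
  then have "g (t - of_int k * (2*pi)) = 0" by (rule *)
  then show ?thesis using minus_of_int[of t k] by simp
qed

text \<open>The summable series defines a continuous function with the same Fourier coefficients as \<open>g\<close>, so the
  difference is orthogonal to all characters.\<close>

theorem fourier_series_has_sum:
  fixes g :: "real \<Rightarrow> complex" and c :: "int \<Rightarrow> complex"
  assumes cont: "continuous_on UNIV g" and per: "\<And>t. g (t + 2*pi) = g t"
    and c: "\<And>q. integral {0..2*pi} (\<lambda>t. g t * cis (- (of_int q * t))) = 2 * pi * c q"
    and b: "b summable_on UNIV" "\<And>q. norm (c q) \<le> b q"
  shows "((\<lambda>q. c q * cis (of_int q * t)) has_sum g t) UNIV"
proof -
  define S where "S = (\<lambda>t. \<Sum>\<^sub>\<infinity>q. c q * cis (of_int q * t))"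
  have b0: "0 \<le> b q" for q using b(2)[of q] norm_ge_zero order_trans by blast
  have "(\<lambda>q. c q * cis (of_int q * t)) summable_on UNIV" for t
    by (rule summable_on_dominated[OF b(1)]) (simp add: norm_mult b(2))
  then have S: "((\<lambda>q. c q * cis (of_int q * t)) has_sum S t) UNIV" for t
    unfolding S_def by (rule has_sum_infsum)
  have Sc: "continuous_on UNIV S"
  proof -
    have "isCont S t" for t
    proof -
      have "continuous_on {t-1..t+1} S"
        by (rule has_sum_integral_interval(1)[OF S _ b(1)])
           (auto intro!: continuous_intros continuous_on_cis_mult b0 simp: norm_mult b(2))
      then show ?thesis by (rule continuous_on_interior) simp
    qed
    then show ?thesis by (simp add: continuous_on_eq_continuous_at)
  qed
  have cisp: "cis (of_int q * (t + 2*pi)) = cis (of_int q * t)" for q :: int and t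
  proof -
    have "cis (of_int q * (2*pi)) = 1" by (metis cis_multiple_2pi mult.commute Ints_of_int)
    then show ?thesis by (simp add: distrib_left cis_mult[symmetric])
  qed
  have Sper: "S (t + 2*pi) = S t" for t unfolding S_def cisp ..
  have coef: "integral {0..2*pi} (\<lambda>t. S t * cis (of_int p * t)) = 2 * pi * c (- p)" for p :: int
  proof -
    have "((\<lambda>q. integral {0..2*pi} (\<lambda>t. c q * cis (of_int q * t) * cis (of_int p * t))) has_sum
        integral {0..2*pi} (\<lambda>t. S t * cis (of_int p * t))) UNIV"
      by (rule has_sum_integral_interval(2)[OF has_sum_cmult_left[OF S] _ b(1)])
         (auto intro!: continuous_intros continuous_on_cis_mult b0 simp: norm_mult b(2))
    moreover have "integral {0..2*pi} (\<lambda>t. c q * cis (of_int q * t) * cis (of_int p * t)) = (if q = - p then 2 * pi * c q else 0)" for q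
    proof -
      have "c q * cis (of_int q * t) * cis (of_int p * t) = c q * cis (of_int (q + p) * t)" for t
        by (simp add: mult.assoc cis_mult distrib_right)
      then have "integral {0..2*pi} (\<lambda>t. c q * cis (of_int q * t) * cis (of_int p * t)) = c q * integral {0..2*pi} (\<lambda>t. cis (of_int (q + p) * t))"
        by (simp only: Henstock_Kurzweil_Integration.integral_mult_right)
      also have "\<dots> = (if q = - p then 2 * pi * c q else 0)"
        unfolding integral_cis_period by auto
      finally show ?thesis .
    qed
    ultimately have "((\<lambda>q. if q = - p then 2 * pi * c q else 0) has_sum integral {0..2*pi} (\<lambda>t. S t * cis (of_int p * t))) UNIV"
      by simp
    moreover have "((\<lambda>q. if q = - p then 2 * pi * c q else 0) has_sum 2 * pi * c (-p)) UNIV"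
      by (rule has_sum_finite_neutralI[of "{-p}"]) auto
    ultimately show ?thesis by (rule has_sum_unique)
  qed
  have "fourier_null (\<lambda>t. g t - S t)"
    unfolding fourier_null_def
  proof (intro conjI allI)
    show "continuous_on UNIV (\<lambda>t. g t - S t)" by (intro continuous_intros cont Sc)
    show "g (t + 2*pi) - S (t + 2*pi) = g t - S t" for t by (simp add: per Sper)
    fix q :: int
    have "integral {0..2*pi} (\<lambda>t. (g t - S t) * cis (of_int q * t))
       = integral {0..2*pi} (\<lambda>t. g t * cis (of_int q * t)) - integral {0..2*pi} (\<lambda>t. S t * cis (of_int q * t))"
      unfolding left_diff_distrib
      by (rule Henstock_Kurzweil_Integration.integral_diff)
         (intro integrable_continuous_real continuous_intros continuous_on_cis_mult continuous_on_subset[OF cont] continuous_on_subset[OF Sc]; simp)+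
    also have "\<dots> = 0" using coef[of q] c[of "-q"] by simp
    finally show "integral {0..2*pi} (\<lambda>t. (g t - S t) * cis (of_int q * t)) = 0" .
  qed
  then have "g t - S t = 0" by (rule fourier_null_imp_zero)
  then show ?thesis using S[of t] by simp
qed

text \<open>The mean value inequality on the segment from 0 to \<open>z\<close>. Keeping only the positive part of the real
  part matters at the saddle point, where \<open>z\<close> is large but its real part is dominated by a Gaussian.\<close>

lemma norm_exp_minus_one_le: "norm (exp z - 1) \<le> exp (max 0 (Re z)) * norm z" for z :: complex
proof -
  have "norm (exp z - exp 0) \<le> exp (max 0 (Re z)) * norm (z - 0)"
  proof (rule field_differentiable_bound[where f'=exp and S="closed_segment 0 z"])
    fix w assume "w \<in> closed_segment 0 z"
    then obtain u where "0 \<le> u" "u \<le> 1" "w = u *\<^sub>R z" by (auto simp: closed_segment_def)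
    moreover then have "u * Re z \<le> max 0 (Re z)"
      by (cases "Re z \<ge> 0") (auto simp: mult_left_le_one_le mult_nonneg_nonpos)
    ultimately show "norm (exp w) \<le> exp (max 0 (Re z))" by simp
    show "(exp has_field_derivative exp w) (at w within closed_segment 0 z)"
      by (rule has_field_derivative_at_within[OF DERIV_exp])
  qed auto
  then show ?thesis by simp
qed

lemma norm_exp_minus_one_le_double:
  fixes z :: complex
  assumes "norm z \<le> 1/2"
  shows "norm (exp z - 1) \<le> 2 * norm z"
proof -
  have "max 0 (Re z) \<le> 1/2" using complex_Re_le_cmod[of z] assms by simp
  then have "exp (max 0 (Re z)) \<le> exp (1/2)" by simp
  also have "\<dots> \<le> 2" using exp_bound_half[of "1/2::real"] by simp
  finally show ?thesis using norm_exp_minus_one_le[of z] mult_right_mono[of "exp (max 0 (Re z))" 2 "norm z"] by simp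
qed

text \<open>Turns the parabola's angle \<open>2 arctan \<tau>\<close>, and later the half-angle formula for the true anomaly, into
  rational functions.\<close>

lemma cis_double_arctan: "cis (2 * arctan x) = (1 + \<i> * x) / (1 - \<i> * x)"
proof -
  define s where "s = sqrt (1 + x\<^sup>2)"
  have s: "s > 0" "s\<^sup>2 = 1 + x\<^sup>2" by (auto simp: s_def add_pos_nonneg)
  have "cis (arctan x) = (1 + \<i> * x) / s"
    by (simp add: complex_eq_iff cos_arctan sin_arctan s_def)
  moreover have "cis (2 * arctan x) = (cis (arctan x))\<^sup>2" by (simp add: power2_eq_square cis_mult)
  moreover have "((1 + \<i> * x) / s)\<^sup>2 = (1 + \<i> * x) / (1 - \<i> * x)"
  proof -
    have n: "1 - \<i> * x \<noteq> 0" by (simp add: complex_eq_iff)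
    have "(of_real s)\<^sup>2 = (1 + \<i> * x) * (1 - \<i> * x)"
      using s(2) by (simp add: complex_eq_iff power2_eq_square flip: of_real_power)
    then show ?thesis using n s(1) by (simp add: power_divide power2_eq_square divide_simps)
  qed
  ultimately show ?thesis by simp
qed

section \<open>Fourier coefficients of the elliptic motion\<close>

text \<open>The bound is what \<open>G \<ge> 32\<close> and \<open>e G \<le> 1/8\<close> give for the eccentricity.\<close>

locale small_eccentricity =
  fixes e :: real
  assumes e_pos: "0 < e" and e_small: "e \<le> 1/256"
begin

text \<open>With \<open>E\<close> the eccentric anomaly, the position on the ellipse of semi-major axis 1 is
  \<open>a * cis E * (1 - b * cis (- E))\<^sup>2\<close> and the radius is \<open>a * (1 - b * cis E) * (1 - b * cis (- E))\<close>. These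
  factorisations make every monomial in the position a product of binomials in \<open>cis E\<close>.\<close>

definition a :: real where "a = (1 + sqrt (1 - e\<^sup>2)) / 2"
definition b :: real where "b = e / (1 + sqrt (1 - e\<^sup>2))"

lemma e_square_small: "e\<^sup>2 \<le> e / 256" "e\<^sup>2 \<le> 1/65536" "0 < e\<^sup>2"
proof -
  show "e\<^sup>2 \<le> e / 256" using e_pos e_small by (simp add: power2_eq_square)
  then show "e\<^sup>2 \<le> 1/65536" using e_small by simp
  show "0 < e\<^sup>2" using e_pos by simp
qed

lemma a_bounds: "1 - e\<^sup>2 / 2 \<le> a" "a < 1" "0 < a"
proof -
  have "1 - e\<^sup>2 \<le> sqrt (1 - e\<^sup>2)"
    using e_square_small by (intro real_le_rsqrt) (simp add: power2_eq_square mult_left_le)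
  then show 1: "1 - e\<^sup>2 / 2 \<le> a" by (simp add: a_def)
  show "a < 1" using e_square_small e_pos by (simp add: a_def)
  show "0 < a" using 1 e_square_small by simp
qed

lemma ab: "2 * a * b = e" and a_b_sq: "a * (1 + b\<^sup>2) = 1"
proof -
  have p: "1 + sqrt (1 - e\<^sup>2) > 0" using e_square_small by (simp add: add_pos_nonneg)
  show 1: "2 * a * b = e" using p by (simp add: a_def b_def)
  have "2 * a - 1 = sqrt (1 - e\<^sup>2)" unfolding a_def by (simp add: field_simps)
  then have "(2 * a - 1)\<^sup>2 = 1 - e\<^sup>2" using e_square_small by simp
  then have "4 * a * (1 - a) = e\<^sup>2" by (simp add: power2_eq_square algebra_simps)
  also have "\<dots> = (2 * a * b)\<^sup>2" by (simp only: 1)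
  also have "\<dots> = 4 * a * (a * b\<^sup>2)" by (simp add: power2_eq_square)
  finally have "1 - a = a * b\<^sup>2" using a_bounds by simp
  then show "a * (1 + b\<^sup>2) = 1" by (simp add: distrib_left)
qed

lemma b_eq: "b = e / (2 * a)" using ab a_bounds by (simp add: field_simps)

lemma b_bounds: "0 < b" "b \<le> 51/100 * e" "b < 1"
proof -
  show "0 < b" using a_bounds e_pos by (simp add: b_eq)
  have "e / (2 * a) \<le> e / (100/51)"
    using a_bounds e_pos e_square_small by (intro divide_left_mono) auto
  then show 1: "b \<le> 51/100 * e" by (simp add: b_eq)
  then show "b < 1" using e_small by simp
qed

text \<open>The circles of radius \<open>e\<close> and \<open>1 / e\<close> are used below; on them \<open>b z\<close> and \<open>b / z\<close> have size at most
  \<open>b / e\<close>, which is about one half.\<close>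

lemma b_ratio: "(1 + b / e)\<^sup>2 \<le> 5/2" "b * e \<le> b / e" "b / e \<le> 51/100"
proof -
  show 1: "b / e \<le> 51/100" using b_bounds e_pos by (simp add: field_simps)
  have "(1 + b / e)\<^sup>2 \<le> (151/100)\<^sup>2" using b_bounds e_pos 1 by (intro power_mono) auto
  also have "\<dots> \<le> 5/2" by (simp add: power2_eq_square)
  finally show "(1 + b / e)\<^sup>2 \<le> 5/2" .
  have "b * e * e \<le> b * 1" using b_bounds e_square_small unfolding mult.assoc
    by (intro mult_left_mono) (auto simp: power2_eq_square)
  then show "b * e \<le> b / e" using e_pos by (simp add: field_simps)
qed

text \<open>On \<open>z = cis E\<close> this is \<open>(1 - e * cos E) * conj(p)^l * p^m * cis (- q * M)\<close>, with \<open>p\<close> the position and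
  \<open>M = E - e * sin E\<close> the mean anomaly. The factor \<open>1 - e * cos E\<close> is \<open>dM/dE\<close>, so the mean over the circle
  is the \<open>q\<close>-th Fourier coefficient in time of \<open>conj(p)^l * p^m\<close>.\<close>

definition orbit_kernel :: "int \<Rightarrow> nat \<Rightarrow> nat \<Rightarrow> complex \<Rightarrow> complex" where
  "orbit_kernel q l m z = of_real a ^ (l + m + 1) * z powi (int m - int l - q)
     * (1 - of_real b * z) ^ (2 * l + 1) * (1 - of_real b / z) ^ (2 * m + 1)
     * exp (of_int q * of_real e / 2 * (z - 1 / z))"

definition orbit_coeff :: "int \<Rightarrow> nat \<Rightarrow> nat \<Rightarrow> complex" where
  "orbit_coeff q l m = circle_mean (orbit_kernel q l m)"

lemma holomorphic_orbit_kernel: "orbit_kernel q l m holomorphic_on -{0}"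
  unfolding orbit_kernel_def[abs_def] by (intro holomorphic_intros) auto

lemma orbit_coeff_real: "Im (orbit_coeff q l m) = 0"
  unfolding orbit_coeff_def
  by (rule circle_mean_real) (simp add: orbit_kernel_def exp_cnj)

lemma orbit_coeff_swap: "orbit_coeff (- q) m l = orbit_coeff q l m"
proof -
  have "orbit_coeff (- q) m l = circle_mean (\<lambda>z. orbit_kernel (- q) m l (inverse z))"
    unfolding orbit_coeff_def by (rule circle_mean_inverse[symmetric])
  also have "\<dots> = circle_mean (orbit_kernel q l m)"
  proof (rule circle_mean_cong)
    fix z :: complex assume "norm z = 1"
    then have z: "z \<noteq> 0" by auto
    have eq: "int m - int l - q = - (int l - int m - - q)" by simp
    have 1: "inverse z powi (int l - int m - - q) = z powi (int m - int l - q)"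
      by (simp only: eq power_int_minus power_int_inverse)
    have 2: "of_int (- q) * of_real e / 2 * (inverse z - 1 / inverse z) = of_int q * complex_of_real e / 2 * (z - 1 / z)"
      using z by (simp add: field_simps)
    have 3: "1 - of_real b * inverse z = 1 - of_real b / z" "1 - of_real b / inverse z = 1 - of_real b * z"
      by (simp_all add: divide_inverse)
    show "orbit_kernel (- q) m l (inverse z) = orbit_kernel q l m z"
      unfolding orbit_kernel_def 1 2 3 by (simp only: add.commute[of m l] mult_ac)
  qed
  finally show ?thesis by (simp add: orbit_coeff_def)
qed

text \<open>The integer power of \<open>z\<close> in the kernel has exponent \<open>n = m - l - q\<close>. Moving the circle to radius \<open>e\<close> for
  \<open>n \<ge> 0\<close> and to radius \<open>1 / e\<close> for \<open>n < 0\<close> turns it into \<open>e\<close> to the power \<open>\<bar>n\<bar>\<close>, while each of the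
  remaining factors stays bounded. This is the reason why a harmonic \<open>(q, k)\<close> is small with \<open>\<bar>q + k\<bar>\<close>.\<close>

lemma orbit_coeff_bound:
  "norm (orbit_coeff q l m) \<le> (5/2) ^ (l + m + 1) * e ^ nat \<bar>int m - int l - q\<bar> * exp \<bar>real_of_int q\<bar>"
proof -
  define n where "n = int m - int l - q"
  \<comment> \<open>The radius for which the integer power of \<open>z\<close> is smallest within the range where the other factors stay bounded.\<close>
  define \<rho> where "\<rho> = (if n \<ge> 0 then e else 1 / e)"
  have \<rho>: "\<rho> > 0" using e_pos by (simp add: \<rho>_def)
  have pw: "\<rho> powi n = e ^ nat \<bar>n\<bar>"
    using e_pos by (simp add: \<rho>_def power_int_def power_inverse inverse_eq_divide power_one_over)
  have b1: "b * \<rho> \<le> b / e" "b / \<rho> \<le> b / e" using b_ratio(2) e_pos by (auto simp: \<rho>_def)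
  have "e * \<rho> + e / \<rho> \<le> 2"
    using e_pos e_square_small by (auto simp: \<rho>_def power2_eq_square)
  have "norm (orbit_kernel q l m z) \<le> (5/2) ^ (l + m + 1) * e ^ nat \<bar>n\<bar> * exp \<bar>real_of_int q\<bar>"
    if z: "norm z = \<rho>" for z
  proof -
    have 1: "norm (1 - of_real b * z) \<le> 1 + b / e"
      using norm_triangle_ineq4[of 1 "of_real b * z"] z b1 b_bounds by (simp add: norm_mult)
    have 2: "norm (1 - of_real b / z) \<le> 1 + b / e"
      using norm_triangle_ineq4[of 1 "of_real b / z"] z b1 b_bounds by (simp add: norm_divide)
    have 3: "norm (exp (of_int q * of_real e / 2 * (z - 1 / z))) \<le> exp \<bar>real_of_int q\<bar>"
    proof -
      have "norm (z - 1 / z) \<le> \<rho> + 1 / \<rho>"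
        using norm_triangle_ineq4[of z "1 / z"] z by (simp add: norm_divide)
      then have "norm (of_int q * of_real e / 2 * (z - 1 / z)) \<le> \<bar>real_of_int q\<bar> * e / 2 * (\<rho> + 1 / \<rho>)"
        using e_pos by (simp add: norm_mult mult_left_mono)
      also have "\<dots> = \<bar>real_of_int q\<bar> / 2 * (e * \<rho> + e / \<rho>)" by (simp add: field_simps)
      also have "\<dots> \<le> \<bar>real_of_int q\<bar> / 2 * 2" by (rule mult_left_mono) (use \<open>e * \<rho> + e / \<rho> \<le> 2\<close> in auto)
      finally have "norm (of_int q * of_real e / 2 * (z - 1 / z)) \<le> \<bar>real_of_int q\<bar>" by simp
      then show ?thesis
        unfolding norm_exp_eq_Re exp_le_cancel_iff using complex_Re_le_cmod order_trans by blast
    qed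
    define X where "X = 1 + b / e"
    have X: "0 \<le> X" "X\<^sup>2 \<le> 5/2" using b_ratio(1) b_bounds e_pos by (auto simp: X_def)
    have a1: "norm (complex_of_real a ^ (l + m + 1)) \<le> 1"
      unfolding norm_power norm_of_real using a_bounds by (intro power_le_one) auto
    have n1: "norm (z powi n) = e ^ nat \<bar>n\<bar>" unfolding norm_power_int z by (rule pw)
    have l1: "norm ((1 - of_real b * z) ^ (2 * l + 1)) \<le> X ^ (2 * l + 1)"
      unfolding norm_power X_def by (rule power_mono[OF 1]) simp
    have m1: "norm ((1 - of_real b / z) ^ (2 * m + 1)) \<le> X ^ (2 * m + 1)"
      unfolding norm_power X_def by (rule power_mono[OF 2]) simp
    have "norm (orbit_kernel q l m z) = norm (complex_of_real a ^ (l + m + 1)) * norm (z powi n)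
        * norm ((1 - of_real b * z) ^ (2 * l + 1)) * norm ((1 - of_real b / z) ^ (2 * m + 1))
        * norm (exp (of_int q * of_real e / 2 * (z - 1 / z)))"
      unfolding orbit_kernel_def norm_mult n_def[symmetric] ..
    also have "\<dots> \<le> 1 * e ^ nat \<bar>n\<bar> * X ^ (2 * l + 1) * X ^ (2 * m + 1) * exp \<bar>real_of_int q\<bar>"
      unfolding n1 using a1 l1 m1 3 X(1) e_pos by (intro mult_mono) (simp_all del: power_Suc)
    also have "\<dots> = e ^ nat \<bar>n\<bar> * (X ^ (2 * l + 1) * X ^ (2 * m + 1)) * exp \<bar>real_of_int q\<bar>"
      by (simp only: mult.assoc mult_1)
    also have "X ^ (2 * l + 1) * X ^ (2 * m + 1) = X ^ (2 * (l + m + 1))"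
      unfolding power_add[symmetric] by (rule arg_cong[where f="\<lambda>k. X ^ k"]) simp
    also have "\<dots> = (X\<^sup>2) ^ (l + m + 1)" by (rule power_mult)
    also have "e ^ nat \<bar>n\<bar> * (X\<^sup>2) ^ (l + m + 1) * exp \<bar>real_of_int q\<bar>
        \<le> e ^ nat \<bar>n\<bar> * (5/2) ^ (l + m + 1) * exp \<bar>real_of_int q\<bar>"
      using X e_pos by (intro mult_right_mono mult_left_mono power_mono) auto
    finally show ?thesis by (simp add: mult_ac)
  qed
  then show ?thesis
    unfolding orbit_coeff_def n_def[symmetric]
    by (intro circle_mean_radius_bound[OF holomorphic_orbit_kernel \<rho>])
qed

definition orbit_pos :: "real \<Rightarrow> complex" where
  "orbit_pos E = of_real a * cis E * (1 - of_real b * cis (- E))\<^sup>2"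

lemma orbit_pos_eq: "orbit_pos E = Complex (cos E - e) ((2 * a - 1) * sin E)"
proof -
  have ab2: "a * b\<^sup>2 = 1 - a" using a_b_sq by (simp add: distrib_left)
  have "orbit_pos E = of_real a * cis E - of_real (2 * a * b) * (cis E * cis (- E))
      + of_real (a * b\<^sup>2) * (cis E * cis (- E)) * cis (- E)"
    unfolding orbit_pos_def by (simp add: power2_eq_square algebra_simps)
  also have "cis E * cis (- E) = 1" by (simp add: cis_mult)
  finally have "orbit_pos E = of_real a * cis E - of_real e + of_real (1 - a) * cis (- E)"
    unfolding ab ab2 by simp
  then show ?thesis by (simp add: complex_eq_iff algebra_simps)
qed

lemma orbit_radius_eq:
  "of_real a * (1 - of_real b * cis E) * (1 - of_real b * cis (- E)) = complex_of_real (1 - e * cos E)"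
proof -
  have "of_real a * (1 - of_real b * cis E) * (1 - of_real b * cis (- E))
     = of_real (a * (1 + b\<^sup>2 * 1)) - of_real (a * b) * (cis E + cis (- E)) + of_real (a * b\<^sup>2) * (cis E * cis (- E) - 1)"
    by (simp add: power2_eq_square algebra_simps)
  also have "cis E * cis (- E) = 1" by (simp add: cis_mult)
  also have "cis E + cis (- E) = of_real (2 * cos E)" by (simp add: complex_eq_iff)
  also have "of_real (a * b) * complex_of_real (2 * cos E) = of_real ((2 * a * b) * cos E)" by simp
  finally show ?thesis unfolding ab using a_b_sq by simp
qed

lemma cnj_orbit_pos: "cnj (orbit_pos E) = of_real a * cis (- E) * (1 - of_real b * cis E)\<^sup>2"
  unfolding orbit_pos_def by (simp add: cis_cnj)

lemma orbit_pos_mult_cnj: "orbit_pos E * cnj (orbit_pos E) = of_real ((1 - e * cos E)\<^sup>2)"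
proof -
  have "orbit_pos E * cnj (orbit_pos E)
     = (of_real a * (1 - of_real b * cis E) * (1 - of_real b * cis (- E)))\<^sup>2 * (cis E * cis (- E))"
    unfolding cnj_orbit_pos unfolding orbit_pos_def by (simp only: power2_eq_square mult_ac)
  also have "cis E * cis (- E) = 1" by (simp add: cis_mult)
  finally show ?thesis unfolding orbit_radius_eq by simp
qed

lemma orbit_kernel_cis:
  "orbit_kernel q l m (cis E) = of_real (1 - e * cos E) * (cnj (orbit_pos E)) ^ l * (orbit_pos E) ^ m
     * cis (- (of_int q * (E - e * sin E)))"
proof -
  let ?u = "1 - of_real b * cis E" and ?v = "1 - of_real b * cis (- E)"
  have powi: "cis E powi (int m - int l - q) = cis E ^ m * cis (- E) ^ l * cis (- (of_int q * E))"
  proof -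
    show ?thesis by (simp add: cis_power_int Complex.DeMoivre cis_mult algebra_simps)
  qed
  have "of_int q * of_real e / 2 * (cis E - 1 / cis E) = \<i> * of_real (of_int q * e * sin E)"
    by (simp add: complex_eq_iff cis_divide[of 0, simplified] flip: cis_divide)
  then have ex: "exp (of_int q * of_real e / 2 * (cis E - 1 / cis E)) = cis (of_int q * e * sin E)"
    unfolding cis_conv_exp[of "of_int q * e * sin E"] by (rule arg_cong)
  have inv: "of_real b / cis E = of_real b * cis (- E)"
    by (simp only: divide_inverse cis_inverse)
  have c: "cis (- (of_int q * (E - e * sin E))) = cis (- (of_int q * E)) * cis (of_int q * e * sin E)"
    by (simp add: cis_mult algebra_simps)
  have "orbit_kernel q l m (cis E) = of_real a ^ (l + m + 1) * (cis E ^ m * cis (- E) ^ l * cis (- (of_int q * E)))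
     * ?u ^ (2 * l + 1) * ?v ^ (2 * m + 1) * cis (of_int q * e * sin E)"
    unfolding orbit_kernel_def powi ex inv ..
  also have "\<dots> = (of_real a * ?u * ?v) * (of_real a * cis (- E) * ?u\<^sup>2) ^ l * (of_real a * cis E * ?v\<^sup>2) ^ m
       * (cis (- (of_int q * E)) * cis (of_int q * e * sin E))"
  proof -
    have odd: "w ^ (2 * n + 1) = (w\<^sup>2) ^ n * w" for w :: complex and n by (simp add: power_mult)
    show ?thesis unfolding odd by (simp only: power_add power_mult_distrib power_one_right mult_ac)
  qed
  finally show ?thesis unfolding orbit_radius_eq cnj_orbit_pos c by (simp only: orbit_pos_def)
qed

lemma continuous_on_sphere_orbit_kernel: "continuous_on (sphere 0 1) (orbit_kernel q l m)"
  by (rule continuous_on_subset[OF holomorphic_on_imp_continuous_on[OF holomorphic_orbit_kernel]]) auto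

lemma Re_orbit_coeff:
  "Re (orbit_coeff q l m) = integral {0..2*pi} (\<lambda>E. Re (orbit_kernel q l m (cis E))) / (2 * pi)"
proof -
  have "(\<lambda>E. orbit_kernel q l m (cis E)) integrable_on {0..2*pi}"
    by (intro integrable_continuous_real continuous_on_cis_circle continuous_on_sphere_orbit_kernel)
  from integral_linear[OF this bounded_linear_Re] show ?thesis
    by (simp add: orbit_coeff_def circle_mean_def o_def)
qed

text \<open>The mean over a period of the squared radius.\<close>

lemma orbit_coeff_0_1_1: "Re (orbit_coeff 0 1 1) = 1 + 3/2 * e\<^sup>2"
proof -
  have k: "Re (orbit_kernel 0 1 1 (cis E)) = (1 - e * cos E) ^ 3" for E
  proof -
    have "orbit_kernel 0 1 1 (cis E) = of_real (1 - e * cos E) * (orbit_pos E * cnj (orbit_pos E))"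
      unfolding orbit_kernel_cis by simp
    also have "\<dots> = of_real ((1 - e * cos E) ^ 3)"
      unfolding orbit_pos_mult_cnj by (simp add: power3_eq_cube power2_eq_square)
    finally show ?thesis by (simp only: Re_complex_of_real)
  qed
  define F where "F = (\<lambda>x. x - 3 * e * sin x + 3 * e\<^sup>2 * (x + sin x * cos x) / 2 - e ^ 3 * (sin x - sin x ^ 3 / 3))"
  have "((\<lambda>E. (1 - e * cos E) ^ 3) has_integral F (2 * pi) - F 0) {0..2*pi}"
  proof (rule fundamental_theorem_of_calculus)
    fix x :: real
    define s c where "s = sin x" and "c = cos x"
    have s2: "s\<^sup>2 = 1 - c\<^sup>2" unfolding s_def c_def by (rule sin_squared_eq)
    have "(F has_real_derivative 1 - 3 * e * c + 3 * e\<^sup>2 * (1 + c\<^sup>2 - s\<^sup>2) / 2 - e ^ 3 * (c - s\<^sup>2 * c)) (at x)"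
      unfolding F_def s_def c_def
      by (rule derivative_eq_intros refl | simp)+ (simp add: field_simps power2_eq_square)
    also have "1 - 3 * e * c + 3 * e\<^sup>2 * (1 + c\<^sup>2 - s\<^sup>2) / 2 - e ^ 3 * (c - s\<^sup>2 * c) = (1 - e * c) ^ 3"
      unfolding s2 by (simp add: field_simps power2_eq_square power3_eq_cube)
    finally have "(F has_real_derivative (1 - e * cos x) ^ 3) (at x)" by (simp add: c_def)
    then show "(F has_vector_derivative (1 - e * cos x) ^ 3) (at x within {0..2*pi})"
      by (simp add: has_real_derivative_iff_has_vector_derivative has_vector_derivative_at_within)
  qed auto
  then show ?thesis unfolding Re_orbit_coeff k by (simp add: integral_unique F_def field_simps)
qed

text \<open>The integrand is an explicit trigonometric polynomial with antiderivative \<open>F\<close>.\<close>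

lemma orbit_coeff_0_2_1: "Re (orbit_coeff 0 2 1) = - (5/2) * e * (1 + 3/4 * e\<^sup>2)"
proof -
  have k: "Re (orbit_kernel 0 2 1 (cis E)) = (1 - e * cos E) ^ 3 * (cos E - e)" for E
  proof -
    have "orbit_kernel 0 2 1 (cis E) = of_real (1 - e * cos E) * (orbit_pos E * cnj (orbit_pos E)) * cnj (orbit_pos E)"
      unfolding orbit_kernel_cis by (simp add: power2_eq_square)
    also have "\<dots> = of_real ((1 - e * cos E) ^ 3) * cnj (orbit_pos E)"
      unfolding orbit_pos_mult_cnj by (simp add: power3_eq_cube power2_eq_square)
    finally show ?thesis by (simp add: orbit_pos_eq)
  qed
  define F where "F = (\<lambda>x. - e * x + (1 + 3 * e\<^sup>2) * sin x - (3 * e + 3 * e ^ 3) * (x + sin x * cos x) / 2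
     + (3 * e\<^sup>2 + e ^ 4) * (sin x - sin x ^ 3 / 3) - e ^ 3 * (3 * x / 8 + 3 / 8 * (sin x * cos x) + sin x * cos x ^ 3 / 4))"
  have "((\<lambda>E. (1 - e * cos E) ^ 3 * (cos E - e)) has_integral F (2 * pi) - F 0) {0..2*pi}"
  proof (rule fundamental_theorem_of_calculus)
    fix x :: real
    define s c where "s = sin x" and "c = cos x"
    have s2: "s\<^sup>2 = 1 - c\<^sup>2" unfolding s_def c_def by (rule sin_squared_eq)
    have "(F has_real_derivative - e + (1 + 3 * e\<^sup>2) * c - (3 * e + 3 * e ^ 3) * (1 + c\<^sup>2 - s\<^sup>2) / 2
      + (3 * e\<^sup>2 + e ^ 4) * (c - s\<^sup>2 * c)
      - e ^ 3 * (3 / 8 + 3 / 8 * (c\<^sup>2 - s\<^sup>2) + (c ^ 4 - 3 * c\<^sup>2 * s\<^sup>2) / 4)) (at x)"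
      unfolding F_def s_def c_def
      by (rule derivative_eq_intros refl | simp)+ (simp add: field_simps power2_eq_square power3_eq_cube eval_nat_numeral)
    also have "- e + (1 + 3 * e\<^sup>2) * c - (3 * e + 3 * e ^ 3) * (1 + c\<^sup>2 - s\<^sup>2) / 2
      + (3 * e\<^sup>2 + e ^ 4) * (c - s\<^sup>2 * c)
      - e ^ 3 * (3 / 8 + 3 / 8 * (c\<^sup>2 - s\<^sup>2) + (c ^ 4 - 3 * c\<^sup>2 * s\<^sup>2) / 4) = (1 - e * c) ^ 3 * (c - e)"
      unfolding s2 by (simp add: field_simps power2_eq_square power3_eq_cube eval_nat_numeral)
    finally have "(F has_real_derivative (1 - e * cos x) ^ 3 * (cos x - e)) (at x)" by (simp add: c_def)
    then show "(F has_vector_derivative (1 - e * cos x) ^ 3 * (cos x - e)) (at x within {0..2*pi})"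
      by (simp add: has_real_derivative_iff_has_vector_derivative has_vector_derivative_at_within)
  qed auto
  moreover have "F (2 * pi) - F 0 = 2 * pi * (- (5/2) * e * (1 + 3/4 * e\<^sup>2))"
    by (simp add: F_def field_simps power2_eq_square power3_eq_cube)
  ultimately show ?thesis unfolding Re_orbit_coeff k by (simp add: integral_unique)
qed

text \<open>For \<open>q = 1\<close> and \<open>l = 0\<close> the kernel is \<open>Q z * R z\<close>, where \<open>Q\<close> is \<open>z^(m-1)\<close> times an entire function \<open>P\<close> of
  \<open>1 / z\<close> and \<open>R\<close> is close to 1. The mean of \<open>Q\<close> is a Taylor coefficient of \<open>P\<close>, and on the circle of
  radius \<open>e\<close> the rest \<open>Q z * (R z - 1)\<close> is smaller than that coefficient by two orders in \<open>e\<close>.\<close>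

lemma orbit_coeff_1_0:
  assumes "m \<ge> 1"
  shows "norm (orbit_coeff 1 0 m - of_real a ^ (m + 1) *
      ((deriv ^^ (m - 1)) (\<lambda>w. (1 - of_real b * w) ^ (2 * m + 1) * exp (- (of_real e / 2) * w)) 0 / fact (m - 1)))
    \<le> e ^ (m + 1) * (4 * (5/2) ^ (m + 1))"
proof -
  define P :: "complex \<Rightarrow> complex" where "P = (\<lambda>w. (1 - of_real b * w) ^ (2 * m + 1) * exp (- (of_real e / 2) * w))"
  define R :: "complex \<Rightarrow> complex" where "R = (\<lambda>z. (1 - of_real b * z) * exp (of_real e / 2 * z))"
  define Q where "Q = (\<lambda>z. z ^ (m - 1) * P (1 / z))"
  define D where "D = (\<lambda>z. Q z * (R z - 1))"
  have Phol: "P holomorphic_on A" for A unfolding P_def by (intro holomorphic_intros)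
  have Qhol: "Q holomorphic_on -{0}" unfolding Q_def P_def by (intro holomorphic_intros) auto
  have Dhol: "D holomorphic_on -{0}" unfolding D_def R_def by (intro holomorphic_intros Qhol)
  have cs: "continuous_on (sphere 0 1) h" if "h holomorphic_on -{0}" for h :: "complex \<Rightarrow> complex"
    by (rule continuous_on_subset[OF holomorphic_on_imp_continuous_on[OF that]]) auto
  have "orbit_coeff 1 0 m = circle_mean (\<lambda>z. of_real a ^ (m + 1) * (Q z + D z))"
    unfolding orbit_coeff_def
  proof (rule circle_mean_cong)
    fix z :: complex
    have "exp (of_int 1 * of_real e / 2 * (z - 1 / z)) = exp (- (of_real e / 2) * (1 / z)) * exp (of_real e / 2 * z)"
    proof -
      have "of_int 1 * of_real e / 2 * (z - 1 / z) = - (complex_of_real e / 2) * (1 / z) + of_real e / 2 * z"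
        by (simp add: right_diff_distrib)
      then show ?thesis by (simp only: exp_add)
    qed
    moreover have "Q z + D z = Q z * R z" by (simp add: D_def right_diff_distrib)
    moreover have "z powi (int m - int 0 - 1) = z ^ (m - 1)"
    proof -
      have "int m - int 0 - 1 = int (m - 1)" using assms by simp
      then show ?thesis by (simp only: power_int_of_nat)
    qed
    ultimately show "orbit_kernel 1 0 m z = of_real a ^ (m + 1) * (Q z + D z)"
      unfolding orbit_kernel_def by (simp add: Q_def P_def R_def mult_ac)
  qed
  then have "orbit_coeff 1 0 m = of_real a ^ (m + 1) * (circle_mean Q + circle_mean D)"
    by (simp add: circle_mean_mult_left circle_mean_add[OF cs[OF Qhol] cs[OF Dhol]])
  moreover have "circle_mean Q = (deriv ^^ (m - 1)) P 0 / fact (m - 1)"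
  proof -
    have "circle_mean Q = circle_mean (\<lambda>z. Q (inverse z))" by (rule circle_mean_inverse[symmetric])
    also have "\<dots> = circle_mean (\<lambda>z. P z / z ^ (m - 1))"
      by (simp add: Q_def divide_inverse power_inverse mult.commute)
    also have "\<dots> = (deriv ^^ (m - 1)) P 0 / fact (m - 1)" by (rule circle_mean_taylor_coeff[OF Phol])
    finally show ?thesis .
  qed
  moreover have "norm (circle_mean D) \<le> e ^ (m + 1) * (4 * (5/2) ^ (m + 1))"
  proof (rule circle_mean_radius_bound[OF Dhol e_pos])
    fix z :: complex assume z: "norm z = e"
    define X where "X = 1 + b / e"
    have X: "1 \<le> X" "X\<^sup>2 \<le> 5/2" using b_ratio(1) b_bounds e_pos by (auto simp: X_def)
    have "norm (1 - of_real b * (1 / z)) \<le> X"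
      using norm_triangle_ineq4[of 1 "of_real b * (1 / z)"] z b_bounds by (simp add: norm_divide X_def)
    then have "norm ((1 - of_real b * (1 / z)) ^ (2 * m + 1)) \<le> X ^ (2 * m + 1)"
      unfolding norm_power by (rule power_mono) simp
    also have "\<dots> \<le> X ^ (2 * (m + 1))" using X(1) by (intro power_increasing) auto
    also have "\<dots> = (X\<^sup>2) ^ (m + 1)" by (rule power_mult)
    also have "\<dots> \<le> (5/2) ^ (m + 1)" using X by (intro power_mono) auto
    finally have 1: "norm ((1 - of_real b * (1 / z)) ^ (2 * m + 1)) \<le> (5/2) ^ (m + 1)" .
    have 2: "norm (exp (- (of_real e / 2) * (1 / z))) \<le> 2"
    proof -
      have "norm (- (complex_of_real e / 2) * (1 / z)) = 1/2" using z e_pos by (simp add: norm_mult norm_divide)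
      then have "norm (exp (- (complex_of_real e / 2) * (1 / z))) \<le> exp (1/2)"
        unfolding norm_exp_eq_Re exp_le_cancel_iff using complex_Re_le_cmod[of "- (complex_of_real e / 2) * (1 / z)"] by linarith
      also have "\<dots> \<le> 2" using exp_bound_half[of "1/2::real"] by simp
      finally show ?thesis .
    qed
    have 3: "norm (R z - 1) \<le> 2 * e\<^sup>2"
    proof -
      have n: "norm (of_real e / 2 * z) = e\<^sup>2 / 2" using z e_pos by (simp add: norm_mult norm_divide power2_eq_square)
      have E: "norm (exp (of_real e / 2 * z) - 1) \<le> e\<^sup>2"
        using norm_exp_minus_one_le_double[of "of_real e / 2 * z"] n e_square_small by simp
      have "R z - 1 = (exp (of_real e / 2 * z) - 1) - of_real b * z * ((exp (of_real e / 2 * z) - 1) + 1)"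
        by (simp add: R_def algebra_simps)
      also have "norm \<dots> \<le> norm (exp (of_real e / 2 * z) - 1) + norm (of_real b * z) * (norm (exp (of_real e / 2 * z) - 1) + 1)"
      proof -
        have "norm (x - y * (x + 1)) \<le> norm x + norm y * (norm x + 1)" for x y :: complex
          using norm_triangle_ineq4[of x "y * (x + 1)"] norm_triangle_ineq[of x 1]
            mult_left_mono[of "norm (x + 1)" "norm x + 1" "norm y"] by (simp add: norm_mult)
        then show ?thesis .
      qed
      also have "\<dots> \<le> e\<^sup>2 + (51/100 * e * e) * (e\<^sup>2 + 1)"
        using E z b_bounds e_pos by (intro add_mono mult_mono) (auto simp: norm_mult)
      also have "\<dots> \<le> e\<^sup>2 + (51/100 * e * e) * (1/100 + 1)"
        using e_square_small e_pos by (intro add_left_mono mult_left_mono) auto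
      also have "\<dots> \<le> 2 * e\<^sup>2" by (simp add: power2_eq_square)
      finally show ?thesis .
    qed
    have "norm (D z) = norm z ^ (m - 1) * (norm ((1 - of_real b * (1 / z)) ^ (2 * m + 1)) * norm (exp (- (of_real e / 2) * (1 / z)))) * norm (R z - 1)"
      by (simp only: D_def Q_def P_def norm_mult norm_power)
    also have "\<dots> \<le> e ^ (m - 1) * ((5/2) ^ (m + 1) * 2) * (2 * e\<^sup>2)"
      unfolding z using 1 2 3 e_pos by (intro mult_mono) (simp_all del: power_Suc)
    also have "\<dots> = (e ^ (m - 1) * e\<^sup>2) * (4 * (5/2) ^ (m + 1))" by (simp only: mult_ac)
    also have "e ^ (m - 1) * e\<^sup>2 = e ^ (m + 1)" using assms by (simp flip: power_add)
    finally show "norm (D z) \<le> e ^ (m + 1) * (4 * (5/2) ^ (m + 1))" .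
  qed
  moreover have "norm (of_real a ^ (m + 1) * circle_mean D) \<le> 1 * norm (circle_mean D)"
    unfolding norm_mult norm_power norm_of_real using a_bounds by (intro mult_right_mono power_le_one) auto
  ultimately show ?thesis unfolding P_def by (simp add: distrib_left)
qed

text \<open>The Taylor coefficient of order 1 gives \<open>- 5 b - e / 2\<close>, which is \<open>- 3 e\<close> to leading order because
  \<open>b\<close> is about \<open>e / 2\<close>.\<close>

lemma orbit_coeff_1_0_2: "\<bar>Re (orbit_coeff 1 0 2) / (- 3 * e) - 1\<bar> \<le> e"
proof (rule relative_error_le)
  show "- 3 * e \<noteq> 0" using e_pos by simp
  have d: "deriv (\<lambda>w::complex. (1 - of_real b * w) ^ 5 * exp (- (of_real e / 2) * w)) 0 = - of_real (5 * b + e / 2)"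
    by (rule DERIV_imp_deriv) (rule derivative_eq_intros refl | simp)+
  have n: "2 * 2 + 1 = (5::nat)" "(2::nat) - 1 = 1" "2 + 1 = (3::nat)" "(1::nat) \<le> 2 \<longleftrightarrow> True" by simp_all
  have f1: "(deriv ^^ 1) = (deriv :: (complex \<Rightarrow> complex) \<Rightarrow> _)" by (simp add: fun_eq_iff)
  have y: "a ^ 3 * (- (5 * b + e / 2)) = - e * (5 * a\<^sup>2 + a ^ 3) / 2"
    using a_bounds by (simp add: b_eq power2_eq_square power3_eq_cube field_simps)
  have "norm (orbit_coeff 1 0 2 - of_real a ^ 3 * (- of_real (5 * b + e / 2) / fact 1)) \<le> e ^ 3 * (4 * (5/2) ^ 3)"
    using orbit_coeff_1_0[of 2] unfolding n f1 d by simp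
  also have "of_real a ^ 3 * (- of_real (5 * b + e / 2) / fact 1) = complex_of_real (a ^ 3 * (- (5 * b + e / 2)))"
    by simp
  finally have "norm (orbit_coeff 1 0 2 - of_real (- e * (5 * a\<^sup>2 + a ^ 3) / 2)) \<le> e * (e\<^sup>2 * (125/2))"
    unfolding y by (simp add: power2_eq_square power3_eq_cube)
  then show "\<bar>Re (orbit_coeff 1 0 2) - (- e * (5 * a\<^sup>2 + a ^ 3) / 2)\<bar> \<le> e * (e\<^sup>2 * (125/2))"
    using abs_Re_le_cmod[of "orbit_coeff 1 0 2 - of_real (- e * (5 * a\<^sup>2 + a ^ 3) / 2)"]
    unfolding minus_complex.sel Re_complex_of_real by linarith
  have eq: "6 - (5 * a\<^sup>2 + a ^ 3) = (1 - a) * (6 + 6 * a + a\<^sup>2)"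
    by (simp add: power2_eq_square power3_eq_cube algebra_simps)
  have "(1 - a) * (6 + 6 * a + a\<^sup>2) \<le> (e\<^sup>2 / 2) * (6 + 6 * 1 + 1\<^sup>2)"
    using a_bounds by (intro mult_mono add_mono power_mono) auto
  then have "6 - (5 * a\<^sup>2 + a ^ 3) \<le> 13/2 * e\<^sup>2" unfolding eq by simp
  moreover have "0 \<le> 6 - (5 * a\<^sup>2 + a ^ 3)" unfolding eq using a_bounds by (intro mult_nonneg_nonneg) auto
  ultimately have "e / 2 * \<bar>6 - (5 * a\<^sup>2 + a ^ 3)\<bar> \<le> e / 2 * (13/2 * e\<^sup>2)"
    using e_pos by (intro mult_left_mono) auto
  moreover have "- e * (5 * a\<^sup>2 + a ^ 3) / 2 - (- 3 * e) = e / 2 * (6 - (5 * a\<^sup>2 + a ^ 3))"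
    by (simp add: field_simps)
  ultimately show "\<bar>- e * (5 * a\<^sup>2 + a ^ 3) / 2 - (- 3 * e)\<bar> \<le> e / 2 * (13/2 * e\<^sup>2)"
    using e_pos by (simp only: abs_mult)
  have "e * (e\<^sup>2 * (125/2)) + e / 2 * (13/2 * e\<^sup>2) = e * (263/4 * e\<^sup>2)" by simp
  also have "\<dots> \<le> e * (3 * e)" using e_pos e_square_small(1) by (intro mult_left_mono) auto
  finally show "e * (e\<^sup>2 * (125/2)) + e / 2 * (13/2 * e\<^sup>2) \<le> e * \<bar>- 3 * e\<bar>" using e_pos by simp
qed

text \<open>Half of the second derivative at 0 is \<open>(42 b\<^sup>2 + 7 b e + e\<^sup>2 / 4) / 2\<close>, which is \<open>57/8 e\<^sup>2\<close> to leading
  order because \<open>b\<close> is about \<open>e / 2\<close>.\<close>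

lemma orbit_coeff_1_0_3: "\<bar>Re (orbit_coeff 1 0 3) / (57/8 * e\<^sup>2) - 1\<bar> \<le> e"
proof (rule relative_error_le)
  show "57/8 * e\<^sup>2 \<noteq> 0" using e_pos by simp
  have d1: "deriv (\<lambda>w::complex. (1 - of_real b * w) ^ 7 * exp (- (of_real e / 2) * w))
     = (\<lambda>w. (- 7 * of_real b * (1 - of_real b * w) ^ 6 - of_real e / 2 * (1 - of_real b * w) ^ 7) * exp (- (of_real e / 2) * w))"
    by (rule ext, rule DERIV_imp_deriv) (rule derivative_eq_intros refl | simp add: algebra_simps)+
  have d: "deriv (deriv (\<lambda>w::complex. (1 - of_real b * w) ^ 7 * exp (- (of_real e / 2) * w))) 0
     = of_real (42 * b\<^sup>2 + 7 * b * e + e\<^sup>2 / 4)"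
    unfolding d1
    by (rule DERIV_imp_deriv) (rule derivative_eq_intros refl | simp add: power2_eq_square field_simps)+
  have n: "2 * 3 + 1 = (7::nat)" "(3::nat) - 1 = 2" "3 + 1 = (4::nat)" "(1::nat) \<le> 3 \<longleftrightarrow> True" by simp_all
  have f2: "(deriv ^^ 2) h = deriv (deriv h)" for h :: "complex \<Rightarrow> complex" by (simp add: numeral_2_eq_2)
  have y: "a ^ 4 * ((42 * b\<^sup>2 + 7 * b * e + e\<^sup>2 / 4) / 2) = e\<^sup>2 * (42 * a\<^sup>2 + 14 * a ^ 3 + a ^ 4) / 8"
    using a_bounds by (simp add: b_eq eval_nat_numeral field_simps)
  have "norm (orbit_coeff 1 0 3 - of_real a ^ 4 * (of_real (42 * b\<^sup>2 + 7 * b * e + e\<^sup>2 / 4) / fact 2)) \<le> e ^ 4 * (4 * (5/2) ^ 4)"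
    using orbit_coeff_1_0[of 3] unfolding n f2 d by simp
  also have "of_real a ^ 4 * (of_real (42 * b\<^sup>2 + 7 * b * e + e\<^sup>2 / 4) / fact 2) = complex_of_real (a ^ 4 * ((42 * b\<^sup>2 + 7 * b * e + e\<^sup>2 / 4) / 2))"
    by simp
  also have "e ^ 4 * (4 * (5/2) ^ 4) = e\<^sup>2 * (e\<^sup>2 * (625/4))" by (simp add: eval_nat_numeral)
  finally have "norm (orbit_coeff 1 0 3 - of_real (e\<^sup>2 * (42 * a\<^sup>2 + 14 * a ^ 3 + a ^ 4) / 8)) \<le> e\<^sup>2 * (e\<^sup>2 * (625/4))"
    unfolding y .
  then show "\<bar>Re (orbit_coeff 1 0 3) - e\<^sup>2 * (42 * a\<^sup>2 + 14 * a ^ 3 + a ^ 4) / 8\<bar> \<le> e\<^sup>2 * (e\<^sup>2 * (625/4))"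
    using abs_Re_le_cmod[of "orbit_coeff 1 0 3 - of_real (e\<^sup>2 * (42 * a\<^sup>2 + 14 * a ^ 3 + a ^ 4) / 8)"]
    unfolding minus_complex.sel Re_complex_of_real by linarith
  have eq: "57 - (42 * a\<^sup>2 + 14 * a ^ 3 + a ^ 4) = (1 - a) * (57 + 57 * a + 15 * a\<^sup>2 + a ^ 3)"
    by (simp add: eval_nat_numeral algebra_simps)
  have "(1 - a) * (57 + 57 * a + 15 * a\<^sup>2 + a ^ 3) \<le> (e\<^sup>2 / 2) * (57 + 57 * 1 + 15 * 1\<^sup>2 + 1 ^ 3)"
    using a_bounds by (intro mult_mono add_mono power_mono mult_left_mono) auto
  then have "57 - (42 * a\<^sup>2 + 14 * a ^ 3 + a ^ 4) \<le> 65 * e\<^sup>2" unfolding eq by simp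
  moreover have "0 \<le> 57 - (42 * a\<^sup>2 + 14 * a ^ 3 + a ^ 4)"
    unfolding eq using a_bounds by (intro mult_nonneg_nonneg add_nonneg_nonneg) auto
  ultimately have "e\<^sup>2 / 8 * \<bar>57 - (42 * a\<^sup>2 + 14 * a ^ 3 + a ^ 4)\<bar> \<le> e\<^sup>2 / 8 * (65 * e\<^sup>2)"
    by (intro mult_left_mono) auto
  moreover have "e\<^sup>2 * (42 * a\<^sup>2 + 14 * a ^ 3 + a ^ 4) / 8 - 57/8 * e\<^sup>2 = - (e\<^sup>2 / 8 * (57 - (42 * a\<^sup>2 + 14 * a ^ 3 + a ^ 4)))"
    by (simp add: field_simps)
  ultimately show "\<bar>e\<^sup>2 * (42 * a\<^sup>2 + 14 * a ^ 3 + a ^ 4) / 8 - 57/8 * e\<^sup>2\<bar> \<le> e\<^sup>2 / 8 * (65 * e\<^sup>2)"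
    by (simp only: abs_minus_cancel abs_mult) simp
  have "e\<^sup>2 * (e\<^sup>2 * (625/4)) + e\<^sup>2 / 8 * (65 * e\<^sup>2) = e\<^sup>2 * (1315/8 * e\<^sup>2)" by simp
  also have "\<dots> \<le> e\<^sup>2 * (57/8 * e)" using e_pos e_square_small(1) by (intro mult_left_mono) auto
  finally show "e\<^sup>2 * (e\<^sup>2 * (625/4)) + e\<^sup>2 / 8 * (65 * e\<^sup>2) \<le> e * \<bar>57/8 * e\<^sup>2\<bar>" by (simp add: mult.left_commute mult.commute)
qed

text \<open>Here the power of \<open>z\<close> is absent, and the kernel is \<open>a^4 * A z * B (1 / z)\<close> with entire \<open>A\<close>, \<open>B\<close> that have
  mean value 1. Hence only \<open>(A - 1) * (B - 1)\<close> contributes to the error, and it is of second order in \<open>e\<close>.\<close>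

lemma orbit_coeff_1_1_2: "\<bar>Re (orbit_coeff 1 1 2) - 1\<bar> \<le> 26 * e\<^sup>2"
proof -
  define A :: "complex \<Rightarrow> complex" where "A = (\<lambda>z. (1 - of_real b * z) ^ 3 * exp (of_real e / 2 * z))"
  define B :: "complex \<Rightarrow> complex" where "B = (\<lambda>w. (1 - of_real b * w) ^ 5 * exp (- (of_real e / 2) * w))"
  have hol: "A holomorphic_on S" "B holomorphic_on S" for S
    unfolding A_def B_def by (intro holomorphic_intros)+
  have cA: "continuous_on (sphere 0 1) A" by (rule holomorphic_on_imp_continuous_on[OF hol(1)])
  have cB: "continuous_on (sphere 0 1) (\<lambda>z. B (1 / z))"
    unfolding B_def by (intro continuous_intros) auto
  have mA: "circle_mean A = 1" using circle_mean_taylor_coeff[OF hol(1), of 0] by (simp add: A_def)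
  have mB: "circle_mean (\<lambda>z. B (1 / z)) = 1"
    using circle_mean_taylor_coeff[OF hol(2), of 0] circle_mean_inverse[of B] by (simp add: B_def inverse_eq_divide)
  have m1: "circle_mean (\<lambda>z. 1) = 1" using circle_mean_taylor_coeff[of "\<lambda>_. 1" 0] by simp
  have "orbit_coeff 1 1 2 = circle_mean (\<lambda>z. of_real a ^ 4 * (A z * B (1 / z)))"
    unfolding orbit_coeff_def
  proof (rule circle_mean_cong)
    fix z :: complex
    have "of_int 1 * of_real e / 2 * (z - 1 / z) = - (complex_of_real e / 2) * (1 / z) + of_real e / 2 * z"
      by (simp add: right_diff_distrib)
    then have ex: "exp (of_int 1 * of_real e / 2 * (z - 1 / z)) = exp (- (of_real e / 2) * (1 / z)) * exp (of_real e / 2 * z)"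
      by (simp only: exp_add)
    have n: "1 + 2 + 1 = (4::nat)" "2 * 1 + 1 = (3::nat)" "2 * 2 + 1 = (5::nat)" "int 2 - int 1 - 1 = 0" by simp_all
    have d: "of_real b / z = of_real b * (1 / z)" by simp
    show "orbit_kernel 1 1 2 z = of_real a ^ 4 * (A z * B (1 / z))"
      unfolding orbit_kernel_def ex n d A_def B_def power_int_0_right by (simp only: mult_1_left mult_1_right mult_ac)
  qed
  also have "\<dots> = of_real a ^ 4 * circle_mean (\<lambda>z. A z * B (1 / z))" by (rule circle_mean_mult_left)
  also have "circle_mean (\<lambda>z. A z * B (1 / z)) = circle_mean (\<lambda>z. (A z - 1) * (B (1 / z) - 1)) + 1"
  proof -
    have "(\<lambda>z. A z * B (1 / z)) = (\<lambda>z. ((A z - 1) * (B (1 / z) - 1) + (A z + B (1 / z))) - 1)"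
      by (simp add: algebra_simps)
    then have "circle_mean (\<lambda>z. A z * B (1 / z)) = circle_mean (\<lambda>z. (A z - 1) * (B (1 / z) - 1) + (A z + B (1 / z))) - circle_mean (\<lambda>z. 1)"
      by (simp only:) (intro circle_mean_diff continuous_intros cA cB)
    also have "circle_mean (\<lambda>z. (A z - 1) * (B (1 / z) - 1) + (A z + B (1 / z)))
       = circle_mean (\<lambda>z. (A z - 1) * (B (1 / z) - 1)) + circle_mean (\<lambda>z. A z + B (1 / z))"
      by (intro circle_mean_add continuous_intros cA cB)
    also have "circle_mean (\<lambda>z. A z + B (1 / z)) = circle_mean A + circle_mean (\<lambda>z. B (1 / z))"
      by (intro circle_mean_add cA cB)
    finally show ?thesis by (simp add: mA mB m1)
  qed
  finally have eq: "orbit_coeff 1 1 2 = of_real a ^ 4 * (circle_mean (\<lambda>z. (A z - 1) * (B (1 / z) - 1)) + 1)" .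
  have small: "norm ((1 - of_real b * w) ^ n * exp v - 1) \<le> ((1 + b) ^ n - 1) + (1 + b) ^ n * e"
    if "norm w = 1" "norm v = e / 2" for w v :: complex and n
  proof -
    have E: "norm (exp v - 1) \<le> e" using norm_exp_minus_one_le_double[of v] that e_small by simp
    have P: "norm ((1 - of_real b * w) ^ n - 1) \<le> (1 + b) ^ n - 1"
      using norm_prod_minus1_le_prod_minus1[of "\<lambda>_. - (of_real b * w)" "{..<n}"] that b_bounds
      by (simp add: norm_mult)
    have Q: "norm ((1 - of_real b * w) ^ n) \<le> (1 + b) ^ n"
      unfolding norm_power using norm_triangle_ineq4[of 1 "of_real b * w"] that b_bounds
      by (intro power_mono) (auto simp: norm_mult)
    have "(1 - of_real b * w) ^ n * exp v - 1 = ((1 - of_real b * w) ^ n - 1) + (1 - of_real b * w) ^ n * (exp v - 1)"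
      by (simp add: algebra_simps)
    also have "norm \<dots> \<le> ((1 + b) ^ n - 1) + (1 + b) ^ n * e"
      by (intro order_trans[OF norm_triangle_ineq] add_mono P) (auto simp: norm_mult intro!: mult_mono E Q zero_le_power add_nonneg_nonneg b_bounds(1)[THEN less_imp_le])
    finally show ?thesis .
  qed
  have b5: "(1 + b) ^ 5 \<le> 1 + 3 * e"
  proof -
    have "(1 + b) ^ 5 \<le> exp b ^ 5" using b_bounds exp_ge_add_one_self[of b] by (intro power_mono) auto
    also have "\<dots> = exp (5 * b)" by (simp flip: exp_of_nat_mult)
    also have "\<dots> \<le> 1 + 5 * b + (5 * b)\<^sup>2" using b_bounds e_small by (intro exp_bound) auto
    also have "\<dots> \<le> 1 + 5 * (51/100 * e) + (5 * (51/100 * e))\<^sup>2"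
      using b_bounds by (intro add_mono mult_left_mono power_mono) auto
    also have "\<dots> \<le> 1 + 3 * e" 
    proof -
      have "1 + 5 * (51/100 * e) + (5 * (51/100 * e))\<^sup>2 = 1 + 51/20 * e + 2601/400 * e\<^sup>2"
        by (simp add: power2_eq_square)
      then show ?thesis using e_square_small(1) e_pos by linarith
    qed
    finally show ?thesis .
  qed
  have b3: "(1 + b) ^ 3 \<le> (1 + b) ^ 5" using b_bounds by (intro power_increasing) auto
  have "norm (circle_mean (\<lambda>z. (A z - 1) * (B (1 / z) - 1))) \<le> (24/5 * e) * (24/5 * e)"
  proof (rule circle_mean_norm_le)
    show "continuous_on (sphere 0 1) (\<lambda>z. (A z - 1) * (B (1 / z) - 1))" by (intro continuous_intros cA cB)
    fix z :: complex assume z: "norm z = 1"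
    have c: "((1 + b) ^ n - 1) + (1 + b) ^ n * e \<le> 24/5 * e" if "(1 + b) ^ n \<le> 1 + 3 * e" for n
    proof -
      have "((1 + b) ^ n - 1) + (1 + b) ^ n * e \<le> 3 * e + (1 + 3 * e) * e"
        using that e_pos by (intro add_mono mult_right_mono) auto
      also have "\<dots> \<le> 24/5 * e" using e_square_small e_pos by (simp add: power2_eq_square algebra_simps)
      finally show ?thesis .
    qed
    have "norm (A z - 1) \<le> 24/5 * e"
      unfolding A_def by (rule order_trans[OF small c]) (use z e_pos b3 b5 in \<open>auto simp: norm_mult norm_divide\<close>)
    moreover have "norm (B (1 / z) - 1) \<le> 24/5 * e"
      unfolding B_def by (rule order_trans[OF small c]) (use z e_pos b3 b5 in \<open>auto simp: norm_mult norm_divide\<close>)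
    ultimately show "norm ((A z - 1) * (B (1 / z) - 1)) \<le> (24/5 * e) * (24/5 * e)"
      unfolding norm_mult using e_pos by (intro mult_mono) auto
  qed
  then have D: "\<bar>Re (circle_mean (\<lambda>z. (A z - 1) * (B (1 / z) - 1)))\<bar> \<le> 2304/100 * e\<^sup>2"
    using abs_Re_le_cmod[of "circle_mean (\<lambda>z. (A z - 1) * (B (1 / z) - 1))"] by (simp add: power2_eq_square)
  have "Re (orbit_coeff 1 1 2) = a ^ 4 * (Re (circle_mean (\<lambda>z. (A z - 1) * (B (1 / z) - 1))) + 1)"
  proof -
    have "orbit_coeff 1 1 2 = a ^ 4 *\<^sub>R (circle_mean (\<lambda>z. (A z - 1) * (B (1 / z) - 1)) + 1)"
      unfolding eq scaleR_conv_of_real of_real_power ..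
    then show ?thesis by simp
  qed
  moreover have "1 - a ^ 4 \<le> 4 * (1 - a)" using Bernoulli_inequality[of "a - 1" 4] a_bounds by simp
  then have "1 - a ^ 4 \<le> 2 * e\<^sup>2" using a_bounds by simp
  moreover have "a ^ 4 \<le> 1" using a_bounds by (intro power_le_one) auto
  moreover have "\<bar>a ^ 4 * Re (circle_mean (\<lambda>z. (A z - 1) * (B (1 / z) - 1)))\<bar> \<le> 1 * (2304/100 * e\<^sup>2)"
    unfolding abs_mult using D \<open>a ^ 4 \<le> 1\<close> by (intro mult_mono) auto
  ultimately show ?thesis unfolding distrib_left 
    using e_square_small(3) by (simp only: abs_le_iff mult_1 mult_1_right) linarith
qed

end

section \<open>Kepler's equation\<close>

locale kepler_orbit = small_eccentricity +
  fixes f :: "real \<Rightarrow> real"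
  assumes anomaly: "is_true_anomaly e f"
begin

text \<open>The eccentric anomaly as a function of time. Subtracting twice the arctangent, instead of inverting
  the usual half-angle formula, defines it smoothly for all times.\<close>

definition ecc :: "real \<Rightarrow> real" where
  "ecc t = f t - 2 * arctan (b * sin (f t) / (1 + b * cos (f t)))"

lemma one_plus_b_cos_pos: "0 < 1 + b * cos y"
proof -
  have "\<bar>b * cos y\<bar> \<le> b * 1" unfolding abs_mult using b_bounds by (intro mult_mono) auto
  then show ?thesis using b_bounds by linarith
qed

lemma one_plus_e_cos_pos: "0 < 1 + e * cos y"
proof -
  have "\<bar>e * cos y\<bar> \<le> e * 1" unfolding abs_mult using e_pos by (intro mult_mono) auto
  then show ?thesis using e_small by linarith
qed

lemma one_minus_e_cos_bounds: "0 < 1 - e * cos y" "1 - e * cos y \<le> 1 + e"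
proof -
  have "\<bar>e * cos y\<bar> \<le> e * 1" unfolding abs_mult using e_pos by (intro mult_mono) auto
  then show "0 < 1 - e * cos y" "1 - e * cos y \<le> 1 + e" using e_small by linarith+
qed

text \<open>The eccentric and the true anomaly are related by a Moebius map of the unit circle.\<close>

lemma cis_ecc: "cis (ecc t) * (1 + of_real b * cis (f t)) = cis (f t) + of_real b"
proof -
  define y where "y = f t"
  define x where "x = b * sin y / (1 + b * cos y)"
  have p: "1 + b * cos y \<noteq> 0" using one_plus_b_cos_pos[of y] by simp
  have "cis (ecc t) * cis (2 * arctan x) = cis y"
    by (simp add: cis_mult ecc_def x_def y_def)
  then have 1: "cis (ecc t) * (1 + \<i> * x) = cis y * (1 - \<i> * x)"
  proof -
    have "1 - \<i> * x \<noteq> 0" by (simp add: complex_eq_iff)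
    with \<open>cis (ecc t) * cis (2 * arctan x) = cis y\<close> show ?thesis
      unfolding cis_double_arctan by (simp add: field_simps)
  qed
  have x1: "of_real (1 + b * cos y) * (1 + \<i> * x) = 1 + of_real b * cis y"
    using p by (simp add: complex_eq_iff x_def)
  have x2: "of_real (1 + b * cos y) * (1 - \<i> * x) = 1 + of_real b * cis (- y)"
    using p by (simp add: complex_eq_iff x_def)
  have "cis (ecc t) * (1 + of_real b * cis y) = of_real (1 + b * cos y) * (cis (ecc t) * (1 + \<i> * x))"
    unfolding x1[symmetric] by (simp only: mult_ac)
  also have "\<dots> = cis y * (1 + of_real b * cis (- y))"
    unfolding 1 x2[symmetric] by (simp only: mult_ac)
  also have "\<dots> = cis y + of_real b * (cis y * cis (- y))" by (simp add: algebra_simps)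
  also have "cis y * cis (- y) = 1" by (simp add: cis_mult)
  finally show ?thesis by (simp add: y_def)
qed

text \<open>Both formulas are rational identities in \<open>u = cis f\<close> and \<open>z = cis E\<close>, which the Moebius relation
  links.\<close>

lemma
  shows primary_radius_ecc: "primary_radius e f t = 1 - e * cos (ecc t)"
    and orbit_pos_ecc: "of_real (primary_radius e f t) * cis (f t) = orbit_pos (ecc t)"
proof -
  define u z where "u = cis (f t)" and "z = cis (ecc t)"
  have u1: "u * cis (- f t) = 1" by (simp add: u_def cis_mult)
  have z1: "z * cis (- ecc t) = 1" by (simp add: z_def cis_mult)
  have eq: "z * (1 + of_real b * u) = u + of_real b" unfolding u_def z_def by (rule cis_ecc)
  have nz: "1 + of_real b * u \<noteq> 0"
  proof
    assume "1 + of_real b * u = 0"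
    then have "1 + b * cos (f t) = 0" by (simp add: u_def complex_eq_iff)
    then show False using one_plus_b_cos_pos[of "f t"] by simp
  qed
  have zb: "(1 - of_real b * z) * (1 + of_real b * u) = of_real (1 - b\<^sup>2)"
  proof -
    have "(1 - of_real b * z) * (1 + of_real b * u) = (1 + of_real b * u) - of_real b * (z * (1 + of_real b * u))"
      by (simp add: algebra_simps)
    then show ?thesis unfolding eq by (simp add: algebra_simps power2_eq_square)
  qed
  have ecosu: "of_real (1 + e * cos (f t)) * u = of_real a * (1 + of_real b * u) * (u + of_real b)"
  proof -
    have "of_real (1 + e * cos (f t)) * u = (of_real (a * (1 + b\<^sup>2)) + of_real (2 * a * b) * of_real (cos (f t))) * u"
      using ab a_b_sq by simp
    also have "of_real (cos (f t)) = (u + cis (- f t)) / 2" by (simp add: u_def complex_eq_iff)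
    also have "(of_real (a * (1 + b\<^sup>2)) + of_real (2 * a * b) * ((u + cis (- f t)) / 2)) * u
       = of_real a * ((1 + of_real (b\<^sup>2)) * u + of_real b * (u * u + u * cis (- f t)))"
      by (simp add: algebra_simps)
    also have "\<dots> = of_real a * (1 + of_real b * u) * (u + of_real b)"
      unfolding u1 by (simp add: algebra_simps power2_eq_square)
    finally show ?thesis .
  qed
  have s2: "1 - e\<^sup>2 = (a * (1 - b\<^sup>2))\<^sup>2"
  proof -
    have "1 - e\<^sup>2 = (a * (1 + b\<^sup>2))\<^sup>2 - (2 * a * b)\<^sup>2" using ab a_b_sq by simp
    then show ?thesis by (simp add: power2_eq_square algebra_simps)
  qed
  have pos: "0 < 1 + e * cos (f t)" by (rule one_plus_e_cos_pos)
  have b21: "1 - b\<^sup>2 \<noteq> 0" using b_bounds by (simp add: power2_eq_1_iff)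
  have a0: "a \<noteq> 0" using a_bounds by simp
  have unz: "u \<noteq> 0" "z \<noteq> 0" by (auto simp: u_def z_def)
  have R: "complex_of_real (primary_radius e f t) * of_real (1 + e * cos (f t)) = of_real (1 - e\<^sup>2)"
    unfolding primary_radius_def of_real_mult[symmetric] using pos by (intro arg_cong[where f=of_real]) simp
  have cis_m: "cis (- ecc t) * (u + of_real b) = 1 + of_real b * u"
  proof -
    have "cis (- ecc t) * (u + of_real b) = (z * cis (- ecc t)) * (1 + of_real b * u)"
      unfolding eq[symmetric] by (simp only: mult_ac)
    then show ?thesis unfolding z1 by simp
  qed
  have vb: "(1 - of_real b * cis (- ecc t)) * (u + of_real b) = u * of_real (1 - b\<^sup>2)"
  proof -
    have "(1 - of_real b * cis (- ecc t)) * (u + of_real b) = (u + of_real b) - of_real b * (cis (- ecc t) * (u + of_real b))"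
      by (simp add: algebra_simps)
    then show ?thesis unfolding cis_m by (simp add: algebra_simps power2_eq_square)
  qed
  have ub: "u + of_real b \<noteq> 0" using eq nz unz by auto
  have E: "complex_of_real (1 - e * cos (ecc t)) * ((1 + of_real b * u) * (u + of_real b)) = of_real a * (of_real (1 - b\<^sup>2))\<^sup>2 * u"
  proof -
    have "complex_of_real (1 - e * cos (ecc t)) * ((1 + of_real b * u) * (u + of_real b))
      = of_real a * ((1 - of_real b * z) * (1 + of_real b * u)) * ((1 - of_real b * cis (- ecc t)) * (u + of_real b))"
      unfolding orbit_radius_eq[symmetric] z_def by (simp only: mult_ac)
    then show ?thesis unfolding zb vb by (simp add: power2_eq_square)
  qed
  have "complex_of_real (primary_radius e f t) * (of_real a * ((1 + of_real b * u) * (u + of_real b)))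
     = of_real (1 - e\<^sup>2) * u"
  proof -
    have "complex_of_real (primary_radius e f t) * (of_real a * ((1 + of_real b * u) * (u + of_real b)))
      = complex_of_real (primary_radius e f t) * (of_real (1 + e * cos (f t)) * u)"
      unfolding ecosu by (simp only: mult.assoc)
    also have "\<dots> = of_real (1 - e\<^sup>2) * u" unfolding R[symmetric] by (simp only: mult.assoc)
    finally show ?thesis .
  qed
  also have "\<dots> = of_real a * (of_real a * (of_real (1 - b\<^sup>2))\<^sup>2 * u)"
    unfolding s2 by (simp add: power2_eq_square)
  also have "\<dots> = complex_of_real (1 - e * cos (ecc t)) * (of_real a * ((1 + of_real b * u) * (u + of_real b)))"
    unfolding E[symmetric] by (simp only: mult_ac)
  finally have "complex_of_real (primary_radius e f t) = complex_of_real (1 - e * cos (ecc t))"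
    using a0 nz ub by (subst (asm) mult_right_cancel) simp_all
  then show pr: "primary_radius e f t = 1 - e * cos (ecc t)" by (simp only: of_real_eq_iff)
  have u_z: "u * (1 - of_real b * z) = z - of_real b"
    using eq by (simp add: algebra_simps)
  have "of_real (primary_radius e f t) * u
     = of_real a * (u * (1 - of_real b * z)) * (1 - of_real b * cis (- ecc t))"
    unfolding pr orbit_radius_eq[symmetric] z_def by (simp only: mult_ac)
  also have "u * (1 - of_real b * z) = z * (1 - of_real b * cis (- ecc t))"
    unfolding u_z using z1 by (simp add: algebra_simps)
  finally show "of_real (primary_radius e f t) * cis (f t) = orbit_pos (ecc t)"
    by (simp add: orbit_pos_def z_def u_def power2_eq_square mult_ac)
qed

lemma continuous_f: "continuous_on UNIV f"
  using anomaly unfolding is_true_anomaly_def by (meson DERIV_continuous_on has_field_derivative_at_within)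

text \<open>In terms of the radius \<open>r\<close> the given equation is \<open>df/dt = sqrt (1 - e\<^sup>2) / r\<^sup>2\<close>, and
  \<open>dE/df = r / sqrt (1 - e\<^sup>2)\<close>.\<close>

lemma ecc_has_derivative: "(ecc has_real_derivative 1 / (1 - e * cos (ecc t))) (at t)"
proof -
  define y f' where "y = f t" and "f' = (1 + e * cos y)\<^sup>2 / (1 - e\<^sup>2) powr (3/2)"
  have f: "(f has_real_derivative f') (at t)"
    using anomaly unfolding is_true_anomaly_def f'_def y_def by blast
  have p: "1 + b * cos y > 0" by (rule one_plus_b_cos_pos)
  define x where "x = b * sin y / (1 + b * cos y)"
  have s: "(sin y)\<^sup>2 = 1 - (cos y)\<^sup>2" by (rule sin_squared_eq)
  define N where "N = 1 + 2 * b * cos y + b\<^sup>2"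
  have Npos: "N > 0"
  proof -
    have "N = (1 + b * cos y)\<^sup>2 + b\<^sup>2 * (sin y)\<^sup>2" unfolding s N_def by (simp add: power2_eq_square algebra_simps)
    then show ?thesis using p by (simp add: add_pos_nonneg)
  qed
  have x2: "1 + x\<^sup>2 = N / (1 + b * cos y)\<^sup>2"
  proof -
    have "N = (1 + b * cos y)\<^sup>2 + b\<^sup>2 * (sin y)\<^sup>2" unfolding s N_def by (simp add: power2_eq_square algebra_simps)
    then show ?thesis using p by (simp add: x_def power_divide power_mult_distrib field_simps)
  qed
  have dx: "((\<lambda>t. b * sin (f t) / (1 + b * cos (f t))) has_real_derivative
      ((b * cos y + b\<^sup>2) / (1 + b * cos y)\<^sup>2) * f') (at t)"
  proof -
    have "((\<lambda>t. b * sin (f t) / (1 + b * cos (f t))) has_real_derivative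
      (b * (cos y * f') * (1 + b * cos y) - b * sin y * (b * (- (sin y * f')))) / ((1 + b * cos y) * (1 + b * cos y))) (at t)"
      using p unfolding y_def by (auto intro!: derivative_eq_intros f simp: y_def mult_ac)
    also have "(b * (cos y * f') * (1 + b * cos y) - b * sin y * (b * (- (sin y * f')))) = (b * cos y + b\<^sup>2 * ((cos y)\<^sup>2 + (sin y)\<^sup>2)) * f'"
    proof -
      have "b * (c * f') * (1 + b * c) - b * s * (b * (- (s * f'))) = (b * c + b\<^sup>2 * (c\<^sup>2 + s\<^sup>2)) * f'" for c s
        by (simp add: power2_eq_square algebra_simps)
      then show ?thesis .
    qed
    finally show ?thesis by (simp only: sin_cos_squared_add2 power2_eq_square[of "1 + b * cos y"] mult_1_right times_divide_eq_left)
  qed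
  have "(ecc has_real_derivative f' - 2 * (((b * cos y + b\<^sup>2) / (1 + b * cos y)\<^sup>2) * f' * inverse (1 + x\<^sup>2))) (at t)"
    unfolding ecc_def[abs_def]
    by (rule derivative_eq_intros f dx DERIV_chain2[where f=arctan] refl DERIV_arctan | simp add: x_def y_def)+
  also have "f' - 2 * (((b * cos y + b\<^sup>2) / (1 + b * cos y)\<^sup>2) * f' * inverse (1 + x\<^sup>2)) = f' * ((1 - b\<^sup>2) / N)"
  proof -
    have "((b * cos y + b\<^sup>2) / (1 + b * cos y)\<^sup>2) * f' * inverse (1 + x\<^sup>2) = f' * ((b * cos y + b\<^sup>2) / N)"
      unfolding x2 using p Npos by (simp add: field_simps)
    then have "f' - 2 * (((b * cos y + b\<^sup>2) / (1 + b * cos y)\<^sup>2) * f' * inverse (1 + x\<^sup>2)) = f' * ((N - 2 * (b * cos y + b\<^sup>2)) / N)"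
      using Npos by (simp add: diff_divide_distrib right_diff_distrib)
    then show ?thesis by (simp add: N_def)
  qed
  also have "\<dots> = 1 / (1 - e * cos (ecc t))"
  proof -
    \<comment> \<open>\<open>w\<close> below is \<open>sqrt (1 - e\<^sup>2)\<close>.\<close>
    have aN: "a * N = 1 + e * cos y"
    proof -
      have "a * N = a * (1 + b\<^sup>2) + (2 * a * b) * cos y" by (simp add: N_def algebra_simps)
      then show ?thesis using ab a_b_sq by simp
    qed
    define w where "w = a * (1 - b\<^sup>2)"
    have "1 - e\<^sup>2 = (a * (1 + b\<^sup>2))\<^sup>2 - (2 * a * b)\<^sup>2" using ab a_b_sq by simp
    then have w2: "1 - e\<^sup>2 = w\<^sup>2" by (simp add: w_def power2_eq_square algebra_simps)
    have "b\<^sup>2 < 1" using power_strict_mono[of b 1 2] b_bounds by simp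
    then have w0: "w > 0" using a_bounds by (simp add: w_def)
    have "(1 - e\<^sup>2) powr (3/2) = (w powr 2) powr (3/2)"
      unfolding w2 using w0 by simp
    also have "\<dots> = w powr 3" unfolding powr_powr by simp
    also have "\<dots> = w ^ 3" using w0 by simp
    finally have "(1 - e\<^sup>2) powr (3/2) = w ^ 3" .
    then have "f' * ((1 - b\<^sup>2) / N) = (1 + e * cos y)\<^sup>2 / w ^ 3 * ((a * (1 - b\<^sup>2)) / (a * N))"
      using a_bounds by (simp add: f'_def)
    also have "\<dots> = (1 + e * cos y) / w\<^sup>2"
    proof -
      have "X\<^sup>2 / w ^ 3 * (w / X) = X / w\<^sup>2" if "X > 0" for X
        using that w0 by (simp add: field_simps power2_eq_square power3_eq_cube)
      then show ?thesis unfolding aN w_def[symmetric] using one_plus_e_cos_pos[of y] by blast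
    qed
    also have "\<dots> = 1 / primary_radius e f t" unfolding w2[symmetric] by (simp add: primary_radius_def y_def)
    finally show ?thesis by (simp add: primary_radius_ecc)
  qed
  finally show ?thesis .
qed

text \<open>The derivative of \<open>E - e * sin E\<close> is 1, and \<open>E\<close> vanishes at time 0.\<close>

lemma kepler_equation: "ecc t - e * sin (ecc t) = t"
proof -
  define k where "k = (\<lambda>t. ecc t - e * sin (ecc t) - t)"
  have "(k has_real_derivative 0) (at t)" for t
  proof -
    have "(k has_real_derivative (1 / (1 - e * cos (ecc t)) - e * (cos (ecc t) * (1 / (1 - e * cos (ecc t)))) - 1)) (at t)"
      unfolding k_def by (auto intro!: derivative_eq_intros ecc_has_derivative)
    moreover have "1 / (1 - e * cos (ecc t)) - e * (cos (ecc t) * (1 / (1 - e * cos (ecc t)))) - 1 = 0"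
      using one_minus_e_cos_bounds(1)[of "ecc t"] by (simp add: field_simps)
    ultimately show ?thesis by simp
  qed
  then have "k t = k 0" by (intro DERIV_isconst_all) blast
  moreover have "ecc 0 = 0" using anomaly by (simp add: ecc_def is_true_anomaly_def)
  ultimately show ?thesis by (simp add: k_def)
qed

lemma kepler_strict_mono: "strict_mono (\<lambda>E. E - e * sin E)"
proof (rule strict_monoI)
  fix x y :: real assume "x < y"
  then show "x - e * sin x < y - e * sin y"
  proof (rule DERIV_pos_imp_increasing)
    fix z
    have "((\<lambda>E. E - e * sin E) has_real_derivative 1 - e * cos z) (at z)" by (auto intro!: derivative_eq_intros)
    then show "\<exists>d. ((\<lambda>E. E - e * sin E) has_real_derivative d) (at z) \<and> 0 < d"
      using one_minus_e_cos_bounds(1) by blast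
  qed
qed

lemma ecc_kepler: "ecc (E - e * sin E) = E"
  using kepler_equation[of "E - e * sin E"] strict_mono_eq[OF kepler_strict_mono] by blast

lemma ecc_period: "ecc (t + 2 * pi) = ecc t + 2 * pi"
proof -
  have "t + 2 * pi = (ecc t + 2 * pi) - e * sin (ecc t + 2 * pi)"
    using kepler_equation[of t] by simp
  then show ?thesis using ecc_kepler[of "ecc t + 2 * pi"] by (simp only:)
qed

lemma continuous_ecc: "continuous_on A ecc"
  using ecc_has_derivative by (meson DERIV_continuous_on has_field_derivative_at_within)

definition orbit_monomial :: "nat \<Rightarrow> nat \<Rightarrow> real \<Rightarrow> complex" where
  "orbit_monomial l m t = (of_real (primary_radius e f t) * cis (- f t)) ^ l
     * (of_real (primary_radius e f t) * cis (f t)) ^ m"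

lemma orbit_monomial_ecc: "orbit_monomial l m t = cnj (orbit_pos (ecc t)) ^ l * orbit_pos (ecc t) ^ m"
proof -
  have "of_real (primary_radius e f t) * cis (- f t) = cnj (of_real (primary_radius e f t) * cis (f t))"
    by (simp add: cis_cnj)
  then show ?thesis unfolding orbit_monomial_def orbit_pos_ecc by simp
qed

lemma continuous_orbit_monomial: "continuous_on A (orbit_monomial l m)"
  unfolding orbit_monomial_ecc[abs_def] orbit_pos_eq Complex_eq
  by (intro continuous_intros continuous_ecc)

text \<open>Substitution of the eccentric anomaly for the time.\<close>

lemma orbit_monomial_fourier_coeff:
  "integral {0..2*pi} (\<lambda>t. orbit_monomial l m t * cis (- (of_int q * t))) = 2 * pi * orbit_coeff q l m"
proof -
  define g where "g = (\<lambda>t. orbit_monomial l m t * cis (- (of_int q * t)))"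
  define k where "k = (\<lambda>E::real. E - e * sin E)"
  have gc: "continuous_on A g" for A
    unfolding g_def by (intro continuous_intros continuous_orbit_monomial)
  have km: "x \<le> y \<Longrightarrow> k x \<le> k y" for x y
    using strict_mono_less_eq[OF kepler_strict_mono] unfolding k_def by blast
  have k0: "k 0 = 0" "k (2 * pi) = 2 * pi" by (auto simp: k_def)
  have "((\<lambda>E. (1 - e * cos E) *\<^sub>R g (k E)) has_integral integral {k 0..k (2*pi)} g) {0..2*pi}"
  proof (rule has_integral_substitution)
    show "k ` {0..2 * pi} \<subseteq> {0..2*pi}" using km[of 0] km[of _ "2 * pi"] k0 by auto
    show "(k has_real_derivative 1 - e * cos x) (at x within {0..2 * pi})" for x
      unfolding k_def by (auto intro!: derivative_eq_intros)
  qed (use gc k0 in auto)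
  then have "((\<lambda>E. orbit_kernel q l m (cis E)) has_integral integral {0..2*pi} g) {0..2*pi}"
    unfolding k0 by (simp add: g_def k_def orbit_monomial_ecc ecc_kepler orbit_kernel_cis scaleR_conv_of_real mult_ac)
  then show ?thesis by (simp add: g_def orbit_coeff_def circle_mean_def integral_unique)
qed

lemma orbit_monomial_period: "orbit_monomial l m (t + 2 * pi) = orbit_monomial l m t"
  unfolding orbit_monomial_ecc ecc_period orbit_pos_eq by simp

text \<open>Trades the factor \<open>exp \<bar>q\<bar>\<close> for powers of 3, so that the bound is summable over \<open>q\<close>.\<close>

lemma orbit_coeff_bound_geometric:
  "norm (orbit_coeff q l m) \<le> (5/2) * (15/2) ^ (l + m) * (1/2) ^ nat \<bar>q - (int m - int l)\<bar>"
proof -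
  define d where "d = nat \<bar>int m - int l - q\<bar>"
  have "\<bar>real_of_int q\<bar> \<le> real (l + m) + real d"
    by (simp add: d_def)
  then have "exp \<bar>real_of_int q\<bar> \<le> exp (real (l + m)) * exp (real d)" by (simp flip: exp_add)
  also have "\<dots> = exp 1 ^ (l + m) * exp 1 ^ d" by (simp flip: exp_of_nat_mult)
  also have "\<dots> \<le> 3 ^ (l + m) * 3 ^ d" using exp_le by (intro mult_mono power_mono) auto
  finally have ex: "exp \<bar>real_of_int q\<bar> \<le> 3 ^ (l + m) * 3 ^ d" .
  have "norm (orbit_coeff q l m) \<le> (5/2) ^ (l + m + 1) * e ^ d * exp \<bar>real_of_int q\<bar>"
    unfolding d_def by (rule orbit_coeff_bound)
  also have "\<dots> \<le> (5/2) ^ (l + m + 1) * e ^ d * (3 ^ (l + m) * 3 ^ d)"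
    using e_pos ex by (intro mult_left_mono) auto
  also have "\<dots> = (5/2) * (15/2) ^ (l + m) * (3 * e) ^ d"
  proof -
    have "(15/2::real) ^ (l + m) = (5/2) ^ (l + m) * 3 ^ (l + m)" by (simp flip: power_mult_distrib)
    then show ?thesis by (simp add: power_mult_distrib)
  qed
  also have "\<dots> \<le> (5/2) * (15/2) ^ (l + m) * (1/2) ^ d"
    using e_pos e_small by (intro mult_left_mono power_mono) auto
  also have "d = nat \<bar>q - (int m - int l)\<bar>" by (simp add: d_def)
  finally show ?thesis .
qed

lemma orbit_monomial_has_sum:
  "((\<lambda>q. orbit_coeff q l m * cis (of_int q * t)) has_sum orbit_monomial l m t) UNIV"
proof (rule fourier_series_has_sum)
  show "continuous_on UNIV (orbit_monomial l m)" by (rule continuous_orbit_monomial)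
  show "orbit_monomial l m (t + 2 * pi) = orbit_monomial l m t" for t by (rule orbit_monomial_period)
  show "integral {0..2*pi} (\<lambda>t. orbit_monomial l m t * cis (- (of_int q * t))) = 2 * pi * orbit_coeff q l m" for q
    by (rule orbit_monomial_fourier_coeff)
  show "(\<lambda>q. (5/2) * (15/2::real) ^ (l + m) * (1/2) ^ nat \<bar>q - (int m - int l)\<bar>) summable_on (UNIV :: int set)"
    by (rule has_sum_imp_summable[OF has_sum_cmult_right[OF has_sum_geometric_int]]) auto
qed (rule orbit_coeff_bound_geometric)

end

section \<open>Oscillatory integrals along the parabola\<close>

lemma has_bochner_integral_gaussian:
  assumes "0 < c"
  shows "has_bochner_integral lborel (\<lambda>x::real. exp (- c * x\<^sup>2)) (sqrt (pi / c))"
proof -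
  define \<sigma> where "\<sigma> = 1 / sqrt (2 * c)"
  have s: "\<sigma> > 0" "\<sigma>\<^sup>2 = 1 / (2 * c)" using assms by (auto simp: \<sigma>_def power_divide)
  have "has_bochner_integral lborel (\<lambda>x. sqrt (pi / c) * normal_density 0 \<sigma> x) (sqrt (pi / c) * 1)"
    using s(1) by (intro has_bochner_integral_mult_right) (simp add: has_bochner_integral_iff)
  moreover have "sqrt (pi / c) * normal_density 0 \<sigma> x = exp (- c * x\<^sup>2)" for x
    using assms by (simp add: normal_density_def s(2))
  ultimately show ?thesis by simp
qed

text \<open>On the real line \<open>inverse (1 - \<i> z)\<^sup>2\<close> is the parabola's \<open>cis (2 arctan z) / (1 + z\<^sup>2)\<close>, and
  \<open>z + z^3 / 3\<close> is the time on the parabola up to the factor \<open>G^3 / 2\<close>.\<close>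

definition parab_kernel :: "real \<Rightarrow> nat \<Rightarrow> nat \<Rightarrow> complex \<Rightarrow> complex" where
  "parab_kernel w l m z = exp (\<i> * of_real w * (z + z ^ 3 / 3))
     * inverse (1 - \<i> * z) ^ (2 * l) * inverse (1 + \<i> * z) ^ (2 * m)"

definition parab_integral :: "real \<Rightarrow> nat \<Rightarrow> nat \<Rightarrow> complex" where
  "parab_integral w l m = (LBINT x. parab_kernel w l m (of_real x))"

definition lorentzian :: "real \<Rightarrow> real" where
  "lorentzian x = inverse (1 + x\<^sup>2)"

lemma one_plus_square_ne_zero: "1 + x\<^sup>2 \<noteq> (0::real)"
  using zero_le_power2[of x] by linarith

lemma lorentzian_bounds: "0 < lorentzian x" "lorentzian x \<le> 1"
  by (auto simp: lorentzian_def inverse_le_1_iff add_pos_nonneg)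

lemma square_mult_lorentzian: "x\<^sup>2 * lorentzian x = 1 - lorentzian x"
  using one_plus_square_ne_zero[of x] by (simp add: lorentzian_def field_simps)

lemma DERIV_lorentzian: "(lorentzian has_real_derivative - (2 * x) * lorentzian x ^ 2) (at x)"
  unfolding lorentzian_def[abs_def] using one_plus_square_ne_zero[of x]
  by (auto intro!: derivative_eq_intros simp: power2_eq_square)

lemma tendsto_lorentzian:
  "(lorentzian \<longlongrightarrow> 0) at_top" "(lorentzian \<longlongrightarrow> 0) at_bot"
  "((\<lambda>x. x * lorentzian x) \<longlongrightarrow> 0) at_top" "((\<lambda>x. x * lorentzian x) \<longlongrightarrow> 0) at_bot"
  unfolding lorentzian_def by real_asymp+

lemma continuous_lorentzian: "continuous_on A lorentzian"
  unfolding lorentzian_def using one_plus_square_ne_zero by (intro continuous_intros) auto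

lemma integrable_lorentzian: "integrable lborel lorentzian"
  using integrable_inverse_1_plus_square by (simp add: set_integrable_def einterval_def lorentzian_def[abs_def])

lemma lorentzian_power_le: "k \<le> n \<Longrightarrow> lorentzian x ^ n \<le> lorentzian x ^ k"
  using lorentzian_bounds[of x] by (intro power_decreasing) auto

lemma integrable_lorentzian_power:
  assumes "1 \<le> n"
  shows "integrable lborel (\<lambda>x. lorentzian x ^ n)"
proof (rule Bochner_Integration.integrable_bound[OF integrable_lorentzian])
  show "(\<lambda>x. lorentzian x ^ n) \<in> borel_measurable lborel"
    using borel_measurable_continuous_onI[OF continuous_on_power[OF continuous_lorentzian]] by simp
  show "AE x in lborel. norm (lorentzian x ^ n) \<le> norm (lorentzian x)"
    using lorentzian_power_le[OF assms] lorentzian_bounds by (auto simp: less_imp_le)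
qed

lemma norm_parab_kernel_real: "norm (parab_kernel w l m (of_real x)) = lorentzian x ^ (l + m)"
proof -
  have "norm (exp (\<i> * of_real w * (of_real x + of_real x ^ 3 / 3))) = 1"
    by (simp add: norm_exp_eq_Re flip: of_real_power)
  moreover have "norm (1 - \<i> * of_real x) ^ 2 = 1 + x\<^sup>2" "norm (1 + \<i> * of_real x) ^ 2 = 1 + x\<^sup>2"
    unfolding cmod_power2 by simp_all
  ultimately show ?thesis
    by (simp add: parab_kernel_def lorentzian_def norm_mult norm_power norm_inverse power_mult power_inverse power_add)
qed

lemma one_plus_ne_zero [simp]: "1 - \<i> * complex_of_real x \<noteq> 0" "1 + \<i> * complex_of_real x \<noteq> 0"
  by (simp_all add: complex_eq_iff)

lemma continuous_parab_kernel_real: "continuous_on A (\<lambda>x. parab_kernel w l m (of_real x))"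
  unfolding parab_kernel_def by (intro continuous_intros) auto

lemma integrable_parab_kernel:
  assumes "1 \<le> l + m"
  shows "integrable lborel (\<lambda>x. parab_kernel w l m (of_real x))"
proof (rule Bochner_Integration.integrable_bound[OF integrable_lorentzian_power[OF assms]])
  show "(\<lambda>x. parab_kernel w l m (of_real x)) \<in> borel_measurable lborel"
    using borel_measurable_continuous_onI[OF continuous_parab_kernel_real] by simp
qed (use lorentzian_bounds in \<open>auto simp: norm_parab_kernel_real less_imp_le\<close>)

lemma cnj_parab_kernel: "cnj (parab_kernel w l m z) = parab_kernel (- w) m l (cnj z)"
  by (simp add: parab_kernel_def exp_cnj mult_ac)

lemma parab_kernel_uminus: "parab_kernel w l m (- z) = parab_kernel (- w) m l z"
proof -
  have "\<i> * of_real w * (- z + (- z) ^ 3 / 3) = \<i> * of_real (- w) * (z + z ^ 3 / 3)"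
    by (simp add: algebra_simps)
  then show ?thesis by (simp add: parab_kernel_def mult_ac)
qed

lemma parab_integral_swap: "parab_integral (- w) m l = parab_integral w l m"
proof -
  have "parab_integral w l m = (LBINT x. parab_kernel w l m (of_real (0 + (- 1) * x)))"
    unfolding parab_integral_def by (subst lborel_integral_real_affine[of "-1" _ 0]) auto
  then show ?thesis by (simp add: parab_kernel_uminus parab_integral_def)
qed

text \<open>Reflection of the line conjugates the kernel.\<close>

lemma parab_integral_real: "Im (parab_integral w l m) = 0"
proof -
  have "cnj (parab_integral w l m) = (LBINT x. cnj (parab_kernel w l m (of_real x)))"
    by (simp add: parab_integral_def)
  also have "\<dots> = parab_integral (- w) m l"
    by (simp add: cnj_parab_kernel parab_integral_def)
  finally show ?thesis by (simp add: parab_integral_swap complex_eq_iff)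
qed

lemma integral_lorentzian_square: "(LBINT x. lorentzian x ^ 2) = pi / 2"
proof -
  define F where "F = (\<lambda>x::real. (x * lorentzian x) / 2 + arctan x / 2)"
  have F: "((\<lambda>x. complex_of_real (F x)) has_vector_derivative complex_of_real (lorentzian x ^ 2)) (at x)" for x
  proof -
    have "(F has_real_derivative (lorentzian x + x * (- (2 * x) * lorentzian x ^ 2)) / 2 + lorentzian x / 2) (at x)"
      unfolding F_def by (auto intro!: derivative_eq_intros DERIV_lorentzian simp: lorentzian_def[of x])
    also have "(lorentzian x + x * (- (2 * x) * lorentzian x ^ 2)) / 2 + lorentzian x / 2
       = lorentzian x - (x\<^sup>2 * lorentzian x) * lorentzian x"
      by (simp add: power2_eq_square field_simps)
    also have "\<dots> = lorentzian x ^ 2"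
      unfolding square_mult_lorentzian by (simp add: power2_eq_square algebra_simps)
    finally show ?thesis by (rule has_vector_derivative_of_real)
  qed
  have "(LBINT x. complex_of_real (lorentzian x ^ 2)) = of_real (0 / 2 + (pi / 2) / 2) - of_real (0 / 2 + (- (pi / 2)) / 2)"
  proof (rule integral_FTC_line[OF F])
    show "continuous_on UNIV (\<lambda>x. complex_of_real (lorentzian x ^ 2))"
      by (intro continuous_intros continuous_lorentzian)
    show "integrable lborel (\<lambda>x. complex_of_real (lorentzian x ^ 2))"
      by (rule integrable_of_real[OF integrable_lorentzian_power]) simp
    show "((\<lambda>x. complex_of_real (F x)) \<longlongrightarrow> of_real (0 / 2 + (- (pi / 2)) / 2)) at_bot"
      unfolding F_def by (intro tendsto_intros tendsto_lorentzian tendsto_arctan_at_bot) simp_all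
    show "((\<lambda>x. complex_of_real (F x)) \<longlongrightarrow> of_real (0 / 2 + (pi / 2) / 2)) at_top"
      unfolding F_def by (intro tendsto_intros tendsto_lorentzian tendsto_arctan_at_top) simp_all
  qed
  then have "complex_of_real (LBINT x. lorentzian x ^ 2) = of_real (pi / 2)"
    unfolding integral_complex_of_real by simp
  then show ?thesis by (simp only: of_real_eq_iff)
qed

lemma parab_integral_norm_le: "2 \<le> l + m \<Longrightarrow> norm (parab_integral w l m) \<le> 2"
proof -
  assume lm: "2 \<le> l + m"
  have "norm (parab_integral w l m) \<le> (LBINT x. lorentzian x ^ 2)"
    unfolding parab_integral_def
  proof (rule Bochner_Integration.integral_norm_bound_integral)
    show "norm (parab_kernel w l m (of_real x)) \<le> lorentzian x ^ 2" for x
      unfolding norm_parab_kernel_real by (rule lorentzian_power_le[OF lm])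
  qed (use lm in \<open>auto intro!: integrable_parab_kernel integrable_lorentzian_power\<close>)
  then show ?thesis using pi_less_4 by (simp add: integral_lorentzian_square)
qed

lemma inverse_one_plus_minus:
  "inverse (1 - \<i> * complex_of_real x) = (1 + \<i> * of_real x) * of_real (lorentzian x)"
  "inverse (1 + \<i> * complex_of_real x) = (1 - \<i> * of_real x) * of_real (lorentzian x)"
  "(1 - \<i> * of_real x) * (1 + \<i> * of_real x) * complex_of_real (lorentzian x) = 1"
proof -
  have "(1 - \<i> * of_real x) * (1 + \<i> * of_real x) = complex_of_real (1 + x\<^sup>2)"
    by (simp add: power2_eq_square algebra_simps)
  then have "(1 - \<i> * of_real x) * (1 + \<i> * of_real x) * complex_of_real (lorentzian x) = of_real ((1 + x\<^sup>2) * lorentzian x)"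
    by (simp only: of_real_mult)
  also have "(1 + x\<^sup>2) * lorentzian x = 1" using one_plus_square_ne_zero[of x] by (simp add: lorentzian_def)
  finally show 1: "(1 - \<i> * of_real x) * (1 + \<i> * of_real x) * complex_of_real (lorentzian x) = 1" by simp
  show "inverse (1 - \<i> * complex_of_real x) = (1 + \<i> * of_real x) * of_real (lorentzian x)"
    by (rule inverse_unique) (simp only: mult.assoc[symmetric] 1)
  show "inverse (1 + \<i> * complex_of_real x) = (1 - \<i> * of_real x) * of_real (lorentzian x)"
    by (rule inverse_unique) (simp only: mult.assoc[symmetric] mult.commute[of "1 + \<i> * of_real x" "1 - \<i> * of_real x"] 1)
qed

lemma parab_integral_0_1_1: "parab_integral 0 1 1 = of_real (pi / 2)"
proof -
  have "parab_kernel 0 1 1 (of_real x) = of_real (lorentzian x ^ 2)" for x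
  proof -
    have "parab_kernel 0 1 1 (of_real x) = (inverse (1 - \<i> * of_real x) * inverse (1 + \<i> * of_real x)) ^ 2"
      by (simp add: parab_kernel_def power_mult_distrib)
    also have "inverse (1 - \<i> * of_real x) * inverse (1 + \<i> * of_real x)
       = ((1 - \<i> * of_real x) * (1 + \<i> * of_real x) * complex_of_real (lorentzian x)) * of_real (lorentzian x)"
      unfolding inverse_one_plus_minus(1,2) by (simp only: mult_ac)
    finally show ?thesis unfolding inverse_one_plus_minus(3) by simp
  qed
  then have "parab_integral 0 1 1 = (LBINT x. complex_of_real (lorentzian x ^ 2))" by (simp only: parab_integral_def)
  then show ?thesis unfolding integral_complex_of_real integral_lorentzian_square .
qed

text \<open>Without oscillation the kernel \<open>inverse (1 - \<i> z)^(2 l)\<close> has a primitive that vanishes at infinity.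
  Thus harmonics with \<open>q = 0\<close> begin at \<open>l, m \<ge> 1\<close>.\<close>

lemma parab_integral_0_l_0:
  assumes "1 \<le> l"
  shows "parab_integral 0 l 0 = 0"
proof -
  obtain k where k: "2 * l = Suc (Suc k)" using assms by (cases l) auto
  define g where "g = (\<lambda>z::complex. inverse (1 - \<i> * z))"
  define C where "C = (1 + of_nat k) * \<i>"
  have C: "C \<noteq> 0" by (simp add: C_def) (metis of_nat_Suc of_nat_eq_0_iff nat.simps(3))
  have dg: "(g has_field_derivative \<i> * g (of_real x) ^ 2) (at (of_real x))" for x :: real
    unfolding g_def by (auto intro!: derivative_eq_intros simp: power2_eq_square)
  have F: "((\<lambda>x. g (of_real x) ^ Suc k / C) has_vector_derivative parab_kernel 0 l 0 (of_real x)) (at x)" for x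
  proof -
    have "((\<lambda>z. g z ^ Suc k / C) has_field_derivative (1 + of_nat k) * (\<i> * g (of_real x) ^ 2 * g (of_real x) ^ k) / C) (at (of_real x))"
      by (intro DERIV_cdivide DERIV_power_Suc dg)
    also have "(1 + of_nat k) * (\<i> * g (of_real x) ^ 2 * g (of_real x) ^ k) / C = g (of_real x) ^ (2 + k)"
    proof -
      have "(1 + of_nat k) * (\<i> * g (of_real x) ^ 2 * g (of_real x) ^ k) = C * g (of_real x) ^ (2 + k)"
        by (simp only: C_def power_add mult_ac)
      then show ?thesis by (simp only: nonzero_mult_div_cancel_left[OF C])
    qed
    also have "\<dots> = parab_kernel 0 l 0 (of_real x)" by (simp add: parab_kernel_def k g_def)
    finally show ?thesis by (rule has_vector_derivative_real_field)
  qed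
  have n: "norm (g (of_real x) ^ Suc k / C) = inverse (sqrt (1 + x\<^sup>2)) ^ Suc k / norm C" for x
    unfolding g_def norm_divide norm_power norm_inverse by (simp add: cmod_def)
  have "((\<lambda>x::real. inverse (sqrt (1 + x\<^sup>2))) \<longlongrightarrow> 0) at_top" "((\<lambda>x::real. inverse (sqrt (1 + x\<^sup>2))) \<longlongrightarrow> 0) at_bot"
    by real_asymp+
  then have lim: "((\<lambda>x::real. inverse (sqrt (1 + x\<^sup>2)) ^ Suc k / norm C) \<longlongrightarrow> 0 ^ Suc k / norm C) at_top"
    "((\<lambda>x::real. inverse (sqrt (1 + x\<^sup>2)) ^ Suc k / norm C) \<longlongrightarrow> 0 ^ Suc k / norm C) at_bot"
    using C by (intro tendsto_intros; simp)+
  have "parab_integral 0 l 0 = 0 - 0"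
    unfolding parab_integral_def
  proof (rule integral_FTC_line[OF F continuous_parab_kernel_real integrable_parab_kernel])
    show "((\<lambda>x. g (complex_of_real x) ^ Suc k / C) \<longlongrightarrow> 0) at_bot" "((\<lambda>x. g (complex_of_real x) ^ Suc k / C) \<longlongrightarrow> 0) at_top"
      using lim unfolding tendsto_norm_zero_iff[symmetric, of "\<lambda>x. g (complex_of_real x) ^ Suc k / C"] n by simp_all
  qed (use assms in auto)
  then show ?thesis by simp
qed

text \<open>The imaginary part of the kernel is odd; the real part \<open>(1 - x\<^sup>2) / (1 + x\<^sup>2)^4\<close> has an elementary
  antiderivative \<open>A\<close>.\<close>

lemma parab_integral_0_2_1: "parab_integral 0 2 1 = of_real (pi / 4)"
proof -
  define v where "v = lorentzian"
  have ker: "parab_kernel 0 2 1 (of_real x) = of_real ((1 - x\<^sup>2) * v x ^ 4) + \<i> * of_real (2 * x * v x ^ 4)" for x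
  proof -
    have "parab_kernel 0 2 1 (of_real x) = inverse (1 - \<i> * of_real x) ^ 4 * inverse (1 + \<i> * of_real x) ^ 2"
      by (simp add: parab_kernel_def)
    also have "\<dots> = (1 + \<i> * of_real x) ^ 4 * of_real (v x) ^ 4 * ((1 - \<i> * of_real x) ^ 2 * of_real (v x) ^ 2)"
      unfolding inverse_one_plus_minus(1,2) v_def power_mult_distrib ..
    also have "(1 + \<i> * complex_of_real x) ^ 4 = (1 + \<i> * of_real x) ^ 2 * (1 + \<i> * of_real x) ^ 2" by (simp flip: power_add)
    also have "(1 + \<i> * complex_of_real x) ^ 2 * (1 + \<i> * of_real x) ^ 2 * of_real (v x) ^ 4 * ((1 - \<i> * of_real x) ^ 2 * of_real (v x) ^ 2)
      = ((1 - \<i> * of_real x) * (1 + \<i> * of_real x) * complex_of_real (lorentzian x)) ^ 2 * (1 + \<i> * of_real x) ^ 2 * of_real (v x) ^ 4"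
      unfolding v_def power_mult_distrib by (simp only: mult_ac)
    also have "\<dots> = (1 + \<i> * of_real x) ^ 2 * of_real (v x) ^ 4"
      unfolding inverse_one_plus_minus(3) by simp
    also have "\<dots> = of_real ((1 - x\<^sup>2) * v x ^ 4) + \<i> * of_real (2 * x * v x ^ 4)"
      by (simp add: power2_eq_square algebra_simps)
    finally show ?thesis .
  qed
  define A where "A = (\<lambda>x. (x * v x) * v x ^ 2 / 3 + (x * v x) * v x / 6 + x * v x / 4 + arctan x / 4)"
  define B where "B = (\<lambda>x. - (v x ^ 3) / 3)"
  have dv: "(v has_real_derivative - (2 * x) * v x ^ 2) (at x)" for x
    unfolding v_def by (rule DERIV_lorentzian)
  have iv: "inverse (1 + x\<^sup>2) = v x" "c / (1 + x * x) = c * v x" for x c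
    by (simp_all add: v_def lorentzian_def power2_eq_square divide_inverse)
  have dA: "(A has_real_derivative (1 - x\<^sup>2) * v x ^ 4) (at x)" for x
  proof -
    define D where "D = - (2 * x) * v x ^ 2"
    have "(A has_real_derivative ((v x + x * D) * v x ^ 2 + (x * v x) * (2 * v x * D)) / 3
       + ((v x + x * D) * v x + (x * v x) * D) / 6 + (v x + x * D) / 4 + v x / 4) (at x)"
      unfolding A_def D_def by (auto intro!: derivative_eq_intros dv simp: iv eval_nat_numeral field_simps)
    also have "((v x + x * D) * v x ^ 2 + (x * v x) * (2 * v x * D)) / 3
       + ((v x + x * D) * v x + (x * v x) * D) / 6 + (v x + x * D) / 4 + v x / 4
       = (v x ^ 3 - 6 * (x\<^sup>2 * v x) * v x ^ 3) / 3 + (v x ^ 2 - 4 * (x\<^sup>2 * v x) * v x ^ 2) / 6 + (v x - 2 * (x\<^sup>2 * v x) * v x) / 4 + v x / 4"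
      by (simp add: D_def eval_nat_numeral algebra_simps)
    also have "\<dots> = v x ^ 4 - (x\<^sup>2 * v x) * v x ^ 3"
      unfolding v_def square_mult_lorentzian by (simp add: eval_nat_numeral field_simps)
    also have "\<dots> = (1 - x\<^sup>2) * v x ^ 4" by (simp add: eval_nat_numeral algebra_simps)
    finally show ?thesis .
  qed
  have dB: "(B has_real_derivative 2 * x * v x ^ 4) (at x)" for x
    unfolding B_def by (auto intro!: derivative_eq_intros dv simp: eval_nat_numeral mult_ac)
  have F: "((\<lambda>x. of_real (A x) + \<i> * of_real (B x)) has_vector_derivative parab_kernel 0 2 1 (of_real x)) (at x)" for x
    unfolding ker
    by (intro has_vector_derivative_add has_vector_derivative_mult_right has_vector_derivative_of_real dA dB)
  note lim = tendsto_lorentzian[folded v_def]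
  have "parab_integral 0 2 1 = (of_real (0 * 0 ^ 2 / 3 + 0 * 0 / 6 + 0 / 4 + (pi / 2) / 4) + \<i> * of_real (- (0 ^ 3) / 3))
      - (of_real (0 * 0 ^ 2 / 3 + 0 * 0 / 6 + 0 / 4 + (- (pi / 2)) / 4) + \<i> * of_real (- (0 ^ 3) / 3))"
    unfolding parab_integral_def
  proof (rule integral_FTC_line[OF F continuous_parab_kernel_real integrable_parab_kernel])
    show "((\<lambda>x. complex_of_real (A x) + \<i> * complex_of_real (B x)) \<longlongrightarrow>
        of_real (0 * 0 ^ 2 / 3 + 0 * 0 / 6 + 0 / 4 + (- (pi / 2)) / 4) + \<i> * of_real (- (0 ^ 3) / 3)) at_bot"
      unfolding A_def B_def by (intro tendsto_intros lim tendsto_arctan_at_bot) simp_all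
    show "((\<lambda>x. complex_of_real (A x) + \<i> * complex_of_real (B x)) \<longlongrightarrow>
        of_real (0 * 0 ^ 2 / 3 + 0 * 0 / 6 + 0 / 4 + (pi / 2) / 4) + \<i> * of_real (- (0 ^ 3) / 3)) at_top"
      unfolding A_def B_def by (intro tendsto_intros lim tendsto_arctan_at_top) simp_all
  qed simp
  then show ?thesis by simp
qed

section \<open>The saddle point\<close>

text \<open>The quadratic part of the phase at its critical point \<open>\<i>\<close>.\<close>

definition saddle_gauss :: "real \<Rightarrow> complex \<Rightarrow> complex" where
  "saddle_gauss w u = exp (- of_real w * u\<^sup>2)"

lemma norm_saddle_gauss: "norm (saddle_gauss w (Complex x y)) = exp (w * y\<^sup>2) * exp (- w * x\<^sup>2)"
  by (simp add: saddle_gauss_def norm_exp_eq_Re power2_eq_square algebra_simps flip: exp_add)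

lemma tendsto_gaussian_zero:
  assumes "0 < w"
  shows "((\<lambda>x::real. c * exp (- w * x\<^sup>2)) \<longlongrightarrow> 0) at_top" "((\<lambda>x::real. c * exp (- w * x\<^sup>2)) \<longlongrightarrow> 0) at_bot"
proof -
  have "((\<lambda>x::real. exp (- w * x\<^sup>2)) \<longlongrightarrow> 0) at_top" "((\<lambda>x::real. exp (- w * x\<^sup>2)) \<longlongrightarrow> 0) at_bot"
    using assms by real_asymp+
  then show "((\<lambda>x::real. c * exp (- w * x\<^sup>2)) \<longlongrightarrow> 0) at_top" "((\<lambda>x::real. c * exp (- w * x\<^sup>2)) \<longlongrightarrow> 0) at_bot"
    by (auto intro: tendsto_mult_right_zero)
qed

lemma integrable_gaussian: "0 < c \<Longrightarrow> integrable lborel (\<lambda>x::real. K * exp (- c * x\<^sup>2))"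
  using has_bochner_integral_gaussian[of c] by (intro integrable_mult_right) (auto simp: has_bochner_integral_iff)

lemma integral_gaussian: "0 < c \<Longrightarrow> (LBINT x::real. K * exp (- c * x\<^sup>2)) = K * sqrt (pi / c)"
  using has_bochner_integral_gaussian[of c] by (simp add: has_bochner_integral_iff)

lemma gaussian_dominated:
  fixes h :: "real \<Rightarrow> complex"
  assumes "0 < c" and h: "continuous_on UNIV h" and le: "\<And>x. norm (h x) \<le> K * exp (- c * x\<^sup>2)"
  shows "integrable lborel h" and "norm (integral\<^sup>L lborel h) \<le> K * sqrt (pi / c)"
proof -
  have i: "integrable lborel (\<lambda>x::real. K * exp (- c * x\<^sup>2))" by (rule integrable_gaussian[OF assms(1)])
  show int: "integrable lborel h"
  proof (rule Bochner_Integration.integrable_bound[OF i])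
    show "h \<in> borel_measurable lborel" using borel_measurable_continuous_onI[OF h] by simp
    show "AE x in lborel. norm (h x) \<le> norm (K * exp (- c * x\<^sup>2))"
      by (rule AE_I2) (use le in \<open>force intro: order_trans[OF _ abs_ge_self]\<close>)
  qed
  have "norm (integral\<^sup>L lborel h) \<le> (LBINT x::real. K * exp (- c * x\<^sup>2))"
    using int i le by (intro Bochner_Integration.integral_norm_bound_integral)
  then show "norm (integral\<^sup>L lborel h) \<le> K * sqrt (pi / c)" unfolding integral_gaussian[OF assms(1)] .
qed

text \<open>The poles of the kernel coincide with the critical point \<open>\<i>\<close>, so the model integral is a Gaussian with a
  pole of order \<open>2 m\<close>, taken along a line that passes the pole at distance \<open>\<eta>\<close>.\<close>

definition saddle_moment :: "real \<Rightarrow> real \<Rightarrow> nat \<Rightarrow> complex" where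
  "saddle_moment w \<eta> m = (LBINT x. saddle_gauss w (Complex x (- \<eta>)) * inverse (Complex x (- \<eta>)) ^ (2 * m))"

lemma continuous_Complex_line: "continuous_on A (\<lambda>x. Complex x y)"
  unfolding Complex_eq by (intro continuous_intros)

lemma continuous_saddle_moment_integrand:
  assumes "0 < \<eta>"
  shows "continuous_on A (\<lambda>x. saddle_gauss w (Complex x (- \<eta>)) * inverse (Complex x (- \<eta>)) ^ k)"
  unfolding saddle_gauss_def using assms
  by (intro continuous_intros continuous_Complex_line) (auto simp: complex_eq_iff)

lemma norm_inverse_line_le:
  assumes "0 < \<eta>"
  shows "norm (inverse (Complex x (- \<eta>)) ^ k) \<le> inverse \<eta> ^ k"
proof -
  have "\<eta> \<le> norm (Complex x (- \<eta>))" using abs_Im_le_cmod[of "Complex x (- \<eta>)"] assms by simp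
  then show ?thesis unfolding norm_power norm_inverse using assms
    by (intro power_mono le_imp_inverse_le) auto
qed

lemma norm_saddle_moment_integrand_le:
  assumes "0 < \<eta>"
  shows "norm (saddle_gauss w (Complex x (- \<eta>)) * inverse (Complex x (- \<eta>)) ^ k)
    \<le> (exp (w * \<eta>\<^sup>2) * inverse \<eta> ^ k) * exp (- w * x\<^sup>2)"
proof -
  have "norm (saddle_gauss w (Complex x (- \<eta>))) * norm (inverse (Complex x (- \<eta>)) ^ k)
     \<le> (exp (w * \<eta>\<^sup>2) * exp (- w * x\<^sup>2)) * inverse \<eta> ^ k"
    unfolding norm_saddle_gauss power2_minus by (intro mult_left_mono norm_inverse_line_le assms) auto
  then show ?thesis by (simp only: norm_mult mult_ac)
qed

lemma integrable_saddle_moment: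
  assumes "0 < \<eta>" "0 < w"
  shows "integrable lborel (\<lambda>x. saddle_gauss w (Complex x (- \<eta>)) * inverse (Complex x (- \<eta>)) ^ k)"
  by (rule gaussian_dominated(1)[OF assms(2) continuous_saddle_moment_integrand[OF assms(1)] norm_saddle_moment_integrand_le[OF assms(1)]])

lemma saddle_moment_0:
  assumes "0 < \<eta>" "0 < w"
  shows "saddle_moment w \<eta> 0 = of_real (sqrt (pi / w))"
proof -
  have dom: "norm (saddle_gauss w (Complex x y)) \<le> exp (w * \<eta>\<^sup>2) * exp (- w * x\<^sup>2)" if "- \<eta> \<le> y" "y \<le> 0" for x y
  proof -
    have "y\<^sup>2 \<le> \<eta>\<^sup>2" using that by (simp add: abs_le_square_iff[symmetric])
    then show ?thesis unfolding norm_saddle_gauss using assms by (intro mult_right_mono) auto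
  qed
  have c: "continuous_on UNIV (\<lambda>x. saddle_gauss w (Complex x y))" for y
    unfolding saddle_gauss_def by (intro continuous_intros continuous_Complex_line)
  have "(LBINT x. saddle_gauss w (Complex x 0)) = (LBINT x. saddle_gauss w (Complex x (- \<eta>)))"
  proof (rule integral_horizontal_line_shift[where lo="- \<eta> - 1" and hi=1 and B="\<lambda>x. exp (w * \<eta>\<^sup>2) * exp (- w * x\<^sup>2)"])
    show "saddle_gauss w holomorphic_on {z. - \<eta> - 1 < Im z \<and> Im z < 1}"
      unfolding saddle_gauss_def[abs_def] by (intro holomorphic_intros)
    show "integrable lborel (\<lambda>x. saddle_gauss w (Complex x (- \<eta>)))" "integrable lborel (\<lambda>x. saddle_gauss w (Complex x 0))"
      by (rule gaussian_dominated(1)[OF assms(2) c dom], use assms in auto)+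
    show "((\<lambda>x. exp (w * \<eta>\<^sup>2) * exp (- w * x\<^sup>2)) \<longlongrightarrow> 0) at_top" by (rule tendsto_gaussian_zero[OF assms(2)])
  qed (use assms dom in auto)
  moreover have "saddle_gauss w (Complex x 0) = of_real (1 * exp (- w * x\<^sup>2))" for x
  proof -
    have "Complex x 0 = of_real x" by (simp add: complex_eq_iff)
    then show ?thesis by (simp add: saddle_gauss_def exp_of_real[symmetric] del: exp_of_real)
  qed
  then have "(LBINT x. saddle_gauss w (Complex x 0)) = of_real (1 * sqrt (pi / w))"
    by (simp only: integral_complex_of_real integral_gaussian[OF assms(2)])
  ultimately show ?thesis by (simp add: saddle_moment_def)
qed

text \<open>Integration by parts: the integrand is the derivative of \<open>exp (- w u\<^sup>2) / u^(2 m + 1)\<close>.\<close>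

lemma saddle_moment_Suc:
  assumes "0 < \<eta>" "0 < w"
  shows "of_nat (2 * m + 1) * saddle_moment w \<eta> (Suc m) = - 2 * of_real w * saddle_moment w \<eta> m"
proof -
  define u where "u = (\<lambda>x. Complex x (- \<eta>))"
  define I where "I = (\<lambda>k x. saddle_gauss w (u x) * inverse (u x) ^ k)"
  have nz: "u x \<noteq> 0" for x using assms by (simp add: u_def complex_eq_iff)
  have int: "integrable lborel (I k)" for k unfolding I_def u_def by (rule integrable_saddle_moment[OF assms])
  have cont: "continuous_on UNIV (I k)" for k unfolding I_def u_def by (rule continuous_saddle_moment_integrand[OF assms(1)])
  have der: "(I (Suc (2 * m)) has_vector_derivative (- 2 * of_real w * I (2 * m) x - of_nat (2 * m + 1) * I (2 * Suc m) x)) (at x)" for x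
  proof -
    define g where "g = (\<lambda>z. saddle_gauss w (z - \<i> * of_real \<eta>) * inverse (z - \<i> * of_real \<eta>) ^ Suc (2 * m))"
    have ux: "complex_of_real x - \<i> * of_real \<eta> = u x" for x by (simp add: u_def complex_eq_iff)
    have d1: "((\<lambda>z. saddle_gauss w (z - \<i> * of_real \<eta>)) has_field_derivative - 2 * of_real w * u x * saddle_gauss w (u x)) (at (of_real x))"
      unfolding saddle_gauss_def ux[symmetric] by (auto intro!: derivative_eq_intros)
    have d2: "((\<lambda>z. inverse (z - \<i> * of_real \<eta>)) has_field_derivative - (inverse (u x) ^ 2)) (at (of_real x))"
      unfolding ux[symmetric] by (auto intro!: derivative_eq_intros simp: ux nz power2_eq_square)
    have "(g has_field_derivative - 2 * of_real w * u x * saddle_gauss w (u x) * inverse (complex_of_real x - \<i> * of_real \<eta>) ^ Suc (2 * m)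
      + (1 + of_nat (2 * m)) * (- (inverse (u x) ^ 2) * inverse (complex_of_real x - \<i> * of_real \<eta>) ^ (2 * m)) * saddle_gauss w (complex_of_real x - \<i> * of_real \<eta>)) (at (of_real x))"
      unfolding g_def by (intro DERIV_mult d1 DERIV_power_Suc d2)
    also have "- 2 * of_real w * u x * saddle_gauss w (u x) * inverse (complex_of_real x - \<i> * of_real \<eta>) ^ Suc (2 * m)
      + (1 + of_nat (2 * m)) * (- (inverse (u x) ^ 2) * inverse (complex_of_real x - \<i> * of_real \<eta>) ^ (2 * m)) * saddle_gauss w (complex_of_real x - \<i> * of_real \<eta>)
      = - 2 * of_real w * I (2 * m) x - of_nat (2 * m + 1) * I (2 * Suc m) x"
      unfolding ux I_def using nz[of x] by (simp add: power2_eq_square)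
    finally have "((\<lambda>x. g (of_real x)) has_vector_derivative - 2 * of_real w * I (2 * m) x - of_nat (2 * m + 1) * I (2 * Suc m) x) (at x)"
      by (rule has_vector_derivative_real_field)
    moreover have "(\<lambda>x. g (of_real x)) = I (Suc (2 * m))" by (rule ext) (simp only: g_def ux I_def)
    ultimately show ?thesis by simp
  qed
  have lim: "(I k \<longlongrightarrow> 0) at_top" "(I k \<longlongrightarrow> 0) at_bot" for k
  proof -
    have le: "norm (I k x) \<le> (exp (w * \<eta>\<^sup>2) * inverse \<eta> ^ k) * exp (- w * x\<^sup>2)" for x
      unfolding I_def u_def by (rule norm_saddle_moment_integrand_le[OF assms(1)])
    show "(I k \<longlongrightarrow> 0) at_top"
      by (rule Lim_null_comparison[OF _ tendsto_gaussian_zero(1)[OF assms(2)]]) (rule always_eventually, use le in blast)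
    show "(I k \<longlongrightarrow> 0) at_bot"
      by (rule Lim_null_comparison[OF _ tendsto_gaussian_zero(2)[OF assms(2)]]) (rule always_eventually, use le in blast)
  qed
  have "(LBINT x. - 2 * of_real w * I (2 * m) x - of_nat (2 * m + 1) * I (2 * Suc m) x) = 0 - 0"
    by (rule integral_FTC_line[OF der _ _ lim(2) lim(1)]) (intro continuous_intros cont Bochner_Integration.integrable_diff integrable_mult_right int)+
  also have "(LBINT x. - 2 * of_real w * I (2 * m) x - of_nat (2 * m + 1) * I (2 * Suc m) x)
     = - 2 * of_real w * integral\<^sup>L lborel (I (2 * m)) - of_nat (2 * m + 1) * integral\<^sup>L lborel (I (2 * Suc m))"
    by (subst Bochner_Integration.integral_diff) (simp_all only: integral_mult_right_zero integrable_mult_right int)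
  finally show ?thesis unfolding saddle_moment_def I_def u_def by simp
qed

lemma saddle_moments:
  assumes "0 < \<eta>" "0 < w"
  shows "saddle_moment w \<eta> 2 = of_real (4/3 * w * sqrt (pi * w))"
    and "saddle_moment w \<eta> 3 = of_real (- 8/15 * w\<^sup>2 * sqrt (pi * w))"
proof -
  have s: "w * sqrt (pi / w) = sqrt (pi * w)"
  proof -
    have "sqrt (pi * w) = sqrt (w\<^sup>2 * (pi / w))" using assms(2) by (simp add: power2_eq_square)
    then show ?thesis using assms(2) by (simp only: real_sqrt_mult) simp
  qed
  have 1: "saddle_moment w \<eta> 1 = of_real (- 2 * sqrt (pi * w))"
    using saddle_moment_Suc[OF assms, of 0] saddle_moment_0[OF assms] by (simp flip: s)
  have "3 * saddle_moment w \<eta> 2 = - 2 * of_real w * saddle_moment w \<eta> 1"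
    using saddle_moment_Suc[OF assms, of 1] by (simp add: numeral_2_eq_2)
  then have "saddle_moment w \<eta> 2 = - 2 * of_real w * saddle_moment w \<eta> 1 / 3" by (simp add: field_simps)
  then show 2: "saddle_moment w \<eta> 2 = of_real (4/3 * w * sqrt (pi * w))" unfolding 1 by simp
  have "5 * saddle_moment w \<eta> 3 = - 2 * of_real w * saddle_moment w \<eta> 2"
    using saddle_moment_Suc[OF assms, of 2] by (simp add: numeral_3_eq_3 numeral_2_eq_2)
  then have "saddle_moment w \<eta> 3 = - 2 * of_real w * saddle_moment w \<eta> 2 / 5" by (simp add: field_simps)
  then show "saddle_moment w \<eta> 3 = of_real (- 8/15 * w\<^sup>2 * sqrt (pi * w))"
    unfolding 2 by (simp add: power2_eq_square)
qed

text \<open>With \<open>z = \<i> + u\<close> the phase is \<open>- 2 w / 3 - w u\<^sup>2 + \<i> w u^3 / 3\<close>, without a linear term; the factor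
  \<open>exp (- 2 w / 3)\<close> is the exponential smallness of the harmonics.\<close>

lemma parab_kernel_saddle:
  assumes "z = \<i> + u"
  shows "parab_kernel w l m z = of_real (exp (- (2 * w / 3))) * ((- 1) ^ m *
    (saddle_gauss w u * inverse u ^ (2 * m) * (exp (\<i> * of_real w * u ^ 3 / 3) * inverse (2 - \<i> * u) ^ (2 * l))))"
proof -
  have "\<i> * of_real w * (z + z ^ 3 / 3) = of_real (- (2 * w / 3)) + (- of_real w * u\<^sup>2 + \<i> * of_real w * u ^ 3 / 3)"
    unfolding assms by (simp add: power3_eq_cube power2_eq_square algebra_simps) (simp add: field_simps)
  then have e: "exp (\<i> * of_real w * (z + z ^ 3 / 3)) = of_real (exp (- (2 * w / 3))) * (saddle_gauss w u * exp (\<i> * of_real w * u ^ 3 / 3))"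
    by (simp only: exp_add saddle_gauss_def exp_of_real)
  have 1: "1 - \<i> * z = 2 - \<i> * u" unfolding assms by (simp add: algebra_simps)
  have 2: "inverse (1 + \<i> * z) ^ (2 * m) = (- 1) ^ m * inverse u ^ (2 * m)"
  proof -
    have "1 + \<i> * z = \<i> * u" unfolding assms by (simp add: algebra_simps)
    then have "inverse (1 + \<i> * z) ^ 2 = - 1 * inverse u ^ 2" by (simp add: power_mult_distrib)
    then have "(inverse (1 + \<i> * z) ^ 2) ^ m = (- 1) ^ m * (inverse u ^ 2) ^ m" by (simp only: power_mult_distrib)
    then show ?thesis by (simp only: power_mult)
  qed
  show ?thesis unfolding parab_kernel_def e 1 2 by (simp only: mult_ac)
qed

lemma norm_parab_kernel_strip_le:
  assumes "0 \<le> w" "0 \<le> y" "y < 1"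
  shows "norm (parab_kernel w l m (Complex x y)) \<le> exp (- w * (y - y ^ 3 / 3)) * exp (- w * y * x\<^sup>2) * inverse ((1 - y)\<^sup>2 + x\<^sup>2) ^ (l + m)"
proof -
  have re: "Re (\<i> * of_real w * (Complex x y + Complex x y ^ 3 / 3)) = - w * (y - y ^ 3 / 3) + - w * y * x\<^sup>2"
    by (simp add: power3_eq_cube power2_eq_square field_simps)
  have n1: "norm (1 - \<i> * Complex x y) ^ 2 = (1 + y)\<^sup>2 + x\<^sup>2" "norm (1 + \<i> * Complex x y) ^ 2 = (1 - y)\<^sup>2 + x\<^sup>2"
    unfolding cmod_power2 by simp_all
  have le: "inverse ((1 + y)\<^sup>2 + x\<^sup>2) \<le> inverse ((1 - y)\<^sup>2 + x\<^sup>2)"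
    using assms by (intro le_imp_inverse_le add_right_mono power_mono add_pos_nonneg) auto
  have "norm (parab_kernel w l m (Complex x y)) = exp (- w * (y - y ^ 3 / 3) + - w * y * x\<^sup>2)
      * inverse ((1 + y)\<^sup>2 + x\<^sup>2) ^ l * inverse ((1 - y)\<^sup>2 + x\<^sup>2) ^ m"
    unfolding parab_kernel_def norm_mult norm_exp_eq_Re re norm_power norm_inverse power_mult power_inverse n1 ..
  also have "\<dots> \<le> exp (- w * (y - y ^ 3 / 3) + - w * y * x\<^sup>2)
      * inverse ((1 - y)\<^sup>2 + x\<^sup>2) ^ l * inverse ((1 - y)\<^sup>2 + x\<^sup>2) ^ m"
    by (intro mult_right_mono mult_left_mono power_mono le zero_le_power) auto
  finally show ?thesis unfolding exp_add power_add by (simp only: mult.assoc)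
qed

text \<open>The kernel is holomorphic below the pole at \<open>\<i>\<close>, and in this strip it decays like a power of \<open>1 / x\<close>.\<close>

lemma parab_integral_shift:
  assumes "0 < w" "0 < \<eta>" "\<eta> < 1" "1 \<le> l + m"
  shows "parab_integral w l m = (LBINT x. parab_kernel w l m (Complex x (1 - \<eta>)))"
    and "integrable lborel (\<lambda>x. parab_kernel w l m (Complex x (1 - \<eta>)))"
proof -
  define d where "d = 1 - \<eta>"
  have d: "0 < d" "d < 1" using assms by (auto simp: d_def)
  have hol: "parab_kernel w l m holomorphic_on {z. - 1 < Im z \<and> Im z < 1}"
    unfolding parab_kernel_def by (intro holomorphic_intros) (auto simp: complex_eq_iff)
  have cub: "y ^ 3 / 3 \<le> y" if "0 \<le> y" "y \<le> 1" for y :: real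
  proof -
    have "y ^ 3 \<le> y ^ 1" using that by (intro power_decreasing) auto
    then show ?thesis using that by simp
  qed
  have dec: "norm (parab_kernel w l m (Complex x y)) \<le> inverse (\<eta>\<^sup>2 + \<bar>x\<bar>\<^sup>2) ^ (l + m)" if y: "0 \<le> y" "y \<le> d" for x y
  proof -
    have "norm (parab_kernel w l m (Complex x y)) \<le> exp (- w * (y - y ^ 3 / 3)) * exp (- w * y * x\<^sup>2) * inverse ((1 - y)\<^sup>2 + x\<^sup>2) ^ (l + m)"
      by (rule norm_parab_kernel_strip_le) (use assms y d in auto)
    also have "\<dots> \<le> 1 * 1 * inverse (\<eta>\<^sup>2 + \<bar>x\<bar>\<^sup>2) ^ (l + m)"
    proof (intro mult_mono power_mono le_imp_inverse_le)
      show "exp (- w * (y - y ^ 3 / 3)) \<le> 1" using cub[of y] y d assms by simp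
      show "exp (- w * y * x\<^sup>2) \<le> 1" using y assms by simp
      show "\<eta>\<^sup>2 + \<bar>x\<bar>\<^sup>2 \<le> (1 - y)\<^sup>2 + x\<^sup>2" using y assms by (auto simp: d_def intro!: power_mono)
    qed (use assms in \<open>auto intro!: add_pos_nonneg\<close>)
    finally show ?thesis by simp
  qed
  have cont: "continuous_on UNIV (\<lambda>x. parab_kernel w l m (Complex x d))"
  proof (rule continuous_on_compose2[OF holomorphic_on_imp_continuous_on[OF hol] continuous_Complex_line])
    show "range (\<lambda>x. Complex x d) \<subseteq> {z. - 1 < Im z \<and> Im z < 1}" using d by auto
  qed
  have int: "integrable lborel (\<lambda>x. parab_kernel w l m (Complex x d))"
  proof (rule gaussian_dominated(1)[OF _ cont])
    show "0 < w * d" using assms d by simp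
    show "norm (parab_kernel w l m (Complex x d)) \<le> inverse (\<eta>\<^sup>2) ^ (l + m) * exp (- (w * d) * x\<^sup>2)" for x
    proof -
      have "norm (parab_kernel w l m (Complex x d)) \<le> exp (- w * (d - d ^ 3 / 3)) * exp (- w * d * x\<^sup>2) * inverse ((1 - d)\<^sup>2 + x\<^sup>2) ^ (l + m)"
        by (rule norm_parab_kernel_strip_le) (use assms d in auto)
      also have "\<dots> \<le> 1 * exp (- w * d * x\<^sup>2) * inverse (\<eta>\<^sup>2) ^ (l + m)"
      proof (intro mult_mono power_mono le_imp_inverse_le)
        show "exp (- w * (d - d ^ 3 / 3)) \<le> 1" using cub[of d] d assms by simp
      qed (use assms in \<open>auto simp: d_def\<close>)
      finally show ?thesis by (simp add: mult.commute)
    qed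
  qed
  then show "integrable lborel (\<lambda>x. parab_kernel w l m (Complex x (1 - \<eta>)))" by (simp only: d_def)
  have r: "complex_of_real x = Complex x 0" for x by (simp add: complex_eq_iff)
  have "(LBINT x. parab_kernel w l m (Complex x d)) = (LBINT x. parab_kernel w l m (Complex x 0))"
  proof (rule integral_horizontal_line_shift[OF hol _ _ _ _ int dec])
    show "integrable lborel (\<lambda>x. parab_kernel w l m (Complex x 0))"
      unfolding r[symmetric] by (rule integrable_parab_kernel[OF assms(4)])
    have "((\<lambda>x::real. inverse (\<eta>\<^sup>2 + x\<^sup>2)) \<longlongrightarrow> 0) at_top" by real_asymp
    from tendsto_power[OF this, of "l + m"] show "((\<lambda>x::real. inverse (\<eta>\<^sup>2 + x\<^sup>2) ^ (l + m)) \<longlongrightarrow> 0) at_top"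
    proof -
      have "(0::real) ^ (l + m) = 0" using assms(4) by (auto simp: power_0_left)
      then show ?thesis using \<open>((\<lambda>x. inverse (\<eta>\<^sup>2 + x\<^sup>2) ^ (l + m)) \<longlongrightarrow> 0 ^ (l + m)) at_top\<close> by (simp only:)
    qed
  qed (use d in auto)
  then show "parab_integral w l m = (LBINT x. parab_kernel w l m (Complex x (1 - \<eta>)))"
    unfolding parab_integral_def r d_def by simp
qed

lemma norm_cubic_phase: "norm (exp (\<i> * of_real w * Complex x (- \<eta>) ^ 3 / 3)) = exp (w * \<eta> * x\<^sup>2 - w * \<eta> ^ 3 / 3)"
  by (simp add: norm_exp_eq_Re power3_eq_cube power2_eq_square field_simps)

lemma norm_two_minus_ge: "0 < \<eta> \<Longrightarrow> \<eta> < 1 \<Longrightarrow> 1 \<le> norm (2 - \<i> * Complex x (- \<eta>))"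
  using abs_Re_le_cmod[of "2 - \<i> * Complex x (- \<eta>)"] by simp

text \<open>On the line at distance \<open>\<eta>\<close> below the saddle, the pole costs \<open>\<eta>\<close> to the power \<open>- 2 m\<close>, the cubic term
  of the phase weakens the Gaussian by the factor \<open>1 - \<eta>\<close> in the exponent, and \<open>\<bar>2 - \<i> u\<bar> \<ge> 1\<close>.\<close>

lemma parab_integral_bound:
  assumes w: "0 < w" and \<eta>: "0 < \<eta>" "\<eta> < 1" and lm: "1 \<le> l + m"
  shows "norm (parab_integral w l m) \<le> exp (w * \<eta>\<^sup>2 - 2 * w / 3) * inverse (\<eta>\<^sup>2) ^ m * sqrt (pi / (w * (1 - \<eta>)))"
  unfolding parab_integral_shift(1)[OF w \<eta> lm]
proof (rule gaussian_dominated(2))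
  show "0 < w * (1 - \<eta>)" using assms by simp
  show "continuous_on UNIV (\<lambda>x. parab_kernel w l m (Complex x (1 - \<eta>)))"
    unfolding parab_kernel_def using assms by (intro continuous_intros continuous_Complex_line) (auto simp: complex_eq_iff)
  show "norm (parab_kernel w l m (Complex x (1 - \<eta>))) \<le> exp (w * \<eta>\<^sup>2 - 2 * w / 3) * inverse (\<eta>\<^sup>2) ^ m * exp (- (w * (1 - \<eta>)) * x\<^sup>2)" for x
  proof -
    define p where "p = norm (saddle_gauss w (Complex x (- \<eta>))) * norm (exp (\<i> * of_real w * Complex x (- \<eta>) ^ 3 / 3))"
    have z: "Complex x (1 - \<eta>) = \<i> + Complex x (- \<eta>)" by (simp add: complex_eq_iff)
    have ph: "p \<le> exp (w * \<eta>\<^sup>2) * exp (- (w * (1 - \<eta>)) * x\<^sup>2)"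
      unfolding p_def norm_saddle_gauss norm_cubic_phase exp_add[symmetric] exp_le_cancel_iff
    proof -
      have "w * \<eta>\<^sup>2 + - w * x\<^sup>2 + (w * \<eta> * x\<^sup>2 - w * \<eta> ^ 3 / 3) = w * \<eta>\<^sup>2 + - (w * (1 - \<eta>)) * x\<^sup>2 - w * \<eta> ^ 3 / 3"
        by (simp add: algebra_simps)
      moreover have "0 \<le> w * \<eta> ^ 3 / 3" using w \<eta> by simp
      ultimately show "w * (- \<eta>)\<^sup>2 + - w * x\<^sup>2 + (w * \<eta> * x\<^sup>2 - w * \<eta> ^ 3 / 3) \<le> w * \<eta>\<^sup>2 + - (w * (1 - \<eta>)) * x\<^sup>2"
        unfolding power2_minus by linarith
    qed
    have n2: "norm (inverse (2 - \<i> * Complex x (- \<eta>)) ^ (2 * l)) \<le> 1"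
      unfolding norm_power norm_inverse using norm_two_minus_ge[OF \<eta>, of x] by (intro power_le_one) (auto simp: inverse_le_1_iff)
    have "norm (parab_kernel w l m (Complex x (1 - \<eta>))) = exp (- (2 * w / 3)) * (p
        * norm (inverse (Complex x (- \<eta>)) ^ (2 * m)) * norm (inverse (2 - \<i> * Complex x (- \<eta>)) ^ (2 * l)))"
    proof -
      have "norm ((- 1 :: complex) ^ m) = 1" "norm (complex_of_real (exp (- (2 * w / 3)))) = exp (- (2 * w / 3))"
        by (simp_all add: norm_power)
      then show ?thesis
        unfolding parab_kernel_saddle[OF z] p_def norm_mult by (simp only: mult_1_left mult_ac)
    qed
    also have "\<dots> \<le> exp (- (2 * w / 3)) * ((exp (w * \<eta>\<^sup>2) * exp (- (w * (1 - \<eta>)) * x\<^sup>2)) * inverse \<eta> ^ (2 * m) * 1)"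
      by (intro mult_left_mono mult_mono[OF mult_mono[OF ph norm_inverse_line_le[OF \<eta>(1)]] n2])
         (use \<eta> in \<open>auto simp: p_def\<close>)
    also have "\<dots> = exp (w * \<eta>\<^sup>2 - 2 * w / 3) * inverse (\<eta>\<^sup>2) ^ m * exp (- (w * (1 - \<eta>)) * x\<^sup>2)"
    proof -
      have "exp (w * \<eta>\<^sup>2 - 2 * w / 3) = exp (- (2 * w / 3)) * exp (w * \<eta>\<^sup>2)" by (simp flip: exp_add)
      moreover have "inverse \<eta> ^ (2 * m) = inverse (\<eta>\<^sup>2) ^ m" by (simp only: power_mult power_inverse)
      ultimately show ?thesis by (simp only: mult_ac mult_1_right)
    qed
    finally show ?thesis .
  qed
qed

text \<open>Replacing \<open>exp (\<i> w u^3 / 3)\<close> by 1 and \<open>2 - \<i> u\<close> by 2 costs a factor of order \<open>w \<bar>u\<bar>^3 + \<bar>u\<bar>\<close>. With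
  \<open>\<eta> = 1 / sqrt w\<close> the relevant \<open>u\<close> have size \<open>\<eta>\<close>, and the error is smaller than the moment by one factor
  \<open>\<eta>\<close>.\<close>

lemma parab_integral_saddle_error:
  assumes \<eta>: "0 < \<eta>" "\<eta> \<le> 1/100" and w: "w * \<eta>\<^sup>2 = 1" and m: "2 \<le> m" and l: "l \<le> 1"
  shows "norm (of_real (exp (2 * w / 3)) * parab_integral w l m - (- 1) ^ m * of_real ((1/4) ^ l) * saddle_moment w \<eta> m)
    \<le> 36/5 * inverse (\<eta>\<^sup>2) ^ (m - 1)"
proof -
  have wpos: "0 < w" using zero_less_mult_pos2[of w "\<eta>\<^sup>2"] w \<eta> by simp
  define u where "u = (\<lambda>x. Complex x (- \<eta>))"
  define Z where "Z = (\<lambda>x. \<i> * of_real w * u x ^ 3 / 3)"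
  define D where "D = (\<lambda>x. exp (Z x) * inverse (2 - \<i> * u x) ^ (2 * l) - of_real ((1/4) ^ l))"
  define H where "H = (\<lambda>x. saddle_gauss w (u x) * inverse (u x) ^ (2 * m) * D x)"
  have z: "Complex x (1 - \<eta>) = \<i> + u x" for x by (simp add: u_def complex_eq_iff)
  have un: "\<eta> \<le> norm (u x)" for x using abs_Im_le_cmod[of "u x"] \<eta> by (simp add: u_def)
  have u2: "1 \<le> norm (2 - \<i> * u x)" for x unfolding u_def by (rule norm_two_minus_ge) (use \<eta> in auto)
  have Hc: "continuous_on UNIV H"
    unfolding H_def D_def Z_def u_def saddle_gauss_def using \<eta>
    by (intro continuous_intros continuous_Complex_line) (auto simp: complex_eq_iff)
  have eq: "of_real (exp (2 * w / 3)) * parab_kernel w l m (Complex x (1 - \<eta>)) - (- 1) ^ m * of_real ((1/4) ^ l) * (saddle_gauss w (u x) * inverse (u x) ^ (2 * m)) = (- 1) ^ m * H x" for x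
  proof -
    have "complex_of_real (exp (2 * w / 3)) * of_real (exp (- (2 * w / 3))) = 1"
      unfolding of_real_mult[symmetric] exp_add[symmetric] by simp
    then have "of_real (exp (2 * w / 3)) * parab_kernel w l m (Complex x (1 - \<eta>))
       = (- 1) ^ m * (saddle_gauss w (u x) * inverse (u x) ^ (2 * m) * (exp (Z x) * inverse (2 - \<i> * u x) ^ (2 * l)))"
      unfolding parab_kernel_saddle[OF z] Z_def by (simp only: mult.assoc[symmetric] mult_1)
    then show ?thesis by (simp add: H_def D_def right_diff_distrib mult_ac)
  qed
  have Hle: "norm (H x) \<le> (4 * inverse \<eta> ^ (2 * m - 1)) * exp (- (w * (1 - \<eta>)) * x\<^sup>2)" for x
  proof -
    define g where "g = exp 1 * exp (- (w * (1 - \<eta>)) * x\<^sup>2)"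
    have sg: "norm (saddle_gauss w (u x)) = exp 1 * exp (- w * x\<^sup>2)"
      unfolding u_def norm_saddle_gauss using w by simp
    have gle: "norm (saddle_gauss w (u x)) \<le> g"
      unfolding sg g_def using wpos \<eta> by (intro mult_left_mono) (auto simp: algebra_simps)
    have ReZ: "Re (Z x) \<le> w * \<eta> * x\<^sup>2"
    proof -
      have "Re (Z x) = w * \<eta> * x\<^sup>2 - w * \<eta> ^ 3 / 3"
        unfolding Z_def u_def by (simp add: power3_eq_cube power2_eq_square field_simps)
      then show ?thesis using wpos \<eta> by simp
    qed
    have 1: "norm (saddle_gauss w (u x)) * norm (exp (Z x) - 1) \<le> g * (w * norm (u x) ^ 3 / 3)"
    proof -
      have "max 0 (Re (Z x)) \<le> w * \<eta> * x\<^sup>2" using ReZ wpos \<eta> by simp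
      then have "norm (exp (Z x) - 1) \<le> exp (w * \<eta> * x\<^sup>2) * norm (Z x)"
        by (intro order_trans[OF norm_exp_minus_one_le] mult_right_mono) auto
      also have "norm (Z x) = w * norm (u x) ^ 3 / 3" using wpos by (simp add: Z_def norm_mult norm_divide norm_power)
      finally have "norm (saddle_gauss w (u x)) * norm (exp (Z x) - 1) \<le> (exp 1 * exp (- w * x\<^sup>2)) * (exp (w * \<eta> * x\<^sup>2) * (w * norm (u x) ^ 3 / 3))"
        unfolding sg by (intro mult_left_mono) auto
      also have "\<dots> = (exp 1 * (exp (- w * x\<^sup>2) * exp (w * \<eta> * x\<^sup>2))) * (w * norm (u x) ^ 3 / 3)" by (simp only: mult_ac)
      also have "exp (- w * x\<^sup>2) * exp (w * \<eta> * x\<^sup>2) = exp (- (w * (1 - \<eta>)) * x\<^sup>2)"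
        unfolding exp_add[symmetric] by (rule arg_cong[where f=exp]) (simp add: algebra_simps)
      finally show ?thesis by (simp only: g_def)
    qed
    have 2: "norm (inverse (2 - \<i> * u x) ^ (2 * l) - of_real ((1/4) ^ l)) \<le> norm (u x)"
    proof (cases "l = 0")
      case False
      then have l1: "l = 1" using l by simp
      define s where "s = 2 - \<i> * u x"
      have s0: "s \<noteq> 0" using u2[of x] by (auto simp: s_def)
      have "inverse s ^ 2 - of_real (1/4) = (4 - s\<^sup>2) / (4 * s\<^sup>2)"
        using s0 by (simp add: field_simps power2_eq_square)
      also have "4 - s\<^sup>2 = \<i> * u x * (s + 2)" by (simp add: s_def power2_eq_square algebra_simps)
      finally have "norm (inverse s ^ 2 - of_real (1/4)) = norm (u x) * norm (s + 2) / (4 * norm s ^ 2)"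
        by (simp add: norm_mult norm_divide norm_power)
      also have "\<dots> \<le> norm (u x) * (4 * norm s ^ 2) / (4 * norm s ^ 2)"
      proof (intro divide_right_mono mult_left_mono)
        have s1: "1 \<le> norm s" using u2[of x] by (simp add: s_def)
        have "norm (s + 2) \<le> norm s + 2" using norm_triangle_ineq[of s 2] by simp
        also have "\<dots> \<le> 4 * (norm s * 1)" using s1 by simp
        also have "\<dots> \<le> 4 * (norm s * norm s)" using s1 by (intro mult_left_mono) auto
        finally show "norm (s + 2) \<le> 4 * norm s ^ 2" by (simp add: power2_eq_square)
      qed auto
      also have "\<dots> = norm (u x)" using s0 by simp
      finally show ?thesis by (simp add: l1 s_def)
    qed simp
    have 3: "norm (inverse (2 - \<i> * u x) ^ (2 * l)) \<le> 1"
      unfolding norm_power norm_inverse using u2[of x] by (intro power_le_one) (auto simp: inverse_le_1_iff)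
    have Dx: "D x = (exp (Z x) - 1) * inverse (2 - \<i> * u x) ^ (2 * l) + (inverse (2 - \<i> * u x) ^ (2 * l) - of_real ((1/4) ^ l))"
      by (simp add: D_def left_diff_distrib)
    have "norm ((exp (Z x) - 1) * inverse (2 - \<i> * u x) ^ (2 * l)) \<le> norm (exp (Z x) - 1) * 1"
      unfolding norm_mult by (rule mult_left_mono[OF 3]) simp
    then have "norm (D x) \<le> norm (exp (Z x) - 1) + norm (u x)"
      unfolding Dx
      using 2 norm_triangle_ineq[of "(exp (Z x) - 1) * inverse (2 - \<i> * u x) ^ (2 * l)" "inverse (2 - \<i> * u x) ^ (2 * l) - of_real ((1/4) ^ l)"]
      by linarith
    then have "norm (saddle_gauss w (u x)) * norm (D x) \<le> norm (saddle_gauss w (u x)) * norm (exp (Z x) - 1) + norm (saddle_gauss w (u x)) * norm (u x)"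
      unfolding distrib_left[symmetric] by (rule mult_left_mono) simp
    also have "\<dots> \<le> g * (w * norm (u x) ^ 3 / 3) + g * norm (u x)"
      by (intro add_mono 1 mult_right_mono gle) auto
    finally have 4: "norm (saddle_gauss w (u x)) * norm (D x) \<le> g * (w * norm (u x) ^ 3 / 3 + norm (u x))"
      by (simp only: distrib_left)
    have g0: "0 \<le> g" by (simp add: g_def)
    \<comment> \<open>The error factor \<open>w v^3 / 3 + v\<close> cancels up to three of the \<open>2 m\<close> powers of \<open>1 / v\<close>; the exponents stay nonnegative as \<open>m \<ge> 2\<close>.\<close>
    define k where "k = 2 * m - 3"
    have k: "2 * m = k + 3" "2 * m - 1 = k + 2" using m by (auto simp: k_def)
    define v where "v = norm (u x)"
    have v: "\<eta> \<le> v" "0 < v" using un[of x] \<eta> by (auto simp: v_def)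
    have iv: "inverse v \<le> inverse \<eta>" using v \<eta> by (intro le_imp_inverse_le) auto
    have "norm (H x) = (norm (saddle_gauss w (u x)) * norm (D x)) * inverse v ^ (k + 3)"
      unfolding H_def norm_mult norm_power norm_inverse v_def k(1) by (simp only: mult_ac)
    also have "\<dots> \<le> (g * (w * v ^ 3 / 3 + v)) * inverse v ^ (k + 3)"
      using 4 v by (intro mult_right_mono) (auto simp: v_def)
    also have "\<dots> = g * (w / 3 * inverse v ^ k + inverse v ^ (k + 2))"
    proof -
      have "inverse v ^ (k + 3) * v ^ 3 = inverse v ^ k" "inverse v ^ (k + 3) * v = inverse v ^ (k + 2)"
      proof -
        have "inverse v ^ 3 * v ^ 3 = 1" using v by (simp flip: power_mult_distrib)
        then show "inverse v ^ (k + 3) * v ^ 3 = inverse v ^ k" by (simp only: power_add mult.assoc mult_1_right)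
        have "k + 3 = (k + 2) + 1" by simp
        then show "inverse v ^ (k + 3) * v = inverse v ^ (k + 2)"
          using v by (simp only: power_add[of _ "k + 2" 1] power_one_right mult.assoc) simp
      qed
      then have "g * (w * v ^ 3 / 3 + v) * inverse v ^ (k + 3) = g * (w / 3 * (inverse v ^ (k + 3) * v ^ 3) + inverse v ^ (k + 3) * v)"
        by (simp only: distrib_left distrib_right mult_ac times_divide_eq_left times_divide_eq_right)
      then show ?thesis using \<open>inverse v ^ (k + 3) * v ^ 3 = inverse v ^ k\<close> \<open>inverse v ^ (k + 3) * v = inverse v ^ (k + 2)\<close> by simp
    qed
    also have "\<dots> \<le> g * (w / 3 * inverse \<eta> ^ k + inverse \<eta> ^ (k + 2))"
      using g0 wpos v iv by (intro mult_left_mono add_mono power_mono) auto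
    also have "w / 3 * inverse \<eta> ^ k = inverse \<eta> ^ (k + 2) / 3"
    proof -
      have "w = inverse \<eta> ^ 2" using w \<eta> by (simp add: field_simps)
      then show ?thesis by (simp only: power_add times_divide_eq_left mult.commute)
    qed
    also have "g * (inverse \<eta> ^ (k + 2) / 3 + inverse \<eta> ^ (k + 2)) = (exp 1 * (4/3)) * (inverse \<eta> ^ (k + 2) * exp (- (w * (1 - \<eta>)) * x\<^sup>2))"
      by (simp add: g_def)
    also have "\<dots> \<le> (3 * (4/3)) * (inverse \<eta> ^ (k + 2) * exp (- (w * (1 - \<eta>)) * x\<^sup>2))"
      using \<eta> exp_le by (intro mult_right_mono) auto
    finally show ?thesis unfolding k(2) by simp
  qed
  have c: "0 < w * (1 - \<eta>)" using wpos \<eta> by simp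
  have lm: "1 \<le> l + m" using m by simp
  have \<eta>1: "\<eta> < 1" using \<eta> by simp
  have "of_real (exp (2 * w / 3)) * parab_integral w l m - (- 1) ^ m * of_real ((1/4) ^ l) * saddle_moment w \<eta> m = (LBINT x. (- 1) ^ m * H x)"
    unfolding eq[symmetric] parab_integral_shift(1)[OF wpos \<eta>(1) \<eta>1 lm] saddle_moment_def u_def
    by (subst Bochner_Integration.integral_diff)
       (simp_all only: integrable_mult_right parab_integral_shift(2)[OF wpos \<eta>(1) \<eta>1 lm] integrable_saddle_moment[OF \<eta>(1) wpos] integral_mult_right_zero)
  also have "norm \<dots> = norm (integral\<^sup>L lborel H)" by (simp add: norm_mult norm_power)
  also have "\<dots> \<le> (4 * inverse \<eta> ^ (2 * m - 1)) * sqrt (pi / (w * (1 - \<eta>)))"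
    by (rule gaussian_dominated(2)[OF c Hc Hle])
  also have "sqrt (pi / (w * (1 - \<eta>))) = \<eta> * sqrt (pi / (1 - \<eta>))"
  proof -
    have "w = inverse (\<eta>\<^sup>2)" using w \<eta> by (simp add: field_simps)
    then have "pi / (w * (1 - \<eta>)) = \<eta>\<^sup>2 * (pi / (1 - \<eta>))" by (simp add: field_simps)
    then show ?thesis using \<eta> by (simp only: real_sqrt_mult) simp
  qed
  also have "(4 * inverse \<eta> ^ (2 * m - 1)) * (\<eta> * sqrt (pi / (1 - \<eta>))) = 4 * inverse (\<eta>\<^sup>2) ^ (m - 1) * sqrt (pi / (1 - \<eta>))"
  proof -
    have "2 * m - 1 = Suc (2 * (m - 1))" using m by simp
    then have "inverse \<eta> ^ (2 * m - 1) * \<eta> = inverse (\<eta>\<^sup>2) ^ (m - 1)"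
      using \<eta> by (simp add: power_mult power_inverse)
    then show ?thesis by simp
  qed
  also have "\<dots> \<le> 4 * inverse (\<eta>\<^sup>2) ^ (m - 1) * (9/5)"
  proof (intro mult_left_mono real_le_lsqrt)
    have "pi / (1 - \<eta>) \<le> (32/10) / (99/100)" using \<eta> pi_approx by (intro frac_le) auto
    also have "\<dots> \<le> (9/5)\<^sup>2" by (simp add: power2_eq_square)
    finally show "pi / (1 - \<eta>) \<le> (9/5)\<^sup>2" .
  qed (use \<eta> in auto)
  finally show ?thesis by simp
qed

section \<open>Expansion of the Newtonian potential\<close>

text \<open>The binomial coefficients of \<open>1 / sqrt (1 + x)\<close>.\<close>

definition inv_sqrt_coeff :: "nat \<Rightarrow> real" where
  "inv_sqrt_coeff l = (- 1/2) gchoose l"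

lemma inv_sqrt_coeff_values:
  "inv_sqrt_coeff 0 = 1" "inv_sqrt_coeff (Suc 0) = - 1/2" "inv_sqrt_coeff 2 = 3/8" "inv_sqrt_coeff 3 = - 5/16"
  by (simp_all add: inv_sqrt_coeff_def gbinomial_prod_rev numeral_2_eq_2 numeral_3_eq_3 atLeast0_lessThan_Suc)

lemma abs_inv_sqrt_coeff_le: "\<bar>inv_sqrt_coeff l\<bar> \<le> 1"
proof (induction l)
  case (Suc l)
  have "real (Suc l) * inv_sqrt_coeff (Suc l) = (- 1/2 - real l) * inv_sqrt_coeff l"
    using gbinomial_mult_1[of "-1/2::real" l] by (simp add: inv_sqrt_coeff_def algebra_simps)
  then have "\<bar>real (Suc l) * inv_sqrt_coeff (Suc l)\<bar> = \<bar>(- 1/2 - real l) * inv_sqrt_coeff l\<bar>"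
    by (rule arg_cong)
  then have "real (Suc l) * \<bar>inv_sqrt_coeff (Suc l)\<bar> = \<bar>- 1/2 - real l\<bar> * \<bar>inv_sqrt_coeff l\<bar>"
    unfolding abs_mult abs_of_nat .
  also have "\<dots> \<le> real (Suc l) * 1" using Suc.IH by (intro mult_mono) auto
  finally show ?case by simp
qed (simp add: inv_sqrt_coeff_values)

lemma of_real_inv_sqrt_coeff: "complex_of_real (inv_sqrt_coeff l) = (- 1/2) gchoose l"
  by (simp add: inv_sqrt_coeff_def gbinomial_prod_rev)

lemma has_sum_prod:
  fixes F H :: "nat \<Rightarrow> complex"
  assumes F: "(F has_sum A) UNIV" "\<And>l. norm (F l) \<le> x ^ l" and H: "(H has_sum B) UNIV" "\<And>m. norm (H m) \<le> x ^ m"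
    and x: "0 \<le> x" "x < 1"
  shows "((\<lambda>(l, m). F l * H m) has_sum A * B) UNIV"
proof -
  have "(\<lambda>(l, m). x ^ l * x ^ m) summable_on (SIGMA l:UNIV. (UNIV :: nat set))"
  proof (rule summable_on_SigmaI)
    show "((\<lambda>m. case (l, m) of (l, m) \<Rightarrow> x ^ l * x ^ m) has_sum x ^ l * (1 / (1 - x))) UNIV" for l :: nat
      using has_sum_cmult_right[OF has_sum_geometric_nat[OF x]] by simp
    show "(\<lambda>l::nat. x ^ l * (1 / (1 - x))) summable_on UNIV"
      using has_sum_imp_summable[OF has_sum_cmult_left[OF has_sum_geometric_nat[OF x]]] .
  qed (use x in auto)
  then have sm: "(\<lambda>(l, m). F l * H m) summable_on (SIGMA l:UNIV. (UNIV :: nat set))"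
  proof (rule summable_on_dominated)
    fix p :: "nat \<times> nat"
    show "norm (case p of (l, m) \<Rightarrow> F l * H m) \<le> (case p of (l, m) \<Rightarrow> x ^ l * x ^ m)"
      using F(2) H(2) x by (cases p) (auto simp: norm_mult intro!: mult_mono)
  qed
  have "((\<lambda>(l, m). F l * H m) has_sum A * B) (SIGMA l:UNIV. UNIV)"
  proof (rule has_sum_SigmaI[OF _ _ sm])
    show "((\<lambda>m. case (l, m) of (l, m) \<Rightarrow> F l * H m) has_sum F l * B) UNIV" for l
      using has_sum_cmult_right[OF H(1)] by simp
    show "((\<lambda>l. F l * B) has_sum A * B) UNIV" by (rule has_sum_cmult_left[OF F(1)])
  qed
  then show ?thesis by simp
qed

text \<open>The generating function of the Legendre polynomials in complex form: \<open>1 / \<bar>1 + X\<bar>\<close> is the product of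
  \<open>(1 + X)\<close> to the power \<open>- 1/2\<close> with its conjugate.\<close>

lemma has_sum_inverse_norm:
  fixes X :: complex
  assumes X: "norm X < 1"
  shows "((\<lambda>(l, m). of_real (inv_sqrt_coeff l * inv_sqrt_coeff m) * X ^ l * cnj X ^ m) has_sum of_real (1 / norm (1 + X))) UNIV"
proof -
  define F where "F = (\<lambda>l. of_real (inv_sqrt_coeff l) * X ^ l)"
  define P where "P = (1 + X) powr (- 1/2)"
  have n: "norm (F l) \<le> norm X ^ l" for l
    using abs_inv_sqrt_coeff_le[of l] by (simp add: F_def norm_mult norm_power mult_left_le_one_le)
  have F: "(F has_sum P) UNIV"
  proof (rule norm_summable_imp_has_sum)
    show "F sums P" unfolding F_def P_def of_real_inv_sqrt_coeff by (rule gen_binomial_complex[OF X])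
    show "summable (\<lambda>l. norm (F l))"
      by (rule summable_comparison_test'[of "\<lambda>l. norm X ^ l" 0]) (use X n in auto)
  qed
  have cF: "((\<lambda>l. cnj (F l)) has_sum cnj P) UNIV" using F by simp
  have "((\<lambda>(l, m). F l * cnj (F m)) has_sum P * cnj P) UNIV"
    by (rule has_sum_prod[where x="norm X"]) (use F cF n X in auto)
  moreover have "(\<lambda>(l, m). F l * cnj (F m)) = (\<lambda>(l, m). of_real (inv_sqrt_coeff l * inv_sqrt_coeff m) * X ^ l * cnj X ^ m)"
    by (auto simp: F_def)
  moreover have "P * cnj P = of_real (1 / norm (1 + X))"
  proof -
    have nz: "0 < norm (1 + X)"
    proof -
      have "1 + X \<noteq> 0"
      proof
        assume "1 + X = 0"
        then have "X = - 1" by (simp add: add_eq_0_iff)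
        then show False using X by simp
      qed
      then show ?thesis by simp
    qed
    have "(- 1/2 :: complex) \<in> \<real>" by (intro Reals_divide Reals_minus Reals_1 Reals_numeral)
    then have "norm P = norm (1 + X) powr (- 1/2)" unfolding P_def by (subst norm_powr_real_powr') auto
    then have "norm P ^ 2 = norm (1 + X) powr (- 1)"
      using nz by (simp add: power2_eq_square flip: powr_add)
    also have "\<dots> = 1 / norm (1 + X)" using nz by (simp add: powr_minus_divide)
    finally show ?thesis by (simp add: complex_norm_square[symmetric] flip: of_real_power)
  qed
  ultimately show ?thesis by (simp only:)
qed

text \<open>The Melnikov integrand is exactly this sum: the subtracted terms are those of order 0 and 1.\<close>

lemma has_sum_inverse_norm_tail:
  fixes X :: complex
  assumes X: "norm X < 1"
  shows "((\<lambda>(l, m). (if l + m < 2 then 0 else of_real (inv_sqrt_coeff l * inv_sqrt_coeff m) * X ^ l * cnj X ^ m))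
     has_sum of_real (1 / norm (1 + X) - 1 + Re X)) UNIV"
proof -
  define h where "h = (\<lambda>(l, m). of_real (inv_sqrt_coeff l * inv_sqrt_coeff m) * X ^ l * cnj X ^ m)"
  \<comment> \<open>The removed terms add up to \<open>1 - Re X\<close>.\<close>
  define D :: "(nat \<times> nat) set" where "D = {(0, 0), (1, 0), (0, 1)}"
  have D_iff: "(l, m) \<in> D \<longleftrightarrow> l + m < 2" for l m by (simp add: D_def) arith
  have "(h has_sum sum h D) D" by (rule has_sum_finite) (simp add: D_def)
  then have "(h has_sum (of_real (1 / norm (1 + X)) - sum h D)) (UNIV - D)"
    using has_sum_Diff[OF has_sum_inverse_norm[OF X, folded h_def]] by blast
  moreover have "sum h D = of_real (1 - Re X)"
    by (simp add: D_def h_def inv_sqrt_coeff_values complex_eq_iff)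
  ultimately have "(h has_sum of_real (1 / norm (1 + X) - 1 + Re X)) (UNIV - D)"
    by (simp add: algebra_simps)
  also have "?this \<longleftrightarrow> ((\<lambda>(l, m). (if l + m < 2 then 0 else of_real (inv_sqrt_coeff l * inv_sqrt_coeff m) * X ^ l * cnj X ^ m))
     has_sum of_real (1 / norm (1 + X) - 1 + Re X)) UNIV"
  proof (rule has_sum_cong_neutral)
    fix p assume "p \<in> UNIV - (UNIV - D)"
    then show "(case p of (l, m) \<Rightarrow> if l + m < 2 then 0 else of_real (inv_sqrt_coeff l * inv_sqrt_coeff m) * X ^ l * cnj X ^ m) = 0"
      by (cases p) (simp add: D_iff)
  next
    fix p assume "p \<in> (UNIV - D) \<inter> UNIV"
    then show "h p = (case p of (l, m) \<Rightarrow> if l + m < 2 then 0 else of_real (inv_sqrt_coeff l * inv_sqrt_coeff m) * X ^ l * cnj X ^ m)"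
      by (cases p) (simp add: D_iff h_def)
  qed auto
  finally show ?thesis .
qed

lemma parab_time_unique:
  fixes G \<tau> \<sigma> :: real
  assumes "0 < G" "G ^ 3 / 2 * (\<tau> + \<tau> ^ 3 / 3) = G ^ 3 / 2 * (\<sigma> + \<sigma> ^ 3 / 3)"
  shows "\<tau> = \<sigma>"
proof -
  have "\<tau> + \<tau> ^ 3 / 3 = \<sigma> + \<sigma> ^ 3 / 3" using assms by simp
  moreover have "x + x ^ 3 / 3 < y + y ^ 3 / 3" if "x < y" for x y :: real
    using that power_mono_odd[of 3 x y] by (intro add_less_le_mono divide_right_mono) auto
  ultimately show ?thesis by (cases \<tau> \<sigma> rule: linorder_cases) force+
qed

lemma parab_time_surj:
  fixes G t :: real
  assumes "0 < G"
  shows "\<exists>\<tau>. t = G ^ 3 / 2 * (\<tau> + \<tau> ^ 3 / 3)"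
proof -
  define c where "c = 2 * t / G ^ 3"
  define M where "M = \<bar>c\<bar>"
  have M: "M \<ge> 0" "- M \<le> c" "c \<le> M" by (auto simp: M_def)
  have "\<exists>x. - M \<le> x \<and> x \<le> M \<and> x + x ^ 3 / 3 = c"
  proof (rule IVT')
    show "- M + (- M) ^ 3 / 3 \<le> c" 
    proof -
      have "(- M) ^ 3 = - (M ^ 3)" by simp
      then show ?thesis using M zero_le_power[OF M(1), of 3] by linarith
    qed
    show "c \<le> M + M ^ 3 / 3" using M zero_le_power[OF M(1), of 3] by linarith
    show "continuous_on {- M..M} (\<lambda>x. x + x ^ 3 / 3)" by (intro continuous_intros) auto
  qed (use M in auto)
  then obtain x where "x + x ^ 3 / 3 = c" by blast
  then have "t = G ^ 3 / 2 * (x + x ^ 3 / 3)" using assms by (simp add: c_def)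
  then show ?thesis by blast
qed

lemma tau_h_parab_time:
  assumes "0 < G"
  shows "tau_h G (G ^ 3 / 2 * (\<tau> + \<tau> ^ 3 / 3)) = \<tau>"
  unfolding tau_h_def using parab_time_unique[OF assms] by (intro the_equality) blast+

lemma parab_time_tau_h:
  assumes "0 < G"
  shows "G ^ 3 / 2 * (tau_h G t + (tau_h G t) ^ 3 / 3) = t"
proof -
  obtain \<tau> where \<tau>: "t = G ^ 3 / 2 * (\<tau> + \<tau> ^ 3 / 3)" using parab_time_surj[OF assms] by blast
  have "tau_h G t = \<tau>" unfolding \<tau> by (rule tau_h_parab_time[OF assms])
  then show ?thesis by (simp only: \<tau>)
qed

lemma borel_measurable_tau_h:
  assumes "0 < G"
  shows "tau_h G \<in> borel_measurable borel"
proof (rule borel_measurable_mono, rule monoI)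
  fix x y :: real assume "x \<le> y"
  show "tau_h G x \<le> tau_h G y"
  proof (rule ccontr)
    assume "\<not> tau_h G x \<le> tau_h G y"
    then have "tau_h G y < tau_h G x" by simp
    then have "tau_h G y + tau_h G y ^ 3 / 3 < tau_h G x + tau_h G x ^ 3 / 3"
      using power_mono_odd[of 3 "tau_h G y" "tau_h G x"] by (intro add_less_le_mono divide_right_mono) auto
    then have "G ^ 3 / 2 * (tau_h G y + tau_h G y ^ 3 / 3) < G ^ 3 / 2 * (tau_h G x + tau_h G x ^ 3 / 3)"
      using assms by (intro mult_strict_left_mono) auto
    then show False using \<open>x \<le> y\<close> unfolding parab_time_tau_h[OF assms] by simp
  qed
qed

text \<open>Time is replaced by the parameter \<open>\<tau>\<close> of the parabola.\<close>

lemma lborel_change_of_variables_parab_time: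
  fixes g :: "real \<Rightarrow> real"
  assumes G: "0 < G" and g: "g \<in> borel_measurable borel"
    and int: "integrable lborel (\<lambda>\<tau>. G ^ 3 / 2 * (1 + \<tau>\<^sup>2) * g (G ^ 3 / 2 * (\<tau> + \<tau> ^ 3 / 3)))"
  shows "integrable lborel g"
    and "integral\<^sup>L lborel g = (LBINT \<tau>. G ^ 3 / 2 * (1 + \<tau>\<^sup>2) * g (G ^ 3 / 2 * (\<tau> + \<tau> ^ 3 / 3)))"
proof -
  define T where "T = (\<lambda>\<tau>::real. G ^ 3 / 2 * (\<tau> + \<tau> ^ 3 / 3))"
  define T' where "T' = (\<lambda>\<tau>::real. G ^ 3 / 2 * (1 + \<tau>\<^sup>2))"
  have T'0: "\<bar>T' x\<bar> = T' x" for x using G by (simp add: T'_def)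
  have inj: "inj T" unfolding T_def by (rule injI) (rule parab_time_unique[OF G])
  have "\<exists>\<tau>. t = T \<tau>" for t unfolding T_def by (rule parab_time_surj[OF G])
  then have rng: "range T = UNIV" by (simp add: surj_def)
  have der: "(T has_field_derivative T' x) (at x within UNIV)" for x
  proof -
    have "((\<lambda>\<tau>::real. \<tau> + \<tau> ^ 3 / 3) has_field_derivative 1 + x\<^sup>2) (at x)"
      by (auto intro!: derivative_eq_intros)
    then show ?thesis unfolding T_def T'_def by (intro DERIV_cmult)
  qed
  define J where "J = (LBINT \<tau>. T' \<tau> * g (T \<tau>))"
  have hb: "has_bochner_integral lborel (\<lambda>\<tau>. T' \<tau> * g (T \<tau>)) J"
    using int unfolding J_def T_def T'_def by (rule has_bochner_integral_integrable)
  have a: "(\<lambda>x. \<bar>T' x\<bar> * g (T x)) absolutely_integrable_on UNIV \<and> integral UNIV (\<lambda>x. \<bar>T' x\<bar> * g (T x)) = J"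
    unfolding T'0
  proof
    have i: "integrable lborel (\<lambda>\<tau>. T' \<tau> * g (T \<tau>))" using hb by (rule integrable.intros)
    have "integrable lebesgue (\<lambda>\<tau>. T' \<tau> * g (T \<tau>))"
      unfolding integrable_completion[OF borel_measurable_integrable[OF i]] by (rule i)
    then show "(\<lambda>x. T' x * g (T x)) absolutely_integrable_on UNIV"
      by (simp add: set_integrable_def)
    show "integral UNIV (\<lambda>x. T' x * g (T x)) = J"
      unfolding J_def by (rule integral_lborel[OF i])
  qed
  have "g absolutely_integrable_on (T ` UNIV) \<and> integral (T ` UNIV) g = J"
  proof -
    have u: "(UNIV :: real set) \<in> sets lebesgue" by simp
    note cov = has_absolute_integral_change_of_variables_1'[where f=g and b=J, OF u der inj]
    show ?thesis using a unfolding cov .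
  qed
  then have abs_int: "g absolutely_integrable_on UNIV" and val: "integral UNIV g = J"
    unfolding rng by (rule conjunct1, rule conjunct2)
  have "integrable lebesgue g"
    using abs_int unfolding set_integrable_def by simp
  then show i: "integrable lborel g"
    by (rule iffD1[OF integrable_completion, rotated]) (use g in simp)
  have "integral\<^sup>L lborel g = J" using integral_lborel[OF i] val by (rule trans[OF sym])
  then show "integral\<^sup>L lborel g = (LBINT \<tau>. G ^ 3 / 2 * (1 + \<tau>\<^sup>2) * g (G ^ 3 / 2 * (\<tau> + \<tau> ^ 3 / 3)))"
    by (simp only: J_def T_def T'_def)
qed

section \<open>Expansion of the Melnikov potential\<close>

locale melnikov_problem = kepler_orbit +
  fixes G :: real
  assumes G_ge: "32 \<le> G" and eG: "e * G \<le> 1/8"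
begin

lemma G_pos: "0 < G" using G_ge by simp

definition parab_time :: "real \<Rightarrow> real" where
  "parab_time \<tau> = G ^ 3 / 2 * (\<tau> + \<tau> ^ 3 / 3)"

text \<open>The ratio of the two distances together with the angle between the two bodies, as a complex number; it
  is a conjugate position on the ellipse times a rational function of \<open>\<tau>\<close>.\<close>

definition complex_ratio :: "real \<Rightarrow> real \<Rightarrow> real \<Rightarrow> complex" where
  "complex_ratio \<alpha> s \<tau> = of_real (- 2 / G\<^sup>2) * cis \<alpha>
     * (of_real (primary_radius e f (s + parab_time \<tau>)) * cis (- f (s + parab_time \<tau>)))
     * inverse (1 - \<i> * of_real \<tau>) ^ 2"

lemma complex_ratio_eq:
  "complex_ratio \<alpha> s \<tau> = of_real (2 * primary_radius e f (s + parab_time \<tau>) / (G\<^sup>2 * (1 + \<tau>\<^sup>2)))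
     * cis (alpha_h \<alpha> G (parab_time \<tau>) - f (s + parab_time \<tau>))"
proof -
  define r F where "r = primary_radius e f (s + parab_time \<tau>)" and "F = f (s + parab_time \<tau>)"
  have "cis (alpha_h \<alpha> G (parab_time \<tau>) - F) = cis \<alpha> * cis pi * cis (2 * arctan \<tau>) * cis (- F)"
    unfolding alpha_h_def parab_time_def tau_h_parab_time[OF G_pos] by (simp only: cis_mult add_uminus_conv_diff)
  also have "\<dots> = - (cis \<alpha> * ((1 + \<i> * \<tau>) * inverse (1 - \<i> * \<tau>)) * cis (- F))"
    by (simp add: cis_double_arctan divide_inverse)
  finally have c: "cis (alpha_h \<alpha> G (parab_time \<tau>) - F) = - (cis \<alpha> * ((1 + \<i> * \<tau>) * inverse (1 - \<i> * \<tau>)) * cis (- F))" .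
  have "of_real (2 * r / (G\<^sup>2 * (1 + \<tau>\<^sup>2))) = of_real (2 / G\<^sup>2) * of_real r * complex_of_real (lorentzian \<tau>)"
    by (simp add: lorentzian_def divide_inverse)
  then have "of_real (2 * r / (G\<^sup>2 * (1 + \<tau>\<^sup>2))) * cis (alpha_h \<alpha> G (parab_time \<tau>) - F)
     = - of_real (2 / G\<^sup>2) * cis \<alpha> * (of_real r * cis (- F)) * (((1 + \<i> * \<tau>) * of_real (lorentzian \<tau>)) * inverse (1 - \<i> * \<tau>))"
    unfolding c by (simp only: mult_minus_left mult_minus_right mult_ac)
  also have "((1 + \<i> * \<tau>) * of_real (lorentzian \<tau>)) * inverse (1 - \<i> * \<tau>) = inverse (1 - \<i> * \<tau>) ^ 2"
    unfolding inverse_one_plus_minus(1)[symmetric] by (simp add: power2_eq_square)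
  finally show ?thesis unfolding complex_ratio_def r_def F_def by simp
qed

lemma primary_radius_bounds: "0 < primary_radius e f t" "primary_radius e f t \<le> 1 + e"
  unfolding primary_radius_ecc using one_minus_e_cos_bounds by auto

lemma norm_complex_ratio_less: "norm (complex_ratio \<alpha> s \<tau>) < 1"
proof -
  define r where "r = primary_radius e f (s + parab_time \<tau>)"
  have r: "0 < r" "r \<le> 2" using primary_radius_bounds[of "s + parab_time \<tau>"] e_small by (auto simp: r_def)
  have "norm (complex_ratio \<alpha> s \<tau>) = 2 / G\<^sup>2 * r * lorentzian \<tau>"
  proof -
    have "2 * r / (G\<^sup>2 * (1 + \<tau>\<^sup>2)) = 2 / G\<^sup>2 * r * lorentzian \<tau>" by (simp add: lorentzian_def divide_inverse)
    then have "norm (complex_ratio \<alpha> s \<tau>) = \<bar>2 / G\<^sup>2 * r * lorentzian \<tau>\<bar>"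
      unfolding complex_ratio_eq r_def[symmetric] norm_mult norm_cis norm_of_real by simp
    then show ?thesis using r G_pos lorentzian_bounds[of \<tau>] by simp
  qed
  also have "\<dots> \<le> 2 / 32\<^sup>2 * 2 * 1"
    using r G_ge lorentzian_bounds[of \<tau>] by (intro mult_mono divide_left_mono power_mono) auto
  also have "\<dots> < 1" by simp
  finally show ?thesis .
qed

text \<open>By the law of cosines the square root in the integrand is \<open>2 \<bar>1 + X\<bar>\<close>.\<close>

lemma melnikov_integrand_parab_time:
  "G ^ 3 / 2 * (1 + \<tau>\<^sup>2) * melnikov_integrand f \<alpha> G s e (parab_time \<tau>)
     = G * (1 / norm (1 + complex_ratio \<alpha> s \<tau>) - 1 + Re (complex_ratio \<alpha> s \<tau>))"
proof -
  define r where "r = primary_radius e f (s + parab_time \<tau>)"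
  define c where "c = cos (alpha_h \<alpha> G (parab_time \<tau>) - f (s + parab_time \<tau>))"
  define q where "q = sqrt (1 + \<tau>\<^sup>2)"
  define y where "y = 2 * r / (G\<^sup>2 * (1 + \<tau>\<^sup>2))"
  define x where "x = x_h G (parab_time \<tau>)"
  have q: "q > 0" "q\<^sup>2 = 1 + \<tau>\<^sup>2" by (auto simp: q_def add_pos_nonneg)
  have x: "x = 2 / (G * q)" unfolding x_def x_h_def parab_time_def tau_h_parab_time[OF G_pos] q_def ..
  have x2: "x\<^sup>2 = 4 / (G\<^sup>2 * (1 + \<tau>\<^sup>2))" unfolding x by (simp add: power_divide power_mult_distrib q(2))
  have xpos: "x\<^sup>2 > 0" using G_pos q by (simp add: x)
  have y: "y = x\<^sup>2 * r / 2" unfolding x2 y_def by simp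
  have X: "complex_ratio \<alpha> s \<tau> = of_real y * cis (alpha_h \<alpha> G (parab_time \<tau>) - f (s + parab_time \<tau>))"
    unfolding complex_ratio_eq y_def r_def ..
  have Re: "Re (complex_ratio \<alpha> s \<tau>) = y * c" unfolding X c_def by simp
  have n2: "norm (1 + complex_ratio \<alpha> s \<tau>) = sqrt (1 + y\<^sup>2 + 2 * y * c)"
  proof -
    have "(1 + y * c)\<^sup>2 + (y * sin (alpha_h \<alpha> G (parab_time \<tau>) - f (s + parab_time \<tau>)))\<^sup>2 = 1 + y\<^sup>2 + 2 * y * c"
      unfolding power_mult_distrib sin_squared_eq c_def by (simp add: power2_eq_square algebra_simps)
    then show ?thesis unfolding X cmod_def c_def by simp
  qed
  have "sqrt (4 + x ^ 4 * r\<^sup>2 + 4 * x\<^sup>2 * r * c) = sqrt (2\<^sup>2 * (1 + y\<^sup>2 + 2 * y * c))"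
    unfolding y by (rule arg_cong[where f=sqrt]) (simp add: power2_eq_square eval_nat_numeral algebra_simps)
  also have "\<dots> = 2 * norm (1 + complex_ratio \<alpha> s \<tau>)"
    unfolding n2 real_sqrt_mult by simp
  finally have root: "sqrt (4 + x ^ 4 * r\<^sup>2 + 4 * x\<^sup>2 * r * c) = 2 * norm (1 + complex_ratio \<alpha> s \<tau>)" .
  have "melnikov_integrand f \<alpha> G s e (parab_time \<tau>) = x\<^sup>2 / (2 * norm (1 + complex_ratio \<alpha> s \<tau>)) + (x\<^sup>2 / 2)\<^sup>2 * r * c - x\<^sup>2 / 2"
    unfolding melnikov_integrand_def Let_def x_def[symmetric] r_def[symmetric] c_def[symmetric] root ..
  also have "\<dots> = x\<^sup>2 / 2 * (1 / norm (1 + complex_ratio \<alpha> s \<tau>) - 1 + Re (complex_ratio \<alpha> s \<tau>))"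
    unfolding Re y by (simp add: power2_eq_square algebra_simps)
  finally have m: "melnikov_integrand f \<alpha> G s e (parab_time \<tau>) = x\<^sup>2 / 2 * (1 / norm (1 + complex_ratio \<alpha> s \<tau>) - 1 + Re (complex_ratio \<alpha> s \<tau>))" .
  have "G ^ 3 / 2 * (1 + \<tau>\<^sup>2) * (x\<^sup>2 / 2) = G"
  proof -
    have "G ^ 3 / 2 * P * (4 / (G\<^sup>2 * P) / 2) = G" if "P \<noteq> 0" for P
      using that G_pos by (simp add: field_simps power2_eq_square power3_eq_cube)
    then show ?thesis unfolding x2 using one_plus_square_ne_zero[of \<tau>] by blast
  qed
  then show ?thesis unfolding m mult.assoc[symmetric] by (simp only:)
qed

text \<open>The constant factor of \<open>X^l * conj(X)^m\<close>; the factor \<open>G\<close> is what remains of \<open>x_h\<^sup>2 / 2 * dt/d\<tau>\<close>.\<close>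

definition melnikov_weight :: "nat \<Rightarrow> nat \<Rightarrow> real" where
  "melnikov_weight l m = (if l + m < 2 then 0
     else inv_sqrt_coeff l * inv_sqrt_coeff m * (- 2 / G\<^sup>2) ^ (l + m) * G)"

text \<open>One term of the triple expansion: in the two conjugate powers of the ratio and in the Fourier
  harmonics of the orbit.\<close>

definition melnikov_mode :: "real \<Rightarrow> real \<Rightarrow> (nat \<times> nat) \<times> int \<Rightarrow> real \<Rightarrow> complex" where
  "melnikov_mode \<alpha> s = (\<lambda>((l, m), q) \<tau>. of_real (melnikov_weight l m) * orbit_coeff q l m
      * cis (of_int q * s + of_int (int l - int m) * \<alpha>) * parab_kernel (of_int q * G ^ 3 / 2) l m (of_real \<tau>))"

text \<open>The decay in \<open>l\<close> and \<open>m\<close> comes from \<open>2 / G\<^sup>2 * (15/2) \<le> 1/2\<close>.\<close>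

definition mode_bound :: "(nat \<times> nat) \<times> int \<Rightarrow> real" where
  "mode_bound = (\<lambda>((l, m), q). 5/2 * G * ((1/2) ^ l * (1/2) ^ m) * (1/2) ^ nat \<bar>q - (int m - int l)\<bar>)"

lemma mode_bound_nonneg: "0 \<le> mode_bound p"
  using G_pos by (cases p) (auto simp: mode_bound_def)

lemma summable_mode_bound: "mode_bound summable_on UNIV"
proof -
  have "mode_bound summable_on (SIGMA lm:UNIV. UNIV)"
  proof (rule summable_on_SigmaI)
    show "((\<lambda>q. mode_bound (lm, q)) has_sum (case lm of (l, m) \<Rightarrow> 5/2 * G * ((1/2) ^ l * (1/2) ^ m) * ((1 + 1/2) / (1 - 1/2)))) UNIV" for lm
      unfolding mode_bound_def by (cases lm) (simp only: prod.case, intro has_sum_cmult_right has_sum_geometric_int, auto)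
    have "((\<lambda>(l, m). (1/2::real) ^ l * (1/2) ^ m) has_sum 4) (UNIV :: (nat \<times> nat) set)"
    proof -
      have g: "((\<lambda>j::nat. complex_of_real ((1/2) ^ j)) has_sum of_real (1 / (1 - 1/2))) UNIV"
        unfolding has_sum_of_real_iff by (rule has_sum_geometric_nat) auto
      have "((\<lambda>(l, m). complex_of_real ((1/2) ^ l) * of_real ((1/2) ^ m)) has_sum of_real (1 / (1 - 1/2)) * of_real (1 / (1 - 1/2))) UNIV"
        by (rule has_sum_prod[OF g _ g, where x="1/2"]) (auto simp: norm_power norm_divide)
      from has_sum_Re[OF this] show ?thesis by (simp add: case_prod_unfold)
    qed
    from has_sum_imp_summable[OF has_sum_cmult_left[OF this, of "5/2 * G * 3"]]
    show "(\<lambda>lm. case lm of (l, m) \<Rightarrow> 5/2 * G * ((1/2) ^ l * (1/2) ^ m) * ((1 + 1/2) / (1 - 1/2))) summable_on UNIV"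
      by (simp add: case_prod_unfold mult_ac)
  qed (use mode_bound_nonneg in auto)
  then show ?thesis by simp
qed

lemma abs_melnikov_weight_le: "\<bar>melnikov_weight l m\<bar> \<le> (2 / G\<^sup>2) ^ (l + m) * G"
proof -
  have "\<bar>inv_sqrt_coeff l * inv_sqrt_coeff m\<bar> \<le> 1 * 1"
    unfolding abs_mult by (intro mult_mono abs_inv_sqrt_coeff_le) auto
  then have "\<bar>inv_sqrt_coeff l * inv_sqrt_coeff m\<bar> * ((2 / G\<^sup>2) ^ (l + m) * G) \<le> 1 * ((2 / G\<^sup>2) ^ (l + m) * G)"
    using G_pos by (intro mult_right_mono) auto
  then show ?thesis using G_pos by (simp add: melnikov_weight_def abs_mult power_abs mult.assoc)
qed

lemma norm_melnikov_mode_le: "norm (melnikov_mode \<alpha> s p \<tau>) \<le> mode_bound p * lorentzian \<tau>"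
proof -
  obtain l m q where p: "p = ((l, m), q)" by (metis surj_pair)
  show ?thesis
  proof (cases "l + m < 2")
    case True
    then show ?thesis using mode_bound_nonneg[of p] lorentzian_bounds[of \<tau>]
      by (simp add: p melnikov_mode_def melnikov_weight_def)
  next
    case False
    define d where "d = nat \<bar>q - (int m - int l)\<bar>"
    have lor: "lorentzian \<tau> ^ (l + m) \<le> lorentzian \<tau>" using lorentzian_power_le[of 1 "l + m" \<tau>] False by simp
    have "norm (melnikov_mode \<alpha> s p \<tau>) = \<bar>melnikov_weight l m\<bar> * norm (orbit_coeff q l m) * lorentzian \<tau> ^ (l + m)"
      by (simp add: p melnikov_mode_def norm_mult norm_parab_kernel_real)
    also have "\<dots> \<le> ((2 / G\<^sup>2) ^ (l + m) * G) * ((5/2) * (15/2) ^ (l + m) * (1/2) ^ d) * lorentzian \<tau>"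
      unfolding d_def using G_pos lorentzian_bounds[of \<tau>]
      by (intro mult_mono abs_melnikov_weight_le orbit_coeff_bound_geometric lor) auto
    also have "\<dots> = 5/2 * G * ((2 / G\<^sup>2 * (15/2)) ^ (l + m)) * (1/2) ^ d * lorentzian \<tau>"
      by (simp only: power_mult_distrib mult_ac)
    also have "\<dots> \<le> 5/2 * G * ((1/2) ^ (l + m)) * (1/2) ^ d * lorentzian \<tau>"
    proof (intro mult_right_mono mult_left_mono power_mono)
      have "2 / G\<^sup>2 * (15/2) \<le> 2 / 32\<^sup>2 * (15/2)" using G_ge by (intro mult_right_mono divide_left_mono power_mono) auto
      then show "2 / G\<^sup>2 * (15/2) \<le> 1/2" by simp
    qed (use G_pos lorentzian_bounds[of \<tau>] in auto)
    finally show ?thesis by (simp add: p mode_bound_def d_def power_add)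
  qed
qed

text \<open>The binomial expansion in \<open>(l, m)\<close> is combined with the Fourier series of each orbit monomial, and the
  majorant makes the triple sum unconditional.\<close>

lemma melnikov_mode_has_sum:
  "((\<lambda>p. melnikov_mode \<alpha> s p \<tau>) has_sum
     of_real (G ^ 3 / 2 * (1 + \<tau>\<^sup>2) * melnikov_integrand f \<alpha> G s e (parab_time \<tau>))) UNIV"
proof -
  define X where "X = complex_ratio \<alpha> s \<tau>"
  define t where "t = s + parab_time \<tau>"
  have sm: "(\<lambda>p. melnikov_mode \<alpha> s p \<tau>) summable_on (SIGMA lm:UNIV. UNIV)"
  proof (rule summable_on_dominated)
    show "(\<lambda>p. mode_bound p * lorentzian \<tau>) summable_on (SIGMA lm:UNIV. UNIV)"
      using summable_on_cmult_left[OF summable_mode_bound] by simp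
  qed (rule norm_melnikov_mode_le)
  define V where "V = (\<lambda>(l, m). if l + m < 2 then 0 else of_real (inv_sqrt_coeff l * inv_sqrt_coeff m) * X ^ l * cnj X ^ m)"
  have "(V has_sum of_real (1 / norm (1 + X) - 1 + Re X)) UNIV"
    unfolding V_def by (rule has_sum_inverse_norm_tail) (simp add: X_def norm_complex_ratio_less)
  from has_sum_cmult_left[OF this, of "of_real G"]
  have outer: "((\<lambda>lm. V lm * of_real G) has_sum of_real (1 / norm (1 + X) - 1 + Re X) * of_real G) UNIV" .
  have inner: "((\<lambda>q. melnikov_mode \<alpha> s (lm, q) \<tau>) has_sum V lm * of_real G) UNIV" for lm
  proof -
    obtain l m where lm: "lm = (l, m)" by (cases lm)
    define K where "K = of_real (melnikov_weight l m) * cis (of_int (int l - int m) * \<alpha>)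
      * (inverse (1 - \<i> * of_real \<tau>) ^ (2 * l) * inverse (1 + \<i> * of_real \<tau>) ^ (2 * m))"
    have mode: "melnikov_mode \<alpha> s (lm, q) \<tau> = K * (orbit_coeff q l m * cis (of_int q * t))" for q
    proof -
      have c: "cis (of_int q * s + of_int (int l - int m) * \<alpha>) * exp (\<i> * of_real (of_int q * G ^ 3 / 2) * (of_real \<tau> + of_real \<tau> ^ 3 / 3))
         = cis (of_int (int l - int m) * \<alpha>) * cis (of_int q * t)"
      proof -
        have "\<i> * of_real (of_int q * G ^ 3 / 2) * (of_real \<tau> + of_real \<tau> ^ 3 / 3) = \<i> * complex_of_real (of_int q * parab_time \<tau>)"
          by (simp add: parab_time_def)
        then have ex: "exp (\<i> * of_real (of_int q * G ^ 3 / 2) * (of_real \<tau> + of_real \<tau> ^ 3 / 3)) = cis (of_int q * parab_time \<tau>)"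
          unfolding cis_conv_exp by (rule arg_cong)
        show ?thesis unfolding ex cis_mult t_def by (rule arg_cong[where f=cis]) (simp add: algebra_simps)
      qed
      have "melnikov_mode \<alpha> s (lm, q) \<tau> = of_real (melnikov_weight l m) * orbit_coeff q l m
         * (cis (of_int q * s + of_int (int l - int m) * \<alpha>) * exp (\<i> * of_real (of_int q * G ^ 3 / 2) * (of_real \<tau> + of_real \<tau> ^ 3 / 3)))
         * (inverse (1 - \<i> * of_real \<tau>) ^ (2 * l) * inverse (1 + \<i> * of_real \<tau>) ^ (2 * m))"
        unfolding lm melnikov_mode_def parab_kernel_def by (simp only: prod.case mult.assoc)
      then show ?thesis unfolding c K_def by (simp only: mult_ac)
    qed
    have val: "K * orbit_monomial l m t = (if l + m < 2 then 0 else of_real (inv_sqrt_coeff l * inv_sqrt_coeff m) * X ^ l * cnj X ^ m) * of_real G"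
    proof (cases "l + m < 2")
      case False
      define r F where "r = primary_radius e f t" and "F = f t"
      define I J where "I = inverse (1 - \<i> * of_real \<tau>)" and "J = inverse (1 + \<i> * complex_of_real \<tau>)"
      have X: "X = of_real (- 2 / G\<^sup>2) * cis \<alpha> * (of_real r * cis (- F)) * I ^ 2"
        unfolding X_def complex_ratio_def r_def F_def t_def I_def ..
      have "cnj I = J" by (simp add: I_def J_def)
      then have cX: "cnj X = of_real (- 2 / G\<^sup>2) * cis (- \<alpha>) * (of_real r * cis F) * J ^ 2"
        unfolding X by (simp add: cis_cnj)
      have ca: "cis (of_int (int l - int m) * \<alpha>) = cis \<alpha> ^ l * cis (- \<alpha>) ^ m"
        by (simp add: Complex.DeMoivre cis_mult algebra_simps)
      have "X ^ l * cnj X ^ m = (of_real (- 2 / G\<^sup>2)) ^ (l + m) * (cis \<alpha> ^ l * cis (- \<alpha>) ^ m) * orbit_monomial l m t * (I ^ (2 * l) * J ^ (2 * m))"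
      proof -
        have I2: "I ^ (2 * l) = (I\<^sup>2) ^ l" "J ^ (2 * m) = (J\<^sup>2) ^ m" by (rule power_mult)+
        show ?thesis
          unfolding cX I2 unfolding X orbit_monomial_def r_def[symmetric] F_def[symmetric]
          by (simp only: power_mult_distrib power_add mult_ac)
      qed
      then show ?thesis
        using False unfolding K_def ca I_def[symmetric] J_def[symmetric] by (simp add: melnikov_weight_def)
    qed (simp add: K_def melnikov_weight_def)
    show ?thesis
      unfolding mode using has_sum_cmult_right[OF orbit_monomial_has_sum[of l m t], of K] unfolding val by (simp add: lm V_def)
  qed
  have "((\<lambda>p. melnikov_mode \<alpha> s p \<tau>) has_sum of_real (1 / norm (1 + X) - 1 + Re X) * of_real G) (SIGMA lm:UNIV. UNIV)"
    by (rule has_sum_SigmaI[OF inner outer sm])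
  moreover have "of_real (1 / norm (1 + X) - 1 + Re X) * complex_of_real G
     = of_real (G ^ 3 / 2 * (1 + \<tau>\<^sup>2) * melnikov_integrand f \<alpha> G s e (parab_time \<tau>))"
    unfolding melnikov_integrand_parab_time X_def by (simp only: of_real_mult mult.commute)
  ultimately show ?thesis by (simp only: UNIV_Times_UNIV)
qed

lemma continuous_primary_radius: "continuous_on A (primary_radius e f)"
proof -
  have "continuous_on A (\<lambda>t. 1 - e * cos (ecc t))" by (intro continuous_intros continuous_ecc)
  moreover have "primary_radius e f = (\<lambda>t. 1 - e * cos (ecc t))" by (rule ext) (rule primary_radius_ecc)
  ultimately show ?thesis by (simp only:)
qed

lemma continuous_complex_ratio: "continuous_on A (complex_ratio \<alpha> s)"
proof -
  have c1: "continuous_on A (\<lambda>\<tau>. s + parab_time \<tau>)" unfolding parab_time_def by (intro continuous_intros) auto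
  have c2: "continuous_on A (\<lambda>\<tau>. primary_radius e f (s + parab_time \<tau>))"
    by (rule continuous_on_compose2[OF continuous_primary_radius c1]) auto
  have c3: "continuous_on A (\<lambda>\<tau>. f (s + parab_time \<tau>))"
    by (rule continuous_on_compose2[OF continuous_f c1]) auto
  show ?thesis
    unfolding complex_ratio_def[abs_def] cis_conv_exp by (intro continuous_intros c2 c3) auto
qed

lemma continuous_pulled_back_integrand:
  "continuous_on A (\<lambda>\<tau>. G ^ 3 / 2 * (1 + \<tau>\<^sup>2) * melnikov_integrand f \<alpha> G s e (parab_time \<tau>))"
  unfolding melnikov_integrand_parab_time
proof (intro continuous_intros continuous_complex_ratio ballI)
  fix \<tau>
  have "1 + complex_ratio \<alpha> s \<tau> \<noteq> 0"
    using norm_complex_ratio_less[of \<alpha> s \<tau>] by (auto simp: add_eq_0_iff)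
  then show "norm (1 + complex_ratio \<alpha> s \<tau>) \<noteq> 0" by simp
qed

lemma borel_measurable_melnikov_integrand: "melnikov_integrand f \<alpha> G s e \<in> borel_measurable borel"
proof -
  define H where "H = (\<lambda>\<tau>. G ^ 3 / 2 * (1 + \<tau>\<^sup>2) * melnikov_integrand f \<alpha> G s e (parab_time \<tau>) / (G ^ 3 / 2 * (1 + \<tau>\<^sup>2)))"
  have nz: "G ^ 3 / 2 * (1 + \<tau>\<^sup>2) \<noteq> 0" for \<tau> using G_pos one_plus_square_ne_zero[of \<tau>] by simp
  have "continuous_on UNIV H"
    unfolding H_def by (intro continuous_on_divide continuous_pulled_back_integrand continuous_intros) (use nz in auto)
  then have "H \<in> borel_measurable borel" by (rule borel_measurable_continuous_onI)
  from measurable_compose[OF borel_measurable_tau_h[OF G_pos] this]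
  have "(\<lambda>t. H (tau_h G t)) \<in> borel_measurable borel" .
  moreover have "H (tau_h G t) = melnikov_integrand f \<alpha> G s e t" for t
    using nz[of "tau_h G t"] parab_time_tau_h[OF G_pos, of t] by (simp add: H_def parab_time_def)
  ultimately show ?thesis by simp
qed

lemma integrable_melnikov_mode: "integrable lborel (melnikov_mode \<alpha> s p)"
proof -
  obtain l m q where p: "p = ((l, m), q)" by (cases p) auto
  show ?thesis
  proof (cases "l + m < 2")
    case True
    then show ?thesis by (simp add: p melnikov_mode_def melnikov_weight_def[abs_def])
  next
    case False
    then show ?thesis unfolding p melnikov_mode_def prod.case
      by (intro integrable_mult_right integrable_parab_kernel) auto
  qed
qed

text \<open>The part of \<open>L\<^sub>q\<^sub>,\<^sub>k\<close> with \<open>k = l - m\<close> that comes from the powers \<open>l\<close> and \<open>m\<close>.\<close>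

definition melnikov_term :: "int \<Rightarrow> nat \<Rightarrow> nat \<Rightarrow> real" where
  "melnikov_term q l m = melnikov_weight l m * Re (orbit_coeff q l m) * Re (parab_integral (of_int q * G ^ 3 / 2) l m)"

lemma integral_melnikov_mode:
  "integral\<^sup>L lborel (melnikov_mode \<alpha> s ((l, m), q)) = of_real (melnikov_term q l m) * cis (of_int q * s + of_int (int l - int m) * \<alpha>)"
proof -
  have "complex_of_real (Re (orbit_coeff q l m)) = orbit_coeff q l m"
    using orbit_coeff_real[of q l m] by (simp add: complex_eq_iff)
  moreover have "complex_of_real (Re (parab_integral (of_int q * G ^ 3 / 2) l m)) = parab_integral (of_int q * G ^ 3 / 2) l m"
    using parab_integral_real by (simp add: complex_eq_iff)
  ultimately have "of_real (melnikov_term q l m) * cis (of_int q * s + of_int (int l - int m) * \<alpha>)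
     = of_real (melnikov_weight l m) * orbit_coeff q l m * cis (of_int q * s + of_int (int l - int m) * \<alpha>) * parab_integral (of_int q * G ^ 3 / 2) l m"
    unfolding melnikov_term_def of_real_mult by (simp only: mult_ac)
  then show ?thesis
    unfolding melnikov_mode_def prod.case integral_mult_right_zero parab_integral_def by simp
qed

lemma
  shows integrable_pulled_back_integrand: "integrable lborel (\<lambda>\<tau>. G ^ 3 / 2 * (1 + \<tau>\<^sup>2) * melnikov_integrand f \<alpha> G s e (parab_time \<tau>))"
    and integral_mode_has_sum: "((\<lambda>p. integral\<^sup>L lborel (melnikov_mode \<alpha> s p)) has_sum
      of_real (LBINT \<tau>. G ^ 3 / 2 * (1 + \<tau>\<^sup>2) * melnikov_integrand f \<alpha> G s e (parab_time \<tau>))) UNIV"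
proof -
  define S where "S = (\<lambda>\<tau>. G ^ 3 / 2 * (1 + \<tau>\<^sup>2) * melnikov_integrand f \<alpha> G s e (parab_time \<tau>))"
  have Sm: "(\<lambda>\<tau>. complex_of_real (S \<tau>)) \<in> borel_measurable lborel"
  proof -
    have "continuous_on UNIV (\<lambda>\<tau>. complex_of_real (S \<tau>))"
      unfolding S_def by (rule continuous_on_of_real[OF continuous_pulled_back_integrand])
    then have "(\<lambda>\<tau>. complex_of_real (S \<tau>)) \<in> borel_measurable borel"
      by (rule borel_measurable_continuous_onI)
    then show ?thesis by simp
  qed
  have nn: "0 \<le> lorentzian x" for x using lorentzian_bounds[of x] by simp
  have sum: "((\<lambda>p. melnikov_mode \<alpha> s p x) has_sum complex_of_real (S x)) UNIV" for x
    unfolding S_def by (rule melnikov_mode_has_sum)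
  note dom = has_sum_integral_dominated[where f="melnikov_mode \<alpha> s" and S="\<lambda>\<tau>. complex_of_real (S \<tau>)" and A=UNIV and M=lborel and g=lorentzian and b=mode_bound,
     OF sum integrable_melnikov_mode Sm integrable_lorentzian nn summable_mode_bound mode_bound_nonneg norm_melnikov_mode_le]
  have "integrable lborel (\<lambda>\<tau>. complex_of_real (S \<tau>))" using dom(1) by simp
  then have i: "integrable lborel S" by (simp only: complex_of_real_integrable_eq)
  then show "integrable lborel (\<lambda>\<tau>. G ^ 3 / 2 * (1 + \<tau>\<^sup>2) * melnikov_integrand f \<alpha> G s e (parab_time \<tau>))"
    unfolding S_def .
  show "((\<lambda>p. integral\<^sup>L lborel (melnikov_mode \<alpha> s p)) has_sum
      of_real (LBINT \<tau>. G ^ 3 / 2 * (1 + \<tau>\<^sup>2) * melnikov_integrand f \<alpha> G s e (parab_time \<tau>))) UNIV"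
    using dom(2) unfolding integral_complex_of_real S_def by simp
qed

lemma
  shows integrable_melnikov_integrand: "integrable lborel (melnikov_integrand f \<alpha> G s e)"
    and melnikov_eq_pulled_back: "melnikov f \<alpha> G s e = (LBINT \<tau>. G ^ 3 / 2 * (1 + \<tau>\<^sup>2) * melnikov_integrand f \<alpha> G s e (parab_time \<tau>))"
  using lborel_change_of_variables_parab_time[OF G_pos borel_measurable_melnikov_integrand] integrable_pulled_back_integrand
  unfolding parab_time_def melnikov_def by simp_all

lemma melnikov_term_has_sum:
  "((\<lambda>((l, m), q). of_real (melnikov_term q l m) * cis (of_int q * s + of_int (int l - int m) * \<alpha>)) has_sum
     complex_of_real (melnikov f \<alpha> G s e)) UNIV"
proof -
  have "(\<lambda>p. integral\<^sup>L lborel (melnikov_mode \<alpha> s p))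
     = (\<lambda>((l, m), q). of_real (melnikov_term q l m) * cis (of_int q * s + of_int (int l - int m) * \<alpha>))"
    by (rule ext) (auto simp: integral_melnikov_mode)
  then show ?thesis using integral_mode_has_sum[of \<alpha> s] unfolding melnikov_eq_pulled_back by (simp only:)
qed

lemma melnikov_term_swap: "melnikov_term (- q) m l = melnikov_term q l m"
proof -
  have "melnikov_weight m l = melnikov_weight l m"
    by (simp add: melnikov_weight_def add.commute[of m l] mult.commute[of "inv_sqrt_coeff m"])
  moreover have "parab_integral (of_int (- q) * G ^ 3 / 2) m l = parab_integral (of_int q * G ^ 3 / 2) l m"
    using parab_integral_swap[of "of_int q * G ^ 3 / 2" m l] by simp
  ultimately show ?thesis unfolding melnikov_term_def by (simp only: orbit_coeff_swap[of q m l])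
qed

text \<open>Combines the bounds of the three factors; the constant \<open>5 = 2 * (5/2)\<close> collects the weight and the orbit
  coefficient.\<close>

lemma abs_melnikov_term_le:
  assumes "norm (parab_integral (of_int q * G ^ 3 / 2) l m) \<le> P"
  shows "\<bar>melnikov_term q l m\<bar> \<le> 5/2 * G * (5 / G\<^sup>2) ^ (l + m) * e ^ nat \<bar>int m - int l - q\<bar> * exp \<bar>real_of_int q\<bar> * P"
proof -
  have "\<bar>melnikov_term q l m\<bar> \<le> ((2 / G\<^sup>2) ^ (l + m) * G) * ((5/2) ^ (l + m + 1) * e ^ nat \<bar>int m - int l - q\<bar> * exp \<bar>real_of_int q\<bar>) * P"
    unfolding melnikov_term_def abs_mult
  proof (intro mult_mono abs_melnikov_weight_le)
    show "\<bar>Re (orbit_coeff q l m)\<bar> \<le> (5/2) ^ (l + m + 1) * e ^ nat \<bar>int m - int l - q\<bar> * exp \<bar>real_of_int q\<bar>"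
      by (rule order_trans[OF abs_Re_le_cmod orbit_coeff_bound])
    show "\<bar>Re (parab_integral (of_int q * G ^ 3 / 2) l m)\<bar> \<le> P"
      by (rule order_trans[OF abs_Re_le_cmod assms])
  qed (use G_pos e_pos in auto)
  also have "\<dots> = 5/2 * G * ((2 / G\<^sup>2) ^ (l + m) * (5/2) ^ (l + m)) * e ^ nat \<bar>int m - int l - q\<bar> * exp \<bar>real_of_int q\<bar> * P"
    by (simp add: mult_ac)
  also have "(2 / G\<^sup>2) ^ (l + m) * (5/2) ^ (l + m) = (5 / G\<^sup>2) ^ (l + m)" by (simp flip: power_mult_distrib)
  finally show ?thesis .
qed

lemma melnikov_term_eq_0: "l + m < 2 \<Longrightarrow> melnikov_term q l m = 0"
  by (simp add: melnikov_term_def melnikov_weight_def)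

lemma abs_melnikov_term_le_mode_bound: "\<bar>melnikov_term q l m\<bar> \<le> 2 * mode_bound ((l, m), q)"
proof (cases "l + m < 2")
  case True
  then show ?thesis using mode_bound_nonneg[of "((l, m), q)"] by (simp add: melnikov_term_eq_0)
next
  case False
  define d where "d = nat \<bar>q - (int m - int l)\<bar>"
  have "\<bar>melnikov_term q l m\<bar> \<le> ((2 / G\<^sup>2) ^ (l + m) * G) * ((5/2) * (15/2) ^ (l + m) * (1/2) ^ d) * 2"
    unfolding melnikov_term_def abs_mult d_def
  proof (intro mult_mono abs_melnikov_weight_le)
    show "\<bar>Re (orbit_coeff q l m)\<bar> \<le> (5/2) * (15/2) ^ (l + m) * (1/2) ^ nat \<bar>q - (int m - int l)\<bar>"
      by (rule order_trans[OF abs_Re_le_cmod orbit_coeff_bound_geometric])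
    show "\<bar>Re (parab_integral (of_int q * G ^ 3 / 2) l m)\<bar> \<le> 2"
      by (rule order_trans[OF abs_Re_le_cmod parab_integral_norm_le]) (use False in simp)
  qed (use G_pos in auto)
  also have "\<dots> = 2 * (5/2 * G * ((2 / G\<^sup>2 * (15/2)) ^ (l + m)) * (1/2) ^ d)"
    by (simp only: power_mult_distrib mult_ac)
  also have "\<dots> \<le> 2 * (5/2 * G * ((1/2) ^ (l + m)) * (1/2) ^ d)"
  proof (intro mult_right_mono mult_left_mono power_mono)
    have "2 / G\<^sup>2 * (15/2) \<le> 2 / 32\<^sup>2 * (15/2)" using G_ge by (intro mult_right_mono divide_left_mono power_mono) auto
    then show "2 / G\<^sup>2 * (15/2) \<le> 1/2" by simp
  qed (use G_pos in auto)
  finally show ?thesis by (simp add: mode_bound_def d_def power_add)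
qed

section \<open>The Fourier coefficients of the potential\<close>

text \<open>Pairs \<open>(l, m)\<close> with \<open>l - m = k\<close> are \<open>(j + k\<^sup>+, j + k\<^sup>-)\<close> with \<open>j = min l m\<close>.\<close>

lemma bij_mode_index: "bij (\<lambda>((q, k), j). ((j + nat k, j + nat (- k)), q))"
  by (rule bij_betw_byWitness[where f'="\<lambda>((l, m), q). ((q, int l - int m), min l m)"]) auto

lemma mode_index_diff: "int (j + nat k) - int (j + nat (- k)) = k" by auto

lemma abs_melnikov_term_index_le:
  "\<bar>melnikov_term q (j + nat k) (j + nat (- k))\<bar> \<le> 5 * G * ((1/2) ^ nat \<bar>k\<bar> * (1/2) ^ nat \<bar>q + k\<bar>) * (1/2) ^ j"
proof -
  define n where "n = nat \<bar>k\<bar>"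
  have n: "(j + nat k) + (j + nat (- k)) = n + j + j" by (simp add: n_def)
  have d: "q - (int (j + nat (- k)) - int (j + nat k)) = q + k" by auto
  have "(1/2::real) ^ (j + nat k) * (1/2) ^ (j + nat (- k)) = (1/2) ^ n * (1/2) ^ j * (1/2) ^ j"
    unfolding power_add[symmetric] n ..
  also have "\<dots> \<le> (1/2) ^ n * (1/2) ^ j * 1" by (intro mult_left_mono power_le_one) auto
  finally have p: "(1/2::real) ^ (j + nat k) * (1/2) ^ (j + nat (- k)) \<le> (1/2) ^ n * (1/2) ^ j" by simp
  have "\<bar>melnikov_term q (j + nat k) (j + nat (- k))\<bar> \<le> 2 * (5/2 * G * ((1/2) ^ (j + nat k) * (1/2) ^ (j + nat (- k))) * (1/2) ^ nat \<bar>q + k\<bar>)"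
    using abs_melnikov_term_le_mode_bound[of q "j + nat k" "j + nat (- k)"] unfolding mode_bound_def prod.case d .
  also have "\<dots> \<le> 2 * (5/2 * G * ((1/2) ^ n * (1/2) ^ j) * (1/2) ^ nat \<bar>q + k\<bar>)"
    using G_pos p by (intro mult_left_mono mult_right_mono) auto
  finally show ?thesis by (simp add: n_def mult_ac)
qed

definition harmonic_coeff :: "int \<Rightarrow> int \<Rightarrow> real" where
  "harmonic_coeff q k = (\<Sum>\<^sub>\<infinity>j. melnikov_term q (j + nat k) (j + nat (- k)))"

lemma harmonic_coeff_has_sum:
  "((\<lambda>j. melnikov_term q (j + nat k) (j + nat (- k))) has_sum harmonic_coeff q k) UNIV"
  unfolding harmonic_coeff_def
proof (rule has_sum_infsum, rule summable_on_dominated)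
  show "(\<lambda>j. 5 * G * ((1/2) ^ nat \<bar>k\<bar> * (1/2) ^ nat \<bar>q + k\<bar>) * (1/2) ^ j) summable_on (UNIV :: nat set)"
    by (rule has_sum_imp_summable[OF has_sum_cmult_right[OF has_sum_geometric_nat]]) auto
  show "norm (melnikov_term q (j + nat k) (j + nat (- k))) \<le> 5 * G * ((1/2) ^ nat \<bar>k\<bar> * (1/2) ^ nat \<bar>q + k\<bar>) * (1/2) ^ j" for j
    using abs_melnikov_term_index_le by simp
qed

lemma harmonic_coeff_uminus: "harmonic_coeff (- q) (- k) = harmonic_coeff q k"
  unfolding harmonic_coeff_def minus_minus by (rule infsum_cong) (rule melnikov_term_swap)

lemma abs_harmonic_coeff_le: "\<bar>harmonic_coeff q k\<bar> \<le> 10 * G * ((1/2) ^ nat \<bar>k\<bar> * (1/2) ^ nat \<bar>q + k\<bar>)"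
proof -
  have "((\<lambda>j::nat. 5 * G * ((1/2) ^ nat \<bar>k\<bar> * (1/2) ^ nat \<bar>q + k\<bar>) * (1/2) ^ j) has_sum
      5 * G * ((1/2) ^ nat \<bar>k\<bar> * (1/2) ^ nat \<bar>q + k\<bar>) * (1 / (1 - 1/2))) UNIV"
    by (intro has_sum_cmult_right has_sum_geometric_nat) auto
  from norm_infsum_le[OF harmonic_coeff_has_sum[of q k] this] abs_melnikov_term_index_le
  show ?thesis by simp
qed

definition coeff_bound :: "int \<times> int \<Rightarrow> real" where
  "coeff_bound = (\<lambda>(q, k). 10 * G * ((1/2) ^ nat \<bar>k\<bar> * (1/2) ^ nat \<bar>q + k\<bar>))"

lemma coeff_bound_nonneg: "0 \<le> coeff_bound p"
  using G_pos by (cases p) (auto simp: coeff_bound_def)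

lemma summable_coeff_bound: "coeff_bound summable_on UNIV"
proof -
  have "(\<lambda>(k, q). coeff_bound (q, k)) summable_on (SIGMA k:UNIV. UNIV)"
  proof (rule summable_on_SigmaI)
    fix k :: int
    have "((\<lambda>q. 10 * G * (1/2) ^ nat \<bar>k\<bar> * (1/2) ^ nat \<bar>q - (- k)\<bar>) has_sum 10 * G * (1/2) ^ nat \<bar>k\<bar> * ((1 + 1/2) / (1 - 1/2))) UNIV"
      by (intro has_sum_cmult_right has_sum_geometric_int) auto
    then show "((\<lambda>q. case (k, q) of (k, q) \<Rightarrow> coeff_bound (q, k)) has_sum 30 * G * (1/2) ^ nat \<bar>k - 0\<bar>) UNIV"
      by (simp add: coeff_bound_def mult_ac)
  next
    show "(\<lambda>k. 30 * G * (1/2) ^ nat \<bar>k - 0\<bar>) summable_on (UNIV :: int set)"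
      by (rule has_sum_imp_summable[OF has_sum_cmult_right[OF has_sum_geometric_int]]) auto
  qed (use coeff_bound_nonneg in auto)
  then have "(\<lambda>(k, q). coeff_bound (q, k)) summable_on UNIV" by simp
  moreover have "bij (\<lambda>(q, k). (k, q) :: int \<times> int)"
    by (rule bij_betw_byWitness[where f'="\<lambda>(k, q). (q, k)"]) auto
  ultimately have "(\<lambda>p. case (case p of (q, k) \<Rightarrow> (k, q)) of (k, q) \<Rightarrow> coeff_bound (q, k)) summable_on UNIV"
    using summable_on_reindex_bij_betw[of "\<lambda>(q, k). (k, q) :: int \<times> int" UNIV UNIV "\<lambda>(k, q). coeff_bound (q, k)"] by blast
  then show ?thesis by (simp add: case_prod_unfold)
qed

lemma harmonic_coeff_series:
  "((\<lambda>(q, k). of_real (harmonic_coeff q k) * cis (of_int q * s + of_int k * \<alpha>)) has_sum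
     complex_of_real (melnikov f \<alpha> G s e)) UNIV"
proof -
  define h where "h = (\<lambda>((l, m), q). complex_of_real (melnikov_term q l m) * cis (of_int q * s + of_int (int l - int m) * \<alpha>))"
  define \<phi> :: "(int \<times> int) \<times> nat \<Rightarrow> (nat \<times> nat) \<times> int" where "\<phi> = (\<lambda>((q, k), j). ((j + nat k, j + nat (- k)), q))"
  have "bij_betw \<phi> UNIV UNIV" unfolding \<phi>_def by (rule bij_mode_index)
  then have "((\<lambda>x. h (\<phi> x)) has_sum complex_of_real (melnikov f \<alpha> G s e)) UNIV"
    using has_sum_reindex_bij_betw[of \<phi> UNIV UNIV h] melnikov_term_has_sum[of s \<alpha>] unfolding h_def by blast
  then have 1: "((\<lambda>x. h (\<phi> x)) has_sum complex_of_real (melnikov f \<alpha> G s e)) (SIGMA qk:UNIV. UNIV)"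
    by simp
  have 2: "((\<lambda>j. h (\<phi> (qk, j))) has_sum (case qk of (q, k) \<Rightarrow> of_real (harmonic_coeff q k) * cis (of_int q * s + of_int k * \<alpha>))) UNIV" for qk
  proof -
    obtain q k where qk: "qk = (q, k)" by (cases qk)
    have "((\<lambda>j. complex_of_real (melnikov_term q (j + nat k) (j + nat (- k))) * cis (of_int q * s + of_int k * \<alpha>)) has_sum
       of_real (harmonic_coeff q k) * cis (of_int q * s + of_int k * \<alpha>)) UNIV"
      by (rule has_sum_cmult_left) (simp only: has_sum_of_real_iff harmonic_coeff_has_sum)
    then show ?thesis unfolding qk \<phi>_def h_def prod.case mode_index_diff .
  qed
  show ?thesis by (rule has_sum_SigmaD[OF 1 2])
qed

text \<open>The double series converges uniformly, so the double Fourier integral may be taken term by term, first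
  in \<open>\<alpha>\<close> and then in \<open>s\<close>.\<close>

lemma melnikov_fourier_eq: "melnikov_fourier f G e q k = of_real (harmonic_coeff q k)"
proof -
  define A where "A = (\<lambda>p. complex_of_real (harmonic_coeff (fst p) (snd p)))"
  define c where "c = (\<lambda>p::int \<times> int. if snd p = k then complex_of_real (2 * pi) else 0)"
  have A: "norm (A p) \<le> coeff_bound p" for p
    using abs_harmonic_coeff_le[of "fst p" "snd p"] by (cases p) (simp add: A_def coeff_bound_def)
  have inner: "((\<lambda>p. A p * c p * cis (of_int (fst p - q) * s)) has_sum
     integral {0..2*pi} (\<lambda>\<alpha>. complex_of_real (melnikov f \<alpha> G s e) * cis (- (of_int q * s + of_int k * \<alpha>)))) UNIV" for s
  proof -
    have e: "A p * cis (of_int (fst p) * s + of_int (snd p) * \<alpha>) * cis (- (of_int q * s + of_int k * \<alpha>))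
       = A p * cis (of_int (fst p - q) * s) * cis (of_int (snd p - k) * \<alpha>)" for p \<alpha>
      unfolding mult.assoc cis_mult by (rule arg_cong[where f="\<lambda>x. A p * cis x"]) (simp add: algebra_simps)
    have i: "integral {0..2*pi} (\<lambda>\<alpha>. A p * cis (of_int (fst p) * s + of_int (snd p) * \<alpha>) * cis (- (of_int q * s + of_int k * \<alpha>)))
        = A p * c p * cis (of_int (fst p - q) * s)" for p
      unfolding e Henstock_Kurzweil_Integration.integral_mult_right integral_cis_period by (simp add: c_def)
    have "((\<lambda>p. integral {0..2*pi} (\<lambda>\<alpha>. A p * cis (of_int (fst p) * s + of_int (snd p) * \<alpha>) * cis (- (of_int q * s + of_int k * \<alpha>)))) has_sum
      integral {0..2*pi} (\<lambda>\<alpha>. complex_of_real (melnikov f \<alpha> G s e) * cis (- (of_int q * s + of_int k * \<alpha>)))) UNIV"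
    proof (rule has_sum_integral_interval(2)[OF _ _ summable_coeff_bound])
      fix \<alpha>
      have "((\<lambda>p. A p * cis (of_int (fst p) * s + of_int (snd p) * \<alpha>)) has_sum complex_of_real (melnikov f \<alpha> G s e)) UNIV"
        using harmonic_coeff_series[of s \<alpha>] by (simp add: A_def case_prod_unfold)
      then show "((\<lambda>p. A p * cis (of_int (fst p) * s + of_int (snd p) * \<alpha>) * cis (- (of_int q * s + of_int k * \<alpha>))) has_sum
          complex_of_real (melnikov f \<alpha> G s e) * cis (- (of_int q * s + of_int k * \<alpha>))) UNIV"
        by (rule has_sum_cmult_left)
      show "norm (A p * cis (of_int (fst p) * s + of_int (snd p) * \<alpha>) * cis (- (of_int q * s + of_int k * \<alpha>))) \<le> coeff_bound p" for p
        using A by (simp add: norm_mult)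
    next
      show "continuous_on {0..2*pi} (\<lambda>\<alpha>. A p * cis (of_int (fst p) * s + of_int (snd p) * \<alpha>) * cis (- (of_int q * s + of_int k * \<alpha>)))" for p
        unfolding e by (intro continuous_intros continuous_on_cis_mult)
    qed (rule coeff_bound_nonneg)
    then show ?thesis unfolding i .
  qed
  have "((\<lambda>p. integral {0..2*pi} (\<lambda>s. A p * c p * cis (of_int (fst p - q) * s))) has_sum
     integral {0..2*pi} (\<lambda>s. integral {0..2*pi} (\<lambda>\<alpha>. complex_of_real (melnikov f \<alpha> G s e) * cis (- (of_int q * s + of_int k * \<alpha>))))) UNIV"
  proof (rule has_sum_integral_interval(2)[OF inner])
    show "(\<lambda>p. 2 * pi * coeff_bound p) summable_on UNIV"
      using has_sum_imp_summable[OF has_sum_cmult_right[OF has_sum_infsum[OF summable_coeff_bound]]] .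
    show "norm (A p * c p * cis (of_int (fst p - q) * x)) \<le> 2 * pi * coeff_bound p" for p x
    proof -
      have "norm (A p) * norm (c p) \<le> coeff_bound p * (2 * pi)"
        using A[of p] coeff_bound_nonneg[of p] by (intro mult_mono) (auto simp: c_def)
      then show ?thesis by (simp add: norm_mult mult_ac)
    qed
    show "continuous_on {0..2 * pi} (\<lambda>s. A p * c p * cis (of_int (fst p - q) * s))" for p
      by (intro continuous_intros continuous_on_cis_mult)
  qed (use coeff_bound_nonneg in auto)
  moreover have "integral {0..2*pi} (\<lambda>s. A p * c p * cis (of_int (fst p - q) * s)) = (if p = (q, k) then of_real (4 * pi\<^sup>2 * harmonic_coeff q k) else 0)" for p
    unfolding Henstock_Kurzweil_Integration.integral_mult_right integral_cis_period
    by (cases p) (auto simp: c_def A_def power2_eq_square)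
  ultimately have "((\<lambda>p. if p = (q, k) then of_real (4 * pi\<^sup>2 * harmonic_coeff q k) else 0) has_sum
     integral {0..2*pi} (\<lambda>s. integral {0..2*pi} (\<lambda>\<alpha>. complex_of_real (melnikov f \<alpha> G s e) * cis (- (of_int q * s + of_int k * \<alpha>))))) UNIV"
    by (simp only:)
  moreover have "((\<lambda>p. if p = (q, k) then of_real (4 * pi\<^sup>2 * harmonic_coeff q k) else 0) has_sum complex_of_real (4 * pi\<^sup>2 * harmonic_coeff q k)) UNIV"
    by (rule has_sum_finite_neutralI[of "{(q, k)}"]) auto
  ultimately have "integral {0..2*pi} (\<lambda>s. integral {0..2*pi} (\<lambda>\<alpha>. complex_of_real (melnikov f \<alpha> G s e) * cis (- (of_int q * s + of_int k * \<alpha>))))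
     = complex_of_real (4 * pi\<^sup>2 * harmonic_coeff q k)"
    by (rule has_sum_unique)
  then show ?thesis unfolding melnikov_fourier_def by simp
qed

lemma melnikov_coeff_eq: "melnikov_coeff f G e q k = harmonic_coeff q k"
  by (simp add: melnikov_coeff_def melnikov_fourier_eq)

text \<open>The sum of all terms with time frequency \<open>q\<close>, of which \<open>\<L>\<^sub>q\<close> collects those for \<open>q\<close> and \<open>- q\<close>.\<close>

definition half_harmonic :: "real \<Rightarrow> real \<Rightarrow> int \<Rightarrow> real" where
  "half_harmonic \<alpha> s q = (\<Sum>\<^sub>\<infinity>k. harmonic_coeff q k * cos (of_int q * s + of_int k * \<alpha>))"

lemma half_harmonic_has_sum:
  "((\<lambda>k. harmonic_coeff q k * cos (of_int q * s + of_int k * \<alpha>)) has_sum half_harmonic \<alpha> s q) UNIV"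
  unfolding half_harmonic_def
proof (rule has_sum_infsum, rule summable_on_dominated)
  show "(\<lambda>k. 10 * G * (1/2) ^ nat \<bar>k - 0\<bar>) summable_on (UNIV :: int set)"
    by (rule has_sum_imp_summable[OF has_sum_cmult_right[OF has_sum_geometric_int]]) auto
  fix k :: int
  have "\<bar>harmonic_coeff q k\<bar> * \<bar>cos (of_int q * s + of_int k * \<alpha>)\<bar> \<le> \<bar>harmonic_coeff q k\<bar> * 1"
    by (intro mult_left_mono) auto
  also have "\<dots> \<le> 10 * G * ((1/2) ^ nat \<bar>k\<bar> * (1/2) ^ nat \<bar>q + k\<bar>)" using abs_harmonic_coeff_le by simp
  also have "\<dots> \<le> 10 * G * ((1/2) ^ nat \<bar>k\<bar> * 1)"
    using G_pos by (intro mult_left_mono power_le_one) auto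
  finally show "norm (harmonic_coeff q k * cos (of_int q * s + of_int k * \<alpha>)) \<le> 10 * G * (1/2) ^ nat \<bar>k - 0\<bar>"
    by (simp add: abs_mult)
qed

lemma half_harmonics_has_sum: "(half_harmonic \<alpha> s has_sum melnikov f \<alpha> G s e) UNIV"
proof -
  have "((\<lambda>(q, k). harmonic_coeff q k * cos (of_int q * s + of_int k * \<alpha>)) has_sum melnikov f \<alpha> G s e) (SIGMA q:UNIV. UNIV)"
    using has_sum_Re[OF harmonic_coeff_series[of s \<alpha>]] by (simp add: case_prod_unfold)
  then show ?thesis
    by (rule has_sum_SigmaD) (simp add: half_harmonic_has_sum)
qed

lemma half_harmonic_uminus: "half_harmonic \<alpha> s (- q) = half_harmonic \<alpha> s q"
proof -
  have "((\<lambda>k. harmonic_coeff (- q) (- k) * cos (of_int (- q) * s + of_int (- k) * \<alpha>)) has_sum half_harmonic \<alpha> s (- q)) UNIV"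
    using has_sum_reindex_bij_betw[of uminus UNIV UNIV "\<lambda>k. harmonic_coeff (- q) k * cos (of_int (- q) * s + of_int k * \<alpha>)"]
      half_harmonic_has_sum[of "- q" s \<alpha>] by (simp add: bij_uminus)
  moreover have "cos (of_int (- q) * s + of_int (- k) * \<alpha>) = cos (of_int q * s + of_int k * \<alpha>)" for k
  proof -
    have "of_int (- q) * s + of_int (- k) * \<alpha> = - (of_int q * s + of_int k * \<alpha>)" by simp
    then show ?thesis by (simp only: cos_minus)
  qed
  ultimately show ?thesis
    using half_harmonic_has_sum[of q s \<alpha>] has_sum_unique by (simp only: harmonic_coeff_uminus) blast
qed

lemma melnikov_harmonic_eq: "melnikov_harmonic f q \<alpha> G s e = 2 * half_harmonic \<alpha> s q"
  by (simp add: melnikov_harmonic_def half_harmonic_def melnikov_coeff_eq)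

lemma harmonic_0_has_sum:
  "((\<lambda>k. harmonic_coeff 0 k * cos (of_int k * \<alpha>)) has_sum (half_harmonic \<alpha> s 0 - harmonic_coeff 0 0) / 2) {1..}"
proof -
  have "((\<lambda>k. harmonic_coeff 0 k * cos (of_int k * \<alpha>)) has_sum (half_harmonic \<alpha> s 0 - harmonic_coeff 0 0 * cos (of_int 0 * \<alpha>)) / 2) {1..}"
  proof (rule has_sum_int_even)
    show "((\<lambda>k. harmonic_coeff 0 k * cos (of_int k * \<alpha>)) has_sum half_harmonic \<alpha> s 0) UNIV"
      using half_harmonic_has_sum[of 0 s \<alpha>] by simp
    show "harmonic_coeff 0 (- k) * cos (of_int (- k) * \<alpha>) = harmonic_coeff 0 k * cos (of_int k * \<alpha>)" for k
      using harmonic_coeff_uminus[of 0 k] by simp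
  qed
  then show ?thesis by simp
qed

lemma melnikov_0_eq: "melnikov_0 f \<alpha> G e = half_harmonic \<alpha> s 0"
  using infsumI[OF harmonic_0_has_sum[of \<alpha> s]] by (simp add: melnikov_0_def melnikov_coeff_eq field_simps)

lemma half_harmonics_ge2_has_sum:
  "(half_harmonic \<alpha> s has_sum ((melnikov f \<alpha> G s e - half_harmonic \<alpha> s 0) / 2 - half_harmonic \<alpha> s 1)) {2..}"
proof -
  have "(half_harmonic \<alpha> s has_sum (melnikov f \<alpha> G s e - half_harmonic \<alpha> s 0) / 2) {1..}"
    by (rule has_sum_int_even[OF half_harmonics_has_sum half_harmonic_uminus])
  then have "(half_harmonic \<alpha> s has_sum ((melnikov f \<alpha> G s e - half_harmonic \<alpha> s 0) / 2 - half_harmonic \<alpha> s 1)) ({1..} - {1})"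
    using has_sum_finite[of "{1}" "half_harmonic \<alpha> s"] by (intro has_sum_Diff) auto
  moreover have "{1..} - {1} = {2 :: int..}" by auto
  ultimately show ?thesis by (simp only:)
qed

lemma melnikov_ge2_eq: "melnikov_ge2 f \<alpha> G s e = melnikov f \<alpha> G s e - half_harmonic \<alpha> s 0 - 2 * half_harmonic \<alpha> s 1"
  using has_sum_cmult_right[OF half_harmonics_ge2_has_sum[of \<alpha> s], of 2]
  unfolding melnikov_ge2_def melnikov_harmonic_eq by (simp add: infsumI)

section \<open>The harmonics beyond the first\<close>

definition decay :: real where "decay = exp (- (G ^ 3 / 3))"

lemma decay_pos: "0 < decay" by (simp add: decay_def)

lemma exp_2_le: "exp (2::real) \<le> 9"
proof -
  have "exp (2::real) = exp 1 * exp 1" by (simp flip: exp_add)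
  also have "\<dots> \<le> 3 * 3" using exp_le by (intro mult_mono) auto
  finally show ?thesis by simp
qed

lemma G_powers_ge: "1024 \<le> G\<^sup>2" "32768 \<le> G ^ 3" "1048576 \<le> G ^ 4"
  using power_mono[OF G_ge, of 2] power_mono[OF G_ge, of 3] power_mono[OF G_ge, of 4] by auto

text \<open>The distance \<open>\<eta> = sqrt (2 / G^3)\<close> from the saddle is the natural one for \<open>q = 1\<close>. Using it for all \<open>q\<close> costs
  only the factor \<open>exp q\<close>, because then \<open>w \<eta>\<^sup>2 = q\<close>.\<close>

lemma parab_integral_bound_pos:
  assumes p: "1 \<le> p" and lm: "1 \<le> l + m"
  shows "norm (parab_integral (real p * G ^ 3 / 2) l m) \<le> exp (real p) * decay ^ p * (G ^ 3 / 2) ^ m * (3 / (G * sqrt G))"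
proof -
  define \<eta> where "\<eta> = sqrt (2 / G ^ 3)"
  define w where "w = real p * G ^ 3 / 2"
  have \<eta>2: "\<eta>\<^sup>2 = 2 / G ^ 3" using G_pos by (simp add: \<eta>_def)
  have \<eta>: "0 < \<eta>" "\<eta> \<le> 1/128"
  proof -
    show "0 < \<eta>" using G_pos by (simp add: \<eta>_def)
    have "\<eta>\<^sup>2 \<le> 2 / 32768" unfolding \<eta>2 using G_powers_ge G_pos by (intro divide_left_mono) auto
    then have "\<eta>\<^sup>2 \<le> (1/128)\<^sup>2" by (simp add: power2_eq_square)
    then show "\<eta> \<le> 1/128" by (rule power2_le_imp_le) simp
  qed
  have w: "0 < w" "G ^ 3 / 2 \<le> w" using G_pos p by (simp_all add: w_def)
  have w\<eta>: "w * \<eta>\<^sup>2 = real p" using G_pos by (simp add: w_def \<eta>2)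
  have "norm (parab_integral w l m) \<le> exp (w * \<eta>\<^sup>2 - 2 * w / 3) * inverse (\<eta>\<^sup>2) ^ m * sqrt (pi / (w * (1 - \<eta>)))"
    by (rule parab_integral_bound) (use w \<eta> lm in auto)
  also have "exp (w * \<eta>\<^sup>2 - 2 * w / 3) = exp (real p) * decay ^ p"
  proof -
    have "w * \<eta>\<^sup>2 - 2 * w / 3 = real p + real p * (- (G ^ 3 / 3))" unfolding w\<eta> by (simp add: w_def)
    then show ?thesis by (simp only: exp_add exp_of_nat_mult decay_def)
  qed
  also have "inverse (\<eta>\<^sup>2) = G ^ 3 / 2" by (simp add: \<eta>2)
  also have "sqrt (pi / (w * (1 - \<eta>))) \<le> 3 / (G * sqrt G)"
  proof (rule real_le_lsqrt)
    have "G ^ 3 / 2 * (127/128) \<le> w * (1 - \<eta>)" using w \<eta> G_pos by (intro mult_mono) auto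
    then have "pi / (w * (1 - \<eta>)) \<le> (22/7) / (G ^ 3 / 2 * (127/128))"
      using G_pos pi_approx by (intro frac_le) auto
    also have "\<dots> \<le> 9 / G ^ 3" using G_pos by (simp add: field_simps)
    also have "\<dots> = (3 / (G * sqrt G))\<^sup>2" using G_pos by (simp add: power_divide power_mult_distrib power2_eq_square power3_eq_cube)
    finally show "pi / (w * (1 - \<eta>)) \<le> (3 / (G * sqrt G))\<^sup>2" .
  qed (use G_pos in simp)
  finally show ?thesis using G_pos decay_pos unfolding w_def by (simp add: mult_left_mono)
qed

text \<open>A power of \<open>l\<close> costs \<open>5 / G\<^sup>2\<close>, but a power of \<open>m\<close> gains \<open>G^3\<close> from the pole at the saddle, so it is
  large, \<open>5 G / 2\<close>. The two factors \<open>exp q\<close>, of the orbit and of the integral, are absorbed in 9.\<close>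

lemma abs_melnikov_term_pos_le:
  assumes p: "1 \<le> p"
  shows "\<bar>melnikov_term (int p) l m\<bar> \<le> 15/2 / sqrt G * (9 * decay) ^ p * (5 / G\<^sup>2) ^ l * (5/2 * G) ^ m
    * e ^ nat \<bar>int m - int l - int p\<bar>"
proof (cases "l + m < 2")
  case True
  then show ?thesis using G_pos decay_pos e_pos by (simp add: melnikov_term_eq_0)
next
  case False
  define n where "n = nat \<bar>int m - int l - int p\<bar>"
  define s where "s = sqrt G"
  have s: "s > 0" "G = s\<^sup>2" using G_pos by (auto simp: s_def)
  have P: "norm (parab_integral (of_int (int p) * G ^ 3 / 2) l m) \<le> exp (real p) * decay ^ p * (G ^ 3 / 2) ^ m * (3 / (G * sqrt G))"
    using parab_integral_bound_pos[OF p, of l m] False by simp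
  have "\<bar>melnikov_term (int p) l m\<bar> \<le> 5/2 * G * (5 / G\<^sup>2) ^ (l + m) * e ^ n * exp (real p) * (exp (real p) * decay ^ p * (G ^ 3 / 2) ^ m * (3 / (G * s)))"
    using abs_melnikov_term_le[OF P] by (simp add: n_def s_def)
  also have "\<dots> = (5/2 * G * (3 / (G * s))) * ((exp (real p) * exp (real p)) * decay ^ p) * (5 / G\<^sup>2) ^ l * ((5 / G\<^sup>2) ^ m * (G ^ 3 / 2) ^ m) * e ^ n"
    by (simp only: power_add mult_ac)
  also have "(5 / G\<^sup>2) ^ m * (G ^ 3 / 2) ^ m = (5/2 * G) ^ m"
  proof -
    have "5 / G\<^sup>2 * (G ^ 3 / 2) = 5/2 * G" using G_pos by (simp add: power2_eq_square power3_eq_cube)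
    then show ?thesis by (simp only: power_mult_distrib[symmetric])
  qed
  also have "5/2 * G * (3 / (G * s)) = 15/2 / s" using G_pos s(1) by simp
  also have "exp (real p) * exp (real p) * decay ^ p = (exp 2 * decay) ^ p"
  proof -
    have "exp (real p) * exp (real p) = exp (real p * 2)" unfolding exp_add[symmetric] by simp
    then show ?thesis by (simp only: exp_of_nat_mult power_mult_distrib)
  qed
  also have "15/2 / s * (exp 2 * decay) ^ p * (5 / G\<^sup>2) ^ l * (5/2 * G) ^ m * e ^ n
      \<le> 15/2 / s * (9 * decay) ^ p * (5 / G\<^sup>2) ^ l * (5/2 * G) ^ m * e ^ n"
    using exp_2_le decay_pos e_pos G_pos s by (intro mult_right_mono mult_left_mono power_mono) auto
  finally show ?thesis unfolding n_def s_def .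
qed

lemma abs_melnikov_term_pos_index_le:
  assumes p: "1 \<le> p"
  shows "\<bar>melnikov_term (int p) (j + nat k) (j + nat (- k))\<bar> \<le> 15/2 / sqrt G * (9 * decay) ^ p
    * (25 / (2 * G)) ^ j * (5 / G\<^sup>2) ^ nat k * (5/2 * G) ^ nat (- k) * e ^ nat \<bar>k + int p\<bar>"
proof -
  have n: "\<bar>int (j + nat (- k)) - int (j + nat k) - int p\<bar> = \<bar>k + int p\<bar>" by auto
  have "5 / G\<^sup>2 * (5/2 * G) = 25 / (2 * G)" using G_pos by (simp add: power2_eq_square)
  then have R: "(25 / (2 * G)) ^ j = (5 / G\<^sup>2) ^ j * (5/2 * G) ^ j" by (simp only: power_mult_distrib[symmetric])
  have "15/2 / sqrt G * (9 * decay) ^ p * (5 / G\<^sup>2) ^ (j + nat k) * (5/2 * G) ^ (j + nat (- k)) * e ^ nat \<bar>k + int p\<bar>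
     = 15/2 / sqrt G * (9 * decay) ^ p * (25 / (2 * G)) ^ j * (5 / G\<^sup>2) ^ nat k * (5/2 * G) ^ nat (- k) * e ^ nat \<bar>k + int p\<bar>"
    unfolding R power_add by (simp only: mult_ac)
  with abs_melnikov_term_pos_le[OF p, of "j + nat k" "j + nat (- k)"] show ?thesis unfolding n by (simp only:)
qed

lemma ratio_le_half: "25 / (2 * G) \<le> 1/2" "0 < 25 / (2 * G)" "5/2 * G * e \<le> 1/2" "0 < 5/2 * G * e" "1 \<le> 5/2 * G"
  "0 < 5 / G\<^sup>2" "5 / G\<^sup>2 \<le> 1/8" "25 / G ^ 4 \<le> 1/8"
  using G_ge eG e_pos G_powers_ge by (auto simp: field_simps)

text \<open>The growth \<open>5 G / 2\<close> with \<open>- k\<close> is harmless because beyond \<open>k = - q\<close> each step also gains a factor \<open>e\<close>,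
  and \<open>e G \<le> 1/8\<close>. So the coefficients are largest at \<open>k = - q\<close> in this bound.\<close>

lemma abs_harmonic_coeff_pos_le:
  assumes p: "1 \<le> p"
  shows "\<bar>harmonic_coeff (int p) k\<bar> \<le> 15 / sqrt G * (45/2 * G * decay) ^ p * (1/2) ^ nat \<bar>k - (- int p)\<bar>"
proof -
  define n where "n = nat \<bar>k + int p\<bar>"
  define A where "A = 5/2 * G"
  have A: "1 \<le> A" "0 \<le> A * e" "A * e \<le> 1/2" using ratio_le_half by (auto simp: A_def)
  have "\<bar>melnikov_term (int p) (j + 0 + nat k) (j + 0 + nat (- k))\<bar> \<le> 15/2 / sqrt G * (45/2 * G * decay) ^ p * (1/2) ^ n * (1/2) ^ j" for j
  proof -
    \<comment> \<open>With \<open>n = \<bar>k + p\<bar>\<close> one has \<open>- k \<le> p + n\<close>; for \<open>k \<ge> 0\<close> this is wasteful but sufficient.\<close>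
    have "A ^ nat (- k) * e ^ n \<le> A ^ (p + n) * e ^ n"
      using A e_pos by (intro mult_right_mono power_increasing) (auto simp: n_def)
    also have "\<dots> = A ^ p * (A * e) ^ n" by (simp add: power_add power_mult_distrib)
    also have "\<dots> \<le> A ^ p * (1/2) ^ n" using A by (intro mult_left_mono power_mono) auto
    finally have 1: "A ^ nat (- k) * e ^ n \<le> A ^ p * (1/2) ^ n" .
    have "\<bar>melnikov_term (int p) (j + nat k) (j + nat (- k))\<bar> \<le> 15/2 / sqrt G * (9 * decay) ^ p
        * ((25 / (2 * G)) ^ j * (5 / G\<^sup>2) ^ nat k * (A ^ nat (- k) * e ^ n))"
      using abs_melnikov_term_pos_index_le[OF p, of j k] by (simp add: A_def n_def mult.assoc)
    also have "\<dots> \<le> 15/2 / sqrt G * (9 * decay) ^ p * ((1/2) ^ j * 1 * (A ^ p * (1/2) ^ n))"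
    proof (intro mult_left_mono mult_mono[OF _ 1])
      show "(25 / (2 * G)) ^ j * (5 / G\<^sup>2) ^ nat k \<le> (1/2) ^ j * 1"
        using ratio_le_half by (intro mult_mono power_mono power_le_one) auto
    qed (use A e_pos decay_pos G_pos in auto)
    also have "\<dots> = 15/2 / sqrt G * (45/2 * G * decay) ^ p * (1/2) ^ n * (1/2) ^ j"
    proof -
      have "9 * decay * A = 45/2 * G * decay" by (simp add: A_def)
      then have P: "(45/2 * G * decay) ^ p = (9 * decay) ^ p * A ^ p" by (simp only: power_mult_distrib[symmetric])
      show ?thesis unfolding P by (simp only: mult_ac mult_1_right)
    qed
    finally show ?thesis by simp
  qed
  from abs_has_sum_nat_tail_le[OF harmonic_coeff_has_sum this]
  show ?thesis by (simp add: n_def mult_ac)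
qed

lemma abs_half_harmonic_pos_le:
  assumes p: "1 \<le> p"
  shows "\<bar>half_harmonic \<alpha> s (int p)\<bar> \<le> 45 / sqrt G * (45/2 * G * decay) ^ p"
proof -
  have "\<bar>half_harmonic \<alpha> s (int p)\<bar> \<le> 15 / sqrt G * (45/2 * G * decay) ^ p * ((1 + 1/2) / (1 - 1/2))"
  proof (rule abs_has_sum_int_le[OF half_harmonic_has_sum])
    fix k
    have "\<bar>harmonic_coeff (int p) k * cos (of_int (int p) * s + of_int k * \<alpha>)\<bar> \<le> \<bar>harmonic_coeff (int p) k\<bar> * 1"
      unfolding abs_mult by (intro mult_left_mono) auto
    also have "\<dots> \<le> 15 / sqrt G * (45/2 * G * decay) ^ p * (1/2) ^ nat \<bar>k - (- int p)\<bar>"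
      using abs_harmonic_coeff_pos_le[OF p] by simp
    finally show "\<bar>harmonic_coeff (int p) k * cos (of_int (int p) * s + of_int k * \<alpha>)\<bar>
      \<le> 15 / sqrt G * (45/2 * G * decay) ^ p * (1/2) ^ nat \<bar>k - (- int p)\<bar>" .
  qed (use G_pos decay_pos in auto)
  then show ?thesis by simp
qed

lemma decay_base_le: "45/2 * G * decay \<le> 1/2"
proof -
  have "1 + G ^ 3 / 3 \<le> exp (G ^ 3 / 3)" by (rule exp_ge_add_one_self)
  then have "G ^ 3 / 3 \<le> exp (G ^ 3 / 3)" by linarith
  then have "decay \<le> inverse (G ^ 3 / 3)"
    unfolding decay_def exp_minus using G_pos by (intro le_imp_inverse_le) auto
  then have "45/2 * G * decay \<le> 45/2 * G * inverse (G ^ 3 / 3)" using G_pos by (intro mult_left_mono) auto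
  also have "\<dots> = 135/2 / G\<^sup>2" using G_pos by (simp add: power2_eq_square power3_eq_cube)
  also have "\<dots> \<le> 135/2 / 1024" using G_powers_ge by (intro divide_left_mono) auto
  finally show ?thesis by simp
qed

text \<open>The bound for \<open>q\<close> is geometric with ratio at most 1/2, so the first one, for \<open>q = 2\<close>, decides.\<close>

lemma abs_melnikov_ge2_le: "\<bar>melnikov_ge2 f \<alpha> G s e\<bar> \<le> 2 ^ 28 * (G * sqrt G) * decay\<^sup>2"
proof -
  define Q where "Q = 45/2 * G * decay"
  have Q: "0 \<le> Q" "Q \<le> 1/2" using decay_base_le G_pos decay_pos by (auto simp: Q_def)
  have "\<bar>(melnikov f \<alpha> G s e - half_harmonic \<alpha> s 0) / 2 - half_harmonic \<alpha> s 1\<bar> \<le> 45 / sqrt G * Q\<^sup>2 * ((1 + 1/2) / (1 - 1/2))"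
  proof (rule abs_has_sum_int_le[OF half_harmonics_ge2_has_sum])
    fix q :: int assume "q \<in> {2..}"
    then have p: "q = int (nat (q - 2) + 2)" by simp
    define p where "p = nat (q - 2)"
    have p: "q = int (p + 2)" using p by (simp only: p_def)
    have "\<bar>half_harmonic \<alpha> s q\<bar> \<le> 45 / sqrt G * Q ^ (p + 2)"
      using abs_half_harmonic_pos_le[of "p + 2" \<alpha> s] unfolding p Q_def by simp
    also have "\<dots> = 45 / sqrt G * Q\<^sup>2 * Q ^ p" by (simp only: power_add mult_ac)
    also have "\<dots> \<le> 45 / sqrt G * Q\<^sup>2 * (1/2) ^ p" using Q G_pos by (intro mult_left_mono power_mono) auto
    finally show "\<bar>half_harmonic \<alpha> s q\<bar> \<le> 45 / sqrt G * Q\<^sup>2 * (1/2) ^ nat \<bar>q - 2\<bar>" by (simp add: p)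
  qed (use G_pos in auto)
  then have "\<bar>melnikov_ge2 f \<alpha> G s e\<bar> \<le> 270 / sqrt G * Q\<^sup>2"
    unfolding melnikov_ge2_eq by (simp add: abs_le_iff field_simps)
  also have "\<dots> = 270 * (45/2)\<^sup>2 * (G\<^sup>2 / sqrt G) * decay\<^sup>2" unfolding Q_def power_mult_distrib by simp
  also have "G\<^sup>2 / sqrt G = G * sqrt G"
    using G_pos by (simp add: power2_eq_square field_simps)
  also have "270 * (45/2)\<^sup>2 * (G * sqrt G) * decay\<^sup>2 \<le> 2 ^ 28 * (G * sqrt G) * decay\<^sup>2"
    using G_pos by (intro mult_right_mono) (auto simp: power2_eq_square)
  finally show ?thesis .
qed

section \<open>The first harmonic\<close>

text \<open>Each step in \<open>j\<close> multiplies by \<open>5 / G\<^sup>2 * (5 G / 2) = 25 / (2 G)\<close>.\<close>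

lemma harmonic_1_tail:
  assumes K: "1 \<le> K"
  shows "\<bar>harmonic_coeff 1 (- int K) - (\<Sum>j<n. melnikov_term 1 j (j + K))\<bar>
    \<le> 135 * decay / sqrt G * (25 / (2 * G)) ^ n * (5/2 * G) ^ K * e ^ (K - 1)"
proof -
  define C where "C = 135/2 * decay / sqrt G * (25 / (2 * G)) ^ n * (5/2 * G) ^ K * e ^ (K - 1)"
  have C: "0 \<le> C" using G_pos decay_pos e_pos by (simp add: C_def)
  have t: "\<bar>melnikov_term 1 (j + n) (j + n + K)\<bar> \<le> C * (1/2) ^ j" for j
  proof -
    have n: "nat (int K - 1) = K - 1" using K by auto
    have "\<bar>melnikov_term 1 (j + n) (j + n + K)\<bar> \<le> 135/2 * decay / sqrt G * (25 / (2 * G)) ^ (j + n) * (5/2 * G) ^ K * e ^ (K - 1)"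
      using abs_melnikov_term_pos_index_le[of 1 "j + n" "- int K"] K n by simp
    also have "\<dots> = C * (25 / (2 * G)) ^ j" unfolding C_def power_add by (simp only: mult_ac times_divide_eq_right times_divide_eq_left)
    also have "\<dots> \<le> C * (1/2) ^ j" using C ratio_le_half by (intro mult_left_mono power_mono) auto
    finally show ?thesis .
  qed
  have "((\<lambda>j. melnikov_term 1 j (j + K)) has_sum harmonic_coeff 1 (- int K)) UNIV"
    using harmonic_coeff_has_sum[of 1 "- int K"] by simp
  from abs_has_sum_nat_tail_le[OF this t] show ?thesis by (simp add: C_def mult_ac)
qed

text \<open>The factor \<open>1 / G\<close> comes from the absence of terms with \<open>l + m < 2\<close>: for \<open>k = 0\<close> and \<open>k = 1\<close> the series
  starts only at \<open>j = 1\<close>, and for \<open>k \<ge> 2\<close> the power \<open>(5 / G\<^sup>2)^k\<close> is small.\<close>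

lemma abs_harmonic_1_nonneg_le:
  "\<bar>harmonic_coeff 1 (int K)\<bar> \<le> 3375 * decay * e / (G * sqrt G) * (1/2) ^ K"
proof -
  define R where "R = 25 / (2 * G)"
  have R: "0 \<le> R" "R \<le> 1/2" using ratio_le_half by (auto simp: R_def)
  have eK: "e ^ K \<le> (1/2) ^ K" using e_pos e_small by (intro power_mono) auto
  have t: "\<bar>melnikov_term 1 (j + 0 + K) (j + 0)\<bar> \<le> 135 * decay / sqrt G * R * e * (1/2) ^ K * (1/2) ^ j" for j
  proof (cases "j + K + j < 2")
    case True
    then show ?thesis using R decay_pos e_pos G_pos by (simp add: melnikov_term_eq_0)
  next
    case False
    have r: "R ^ j * (5 / G\<^sup>2) ^ K \<le> 2 * R * (1/2) ^ j"
    proof (cases j)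
      case 0
      have "(5 / G\<^sup>2) ^ K \<le> (5 / G\<^sup>2) ^ 1" using False 0 ratio_le_half by (intro power_decreasing) auto
      also have "\<dots> \<le> 2 * R" using G_ge by (simp add: R_def field_simps power2_eq_square)
      finally show ?thesis using 0 by simp
    next
      case (Suc i)
      have "R ^ j * (5 / G\<^sup>2) ^ K \<le> R ^ j * 1" using R ratio_le_half by (intro mult_left_mono power_le_one) auto
      also have "\<dots> \<le> R * (1/2) ^ i" using Suc R by (auto intro!: mult_left_mono power_mono)
      finally show ?thesis using Suc by simp
    qed
    have "\<bar>melnikov_term 1 (j + K) j\<bar> \<le> 135/2 * decay / sqrt G * R ^ j * (5 / G\<^sup>2) ^ K * e ^ nat \<bar>int K + 1\<bar>"
      using abs_melnikov_term_pos_index_le[of 1 j "int K"] by (simp add: R_def)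
    also have "nat \<bar>int K + 1\<bar> = K + 1" by simp
    also have "135/2 * decay / sqrt G * R ^ j * (5 / G\<^sup>2) ^ K * e ^ (K + 1) = 135/2 * decay / sqrt G * e * ((R ^ j * (5 / G\<^sup>2) ^ K) * e ^ K)"
      by simp
    also have "\<dots> \<le> 135/2 * decay / sqrt G * e * ((2 * R * (1/2) ^ j) * (1/2) ^ K)"
      using r eK R decay_pos e_pos G_pos by (intro mult_left_mono[OF mult_mono]) auto
    finally show ?thesis by (simp add: mult_ac)
  qed
  have "((\<lambda>j. melnikov_term 1 (j + K) j) has_sum harmonic_coeff 1 (int K)) UNIV"
    using harmonic_coeff_has_sum[of 1 "int K"] by simp
  from abs_has_sum_nat_tail_le[OF this t] show ?thesis by (simp add: R_def mult_ac)
qed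

lemma abs_harmonic_1_neg_le:
  assumes "4 \<le> K"
  shows "\<bar>harmonic_coeff 1 (- int K)\<bar> \<le> 5274 * decay * e ^ 3 * G ^ 4 / sqrt G * (1/2) ^ (K - 4)"
proof -
  have "(5/2 * G) ^ K * e ^ (K - 1) = (5/2 * G) ^ 4 * e ^ 3 * (5/2 * G * e) ^ (K - 4)"
  proof -
    have "K = 4 + (K - 4)" "K - 1 = 3 + (K - 4)" using assms by auto
    then have "(5/2 * G) ^ K = (5/2 * G) ^ 4 * (5/2 * G) ^ (K - 4)" "e ^ (K - 1) = e ^ 3 * e ^ (K - 4)"
      by (metis power_add)+
    then show ?thesis unfolding power_mult_distrib[of "5/2 * G" e] by (simp only: mult_ac)
  qed
  also have "\<dots> \<le> (5/2 * G) ^ 4 * e ^ 3 * (1/2) ^ (K - 4)"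
    using ratio_le_half e_pos by (intro mult_left_mono power_mono) auto
  finally have 1: "(5/2 * G) ^ K * e ^ (K - 1) \<le> (5/2 * G) ^ 4 * e ^ 3 * (1/2) ^ (K - 4)" .
  have "\<bar>harmonic_coeff 1 (- int K)\<bar> \<le> 135 * decay / sqrt G * ((5/2 * G) ^ K * e ^ (K - 1))"
    using harmonic_1_tail[of K 0] assms by (simp add: mult.assoc)
  also have "\<dots> \<le> 135 * decay / sqrt G * ((5/2 * G) ^ 4 * e ^ 3 * (1/2) ^ (K - 4))"
    using 1 decay_pos G_pos by (intro mult_left_mono) auto
  also have "\<dots> = (135 * (5/2) ^ 4) * (decay * e ^ 3 * G ^ 4 / sqrt G * (1/2) ^ (K - 4))"
    unfolding power_mult_distrib by simp
  also have "\<dots> \<le> 5274 * (decay * e ^ 3 * G ^ 4 / sqrt G * (1/2) ^ (K - 4))"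
    using decay_pos G_pos e_pos by (intro mult_right_mono) (auto simp: eval_nat_numeral)
  finally show ?thesis by (simp add: mult_ac)
qed

text \<open>All of \<open>\<L>\<^sub>1\<close> except \<open>k = -1, -2, -3\<close>.\<close>

definition first_harmonic_error :: "real \<Rightarrow> real \<Rightarrow> real" where
  "first_harmonic_error \<alpha> s = 2 * (half_harmonic \<alpha> s 1 - (harmonic_coeff 1 (-1) * cos (s - \<alpha>)
      + harmonic_coeff 1 (-2) * cos (s - 2 * \<alpha>) + harmonic_coeff 1 (-3) * cos (s - 3 * \<alpha>)))"

text \<open>The coefficients with \<open>k \<le> -4\<close> carry \<open>e^3 G^(7/2)\<close> and those with \<open>k \<ge> 0\<close> carry \<open>e G^(-3/2)\<close>. Both
  families are dominated by one geometric sequence centred at \<open>-2\<close>, in the middle of the gap.\<close>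

lemma abs_first_harmonic_error_le:
  "\<bar>first_harmonic_error \<alpha> s\<bar> \<le> 2 ^ 18 * e * decay * (e\<^sup>2 * (G ^ 3 * sqrt G) + 1 / (G * sqrt G))"
proof -
  define g where "g = (\<lambda>k. harmonic_coeff 1 k * cos (of_int 1 * s + of_int k * \<alpha>))"
  define c1 where "c1 = 5274 * decay * e ^ 3 * G ^ 4 / sqrt G"
  define c2 where "c2 = 3375 * decay * e / (G * sqrt G)"
  have c: "0 \<le> c1" "0 \<le> c2" using decay_pos e_pos G_pos by (auto simp: c1_def c2_def)
  have "(g has_sum (half_harmonic \<alpha> s 1 - (\<Sum>k\<in>{-1, -2, -3}. g k))) (UNIV - {-1, -2, -3})"
    using half_harmonic_has_sum[of 1 s \<alpha>] unfolding g_def by (intro has_sum_Diff has_sum_finite) auto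
  moreover have "half_harmonic \<alpha> s 1 - (\<Sum>k\<in>{-1, -2, -3}. g k) = first_harmonic_error \<alpha> s / 2"
    by (simp add: g_def first_harmonic_error_def)
  ultimately have S: "(g has_sum (first_harmonic_error \<alpha> s / 2)) (UNIV - {-1, -2, -3})" by (simp only:)
  have "\<bar>first_harmonic_error \<alpha> s / 2\<bar> \<le> 4 * (c1 + c2) * ((1 + 1/2) / (1 - 1/2))"
  proof (rule abs_has_sum_int_le[OF S])
    fix k :: int assume k: "k \<in> UNIV - {-1, -2, -3}"
    have "\<bar>g k\<bar> \<le> \<bar>harmonic_coeff 1 k\<bar> * 1" unfolding g_def abs_mult by (intro mult_left_mono) auto
    also have "\<dots> \<le> 4 * (c1 + c2) * (1/2) ^ nat \<bar>k - (-2)\<bar>"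
    proof (cases "0 \<le> k")
      case True
      have n: "nat \<bar>k - (-2)\<bar> = 2 + nat k" using True by simp
      have "\<bar>harmonic_coeff 1 k\<bar> \<le> c2 * (1/2) ^ nat k"
        using abs_harmonic_1_nonneg_le[of "nat k"] True by (simp add: c2_def)
      also have "\<dots> \<le> (c1 + c2) * (1/2) ^ nat k" using c by (intro mult_right_mono) auto
      finally show ?thesis unfolding n power_add by (simp add: power2_eq_square algebra_simps)
    next
      case False
      with k have k4: "k \<le> -4" by auto
      have n: "nat \<bar>k - (-2)\<bar> = 2 + (nat (- k) - 4)" using k4 by auto
      have "\<bar>harmonic_coeff 1 k\<bar> \<le> c1 * (1/2) ^ (nat (- k) - 4)"
        using abs_harmonic_1_neg_le[of "nat (- k)"] k4 by (simp add: c1_def)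
      also have "\<dots> \<le> (c1 + c2) * (1/2) ^ (nat (- k) - 4)" using c by (intro mult_right_mono) auto
      finally show ?thesis unfolding n power_add by (simp add: power2_eq_square algebra_simps)
    qed
    finally show "\<bar>g k\<bar> \<le> 4 * (c1 + c2) * (1/2) ^ nat \<bar>k - (-2)\<bar>" .
  qed (use c in auto)
  then have "\<bar>first_harmonic_error \<alpha> s\<bar> \<le> 24 * c1 + 24 * c2" by (simp add: abs_le_iff field_simps)
  also have "c1 = 5274 * (decay * e * (e\<^sup>2 * (G ^ 3 * sqrt G)))"
  proof -
    have "G ^ 4 / sqrt G = G ^ 3 * sqrt G" using G_pos by (simp add: eval_nat_numeral field_simps)
    moreover have "c1 = 5274 * (decay * e * (e\<^sup>2 * (G ^ 4 / sqrt G)))"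
      by (simp add: c1_def power2_eq_square power3_eq_cube)
    ultimately show ?thesis by (simp only:)
  qed
  also have "c2 = 3375 * (decay * e * (1 / (G * sqrt G)))" by (simp add: c2_def)
  also have "24 * (5274 * (decay * e * (e\<^sup>2 * (G ^ 3 * sqrt G)))) + 24 * (3375 * (decay * e * (1 / (G * sqrt G))))
     \<le> 2 ^ 18 * (decay * e * (e\<^sup>2 * (G ^ 3 * sqrt G))) + 2 ^ 18 * (decay * e * (1 / (G * sqrt G)))"
    unfolding mult.assoc[symmetric, of 24] using decay_pos e_pos G_pos by (intro add_mono mult_right_mono) auto
  finally show ?thesis by (simp add: algebra_simps)
qed

text \<open>The error at the saddle is \<open>36/5 * w^(m-1)\<close>, and the main value contains the additional factor
  \<open>sqrt (\<pi> w) \<ge> 6 G\<close>.\<close>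

lemma parab_integral_main:
  assumes m: "2 \<le> m" and l: "l \<le> 1" and c: "1/3 \<le> c"
    and M: "\<And>\<eta> w. 0 < \<eta> \<Longrightarrow> 0 < w \<Longrightarrow>
      (- 1) ^ m * of_real ((1/4) ^ l) * saddle_moment w \<eta> m = of_real (c * w ^ (m - 1) * sqrt (pi * w))"
  obtains \<delta> where "\<bar>\<delta>\<bar> \<le> 4 / G"
    "Re (parab_integral (G ^ 3 / 2) l m) = decay * (c * (G ^ 3 / 2) ^ (m - 1) * (sqrt (pi/2) * (G * sqrt G))) * (1 + \<delta>)"
proof -
  define w where "w = G ^ 3 / 2"
  define \<eta> where "\<eta> = 1 / sqrt w"
  define V where "V = c * w ^ (m - 1) * sqrt (pi * w)"
  define x where "x = exp (2 * w / 3) * Re (parab_integral w l m)"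
  have w: "0 < w" "16384 \<le> w" using G_pos G_powers_ge by (auto simp: w_def)
  have \<eta>: "0 < \<eta>" "\<eta> \<le> 1/100" "w * \<eta>\<^sup>2 = 1"
  proof -
    have "100 \<le> sqrt w" using w by (intro real_le_rsqrt) auto
    then show "\<eta> \<le> 1/100" unfolding \<eta>_def by (intro divide_left_mono) (use w in auto)
  qed (use w in \<open>auto simp: \<eta>_def power_divide\<close>)
  have "inverse (\<eta>\<^sup>2) = w" using w by (simp add: \<eta>_def power_divide)
  then have "norm (of_real (exp (2 * w / 3)) * parab_integral w l m - of_real V) \<le> 36/5 * w ^ (m - 1)"
    using parab_integral_saddle_error[OF \<eta> m l] unfolding M[OF \<eta>(1) w(1)] V_def by simp
  moreover have "of_real (exp (2 * w / 3)) * parab_integral w l m - of_real V = of_real (x - V)"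
    by (simp add: complex_eq_iff x_def parab_integral_real)
  ultimately have err: "\<bar>x - V\<bar> \<le> 36/5 * w ^ (m - 1)" by (simp only: norm_of_real)
  have root: "sqrt (pi * w) = sqrt (pi/2) * (G * sqrt G)"
  proof -
    have "pi * w = pi/2 * (G\<^sup>2 * G)" by (simp add: w_def power2_eq_square power3_eq_cube)
    moreover have "sqrt (G\<^sup>2) = G" using G_pos by simp
    ultimately show ?thesis by (simp only: real_sqrt_mult)
  qed
  have "6 * G \<le> sqrt (pi * w)"
  proof (rule real_le_rsqrt)
    have "(6 * G)\<^sup>2 \<le> 3 * (32 * G\<^sup>2 / 2)" using G_pos by (simp add: power_mult_distrib)
    also have "\<dots> \<le> 3 * (G * G\<^sup>2 / 2)" using G_ge by (intro mult_left_mono divide_right_mono mult_right_mono) auto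
    also have "\<dots> \<le> pi * w" using pi_gt3 G_pos unfolding w_def
      by (intro mult_mono) (auto simp: power2_eq_square power3_eq_cube)
    finally show "(6 * G)\<^sup>2 \<le> pi * w" .
  qed
  then have "1/3 * w ^ (m - 1) * (6 * G) \<le> V"
    unfolding V_def using w c G_pos by (intro mult_mono) auto
  then have V: "2 * G * w ^ (m - 1) \<le> V" by simp
  then have Vpos: "0 < V" using w G_pos by (smt (verit) mult_pos_pos zero_less_power)
  have "36/5 * w ^ (m - 1) \<le> 4 / G * V"
  proof -
    have "36/5 * w ^ (m - 1) \<le> 4 / G * (2 * G * w ^ (m - 1))" using G_pos w by simp
    also have "\<dots> \<le> 4 / G * V" using V G_pos by (intro mult_left_mono) auto
    finally show ?thesis .
  qed
  then have "\<bar>x / V - 1\<bar> \<le> 4 / G" by (intro relative_error_le[OF _ err, where D=0]) (use Vpos in auto)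
  moreover have "Re (parab_integral w l m) = decay * V * (1 + (x / V - 1))"
  proof -
    have "2 * w / 3 = - (- (G ^ 3 / 3))" by (simp add: w_def)
    then have "decay * x = Re (parab_integral w l m)" unfolding x_def decay_def by (simp add: exp_minus)
    then show ?thesis using Vpos by simp
  qed
  ultimately show thesis unfolding V_def w_def root[unfolded w_def] by (rule that)
qed

lemma moment_constants:
  assumes "0 < \<eta>" "0 < w"
  shows "(- 1) ^ 2 * of_real ((1/4) ^ 1) * saddle_moment w \<eta> 2 = of_real (1/3 * w ^ (2 - 1) * sqrt (pi * w))"
    "(- 1) ^ 2 * of_real ((1/4) ^ 0) * saddle_moment w \<eta> 2 = of_real (4/3 * w ^ (2 - 1) * sqrt (pi * w))"
    "(- 1) ^ 3 * of_real ((1/4) ^ 0) * saddle_moment w \<eta> 3 = of_real (8/15 * w ^ (3 - 1) * sqrt (pi * w))"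
  unfolding saddle_moments[OF assms] by simp_all

lemma sqrt_half_pi_ge: "5/4 \<le> sqrt (pi/2)"
  using pi_approx by (intro real_le_rsqrt) (auto simp: power2_eq_square)

lemma sqrt_pi_eqs: "sqrt (pi / (8 * G)) = sqrt (pi/2) / (2 * sqrt G)" "sqrt (2 * pi) = 2 * sqrt (pi/2)"
proof -
  have 1: "pi / (8 * G) = (pi/2) / (2\<^sup>2 * G)" "2 * pi = 2\<^sup>2 * (pi/2)" by simp_all
  show "sqrt (pi / (8 * G)) = sqrt (pi/2) / (2 * sqrt G)" "sqrt (2 * pi) = 2 * sqrt (pi/2)"
    unfolding 1 real_sqrt_mult real_sqrt_divide by simp_all
qed

lemma e_square_relative_small: "26 * e\<^sup>2 \<le> 1" "e \<le> 1" "3/2 * e\<^sup>2 \<le> 1"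
  using e_square_small e_small by auto

lemma melnikov_term_1: "melnikov_term 1 l m = melnikov_weight l m * Re (orbit_coeff 1 l m) * Re (parab_integral (G ^ 3 / 2) l m)"
  by (simp add: melnikov_term_def)

lemma melnikov_weight_values:
  "melnikov_weight 1 1 = 1 / G ^ 3" "melnikov_weight 2 1 = 3 / (2 * G ^ 5)" "melnikov_weight 1 2 = 3 / (2 * G ^ 5)"
  "melnikov_weight 0 2 = 3 / (2 * G ^ 3)" "melnikov_weight 0 3 = 5 / (2 * G ^ 5)"
proof -
  have p: "(- 2 / G\<^sup>2)\<^sup>2 * G = 4 / G ^ 3" "(- 2 / G\<^sup>2) ^ 3 * G = - 8 / G ^ 5"
    using G_pos by (simp_all add: field_simps eval_nat_numeral)
  have n: "1 + 1 = (2::nat)" "2 + 1 = (3::nat)" "1 + 2 = (3::nat)" "0 + 2 = (2::nat)" "0 + 3 = (3::nat)" by simp_all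
  show "melnikov_weight 1 1 = 1 / G ^ 3" "melnikov_weight 2 1 = 3 / (2 * G ^ 5)" "melnikov_weight 1 2 = 3 / (2 * G ^ 5)"
    "melnikov_weight 0 2 = 3 / (2 * G ^ 3)" "melnikov_weight 0 3 = 5 / (2 * G ^ 5)"
    unfolding melnikov_weight_def n mult.assoc p by (simp_all add: inv_sqrt_coeff_values)
qed

text \<open>The principal term is \<open>(l, m) = (1, 2)\<close>, since \<open>(0, 1)\<close> is removed from the potential.\<close>

lemma harmonic_1_1_relative_error:
  "\<bar>2 * harmonic_coeff 1 (-1) / (sqrt (pi / (8 * G)) * decay) - 1\<bar> \<le> 26 * e\<^sup>2 + 2 * (4 / G) + 170000 / G"
proof -
  define s where "s = sqrt G"
  define p where "p = sqrt (pi/2)"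
  have s: "0 < s" "G = s * s" using G_pos by (auto simp: s_def)
  have p: "5/4 \<le> p" unfolding p_def by (rule sqrt_half_pi_ge)
  obtain \<delta> where d: "\<bar>\<delta>\<bar> \<le> 4 / G"
    "Re (parab_integral (G ^ 3 / 2) 1 2) = decay * (1/3 * (G ^ 3 / 2) ^ (2 - 1) * (sqrt (pi/2) * (G * sqrt G))) * (1 + \<delta>)"
    by (rule parab_integral_main[of 2 1 "1/3"]) (use moment_constants(1) in auto)
  show ?thesis
  proof (rule relative_error_product[OF _ _ _ _ d(1)])
    show "sqrt (pi / (8 * G)) * decay \<noteq> 0" using G_pos decay_pos by simp
    show "2 * melnikov_term 1 1 2 = sqrt (pi / (8 * G)) * decay * (Re (orbit_coeff 1 1 2) * (1 + \<delta>))"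
      unfolding melnikov_term_1 d(2) melnikov_weight_values sqrt_pi_eqs p_def[symmetric] s_def[symmetric]
      using s(1) unfolding s(2) by (simp add: field_simps eval_nat_numeral)
    show "\<bar>Re (orbit_coeff 1 1 2) - 1\<bar> \<le> 26 * e\<^sup>2" by (rule orbit_coeff_1_1_2)
    have "melnikov_term 1 0 1 = 0" by (rule melnikov_term_eq_0) simp
    then have "(\<Sum>j<2. melnikov_term 1 j (j + 1)) = melnikov_term 1 1 2" by (simp add: eval_nat_numeral)
    then have "\<bar>harmonic_coeff 1 (-1) - melnikov_term 1 1 2\<bar> \<le> 135 * decay / s * (25 / (2 * G))\<^sup>2 * (5/2 * G)"
      using harmonic_1_tail[of 1 2] by (simp add: s_def)
    then have "\<bar>2 * harmonic_coeff 1 (-1) - 2 * melnikov_term 1 1 2\<bar> \<le> 270 * decay / s * (25 / (2 * G))\<^sup>2 * (5/2 * G)"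
      by (simp add: abs_le_iff field_simps)
    also have "\<dots> = 843750/8 * (decay / (G * s))" using s(1) unfolding s(2) by (simp add: field_simps power2_eq_square)
    also have "\<dots> \<le> 106250 * (decay / (G * s))" using s G_pos decay_pos by (intro mult_right_mono) auto
    also have "\<dots> = 170000 / G * (5/4 / (2 * s) * decay)" by simp
    also have "\<dots> \<le> 170000 / G * (p / (2 * s) * decay)"
      using p s(1) G_pos decay_pos by (intro mult_left_mono mult_right_mono divide_right_mono) auto
    also have "\<dots> = 170000 / G * \<bar>sqrt (pi / (8 * G)) * decay\<bar>"
      unfolding sqrt_pi_eqs p_def[symmetric] s_def[symmetric] using p s(1) decay_pos by (simp add: abs_mult)
    finally show "\<bar>2 * harmonic_coeff 1 (-1) - 2 * melnikov_term 1 1 2\<bar> \<le> 170000 / G * \<bar>sqrt (pi / (8 * G)) * decay\<bar>" .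
  qed (rule e_square_relative_small)
qed

text \<open>The principal term is \<open>(l, m) = (0, 2)\<close>.\<close>

lemma harmonic_1_2_relative_error:
  "\<bar>2 * harmonic_coeff 1 (-2) / (- 3 * sqrt (2 * pi) * e * (G * sqrt G) * decay) - 1\<bar> \<le> e + 2 * (4 / G) + 3000 / G"
proof -
  define s where "s = sqrt G"
  define p where "p = sqrt (pi/2)"
  have s: "0 < s" "G = s * s" using G_pos by (auto simp: s_def)
  have p: "5/4 \<le> p" unfolding p_def by (rule sqrt_half_pi_ge)
  obtain \<delta> where d: "\<bar>\<delta>\<bar> \<le> 4 / G"
    "Re (parab_integral (G ^ 3 / 2) 0 2) = decay * (4/3 * (G ^ 3 / 2) ^ (2 - 1) * (sqrt (pi/2) * (G * sqrt G))) * (1 + \<delta>)"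
    by (rule parab_integral_main[of 2 0 "4/3"]) (use moment_constants(2) in auto)
  show ?thesis
  proof (rule relative_error_product[OF _ _ _ _ d(1)])
    show "- 3 * sqrt (2 * pi) * e * (G * sqrt G) * decay \<noteq> 0" using G_pos decay_pos e_pos by simp
    show "2 * melnikov_term 1 0 2 = - 3 * sqrt (2 * pi) * e * (G * sqrt G) * decay * (Re (orbit_coeff 1 0 2) / (- 3 * e) * (1 + \<delta>))"
      unfolding melnikov_term_1 d(2) melnikov_weight_values sqrt_pi_eqs p_def[symmetric] s_def[symmetric]
      using s(1) e_pos unfolding s(2) by (simp add: field_simps eval_nat_numeral)
    show "\<bar>Re (orbit_coeff 1 0 2) / (- 3 * e) - 1\<bar> \<le> e" by (rule orbit_coeff_1_0_2)
    have "\<bar>harmonic_coeff 1 (-2) - melnikov_term 1 0 2\<bar> \<le> 135 * decay / s * (25 / (2 * G)) * (5/2 * G)\<^sup>2 * e"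
      using harmonic_1_tail[of 2 1] by (simp add: s_def numeral_2_eq_2)
    then have "\<bar>2 * harmonic_coeff 1 (-2) - 2 * melnikov_term 1 0 2\<bar> \<le> 270 * decay / s * (25 / (2 * G)) * (5/2 * G)\<^sup>2 * e"
      by (simp add: abs_le_iff field_simps)
    also have "\<dots> = 168750/8 * (e * s * decay)" using s(1) unfolding s(2) by (simp add: field_simps power2_eq_square)
    also have "\<dots> \<le> 22500 * (e * s * decay)" using s e_pos decay_pos by (intro mult_right_mono) auto
    also have "\<dots> = 3000 / G * (6 * (5/4) * e * (G * s) * decay)" using G_pos by simp
    also have "\<dots> \<le> 3000 / G * (6 * p * e * (G * s) * decay)"
      using p s(1) G_pos decay_pos e_pos by (intro mult_left_mono mult_right_mono) auto
    also have "\<dots> = 3000 / G * \<bar>- 3 * sqrt (2 * pi) * e * (G * sqrt G) * decay\<bar>"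
      unfolding sqrt_pi_eqs p_def[symmetric] s_def[symmetric] using p s(1) G_pos e_pos decay_pos by (simp add: abs_mult)
    finally show "\<bar>2 * harmonic_coeff 1 (-2) - 2 * melnikov_term 1 0 2\<bar> \<le> 3000 / G * \<bar>- 3 * sqrt (2 * pi) * e * (G * sqrt G) * decay\<bar>" .
  qed (rule e_square_relative_small)
qed

text \<open>The principal term is \<open>(l, m) = (0, 3)\<close>.\<close>

lemma harmonic_1_3_relative_error:
  "\<bar>2 * harmonic_coeff 1 (-3) / (19/8 * sqrt (2 * pi) * e\<^sup>2 * (G\<^sup>2 * sqrt G) * decay) - 1\<bar> \<le> e + 2 * (4 / G) + 9000 / G"
proof -
  define s where "s = sqrt G"
  define p where "p = sqrt (pi/2)"
  have s: "0 < s" "G = s * s" using G_pos by (auto simp: s_def)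
  have p: "5/4 \<le> p" unfolding p_def by (rule sqrt_half_pi_ge)
  obtain \<delta> where d: "\<bar>\<delta>\<bar> \<le> 4 / G"
    "Re (parab_integral (G ^ 3 / 2) 0 3) = decay * (8/15 * (G ^ 3 / 2) ^ (3 - 1) * (sqrt (pi/2) * (G * sqrt G))) * (1 + \<delta>)"
    by (rule parab_integral_main[of 3 0 "8/15"]) (use moment_constants(3) in auto)
  show ?thesis
  proof (rule relative_error_product[OF _ _ _ _ d(1)])
    show "19/8 * sqrt (2 * pi) * e\<^sup>2 * (G\<^sup>2 * sqrt G) * decay \<noteq> 0" using G_pos decay_pos e_pos by simp
    show "2 * melnikov_term 1 0 3 = 19/8 * sqrt (2 * pi) * e\<^sup>2 * (G\<^sup>2 * sqrt G) * decay * (Re (orbit_coeff 1 0 3) / (57/8 * e\<^sup>2) * (1 + \<delta>))"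
      unfolding melnikov_term_1 d(2) melnikov_weight_values sqrt_pi_eqs p_def[symmetric] s_def[symmetric]
      using s(1) e_pos unfolding s(2) by (simp add: field_simps eval_nat_numeral)
    show "\<bar>Re (orbit_coeff 1 0 3) / (57/8 * e\<^sup>2) - 1\<bar> \<le> e" by (rule orbit_coeff_1_0_3)
    have "\<bar>harmonic_coeff 1 (-3) - melnikov_term 1 0 3\<bar> \<le> 135 * decay / s * (25 / (2 * G)) * (5/2 * G) ^ 3 * e\<^sup>2"
      using harmonic_1_tail[of 3 1] by (simp add: s_def)
    then have "\<bar>2 * harmonic_coeff 1 (-3) - 2 * melnikov_term 1 0 3\<bar> \<le> 270 * decay / s * (25 / (2 * G)) * (5/2 * G) ^ 3 * e\<^sup>2"
      by (simp add: abs_le_iff field_simps)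
    also have "\<dots> = 843750/16 * (e\<^sup>2 * (G * s) * decay)" using s(1) unfolding s(2) by (simp add: field_simps power2_eq_square power3_eq_cube)
    also have "\<dots> \<le> 213750/4 * (e\<^sup>2 * (G * s) * decay)" using s G_pos e_pos decay_pos by (intro mult_right_mono) auto
    also have "\<dots> = 9000 / G * (19/4 * (5/4) * e\<^sup>2 * (G\<^sup>2 * s) * decay)" using G_pos by (simp add: power2_eq_square)
    also have "\<dots> \<le> 9000 / G * (19/4 * p * e\<^sup>2 * (G\<^sup>2 * s) * decay)"
      using p s(1) G_pos decay_pos e_pos by (intro mult_left_mono mult_right_mono) auto
    also have "\<dots> = 9000 / G * \<bar>19/8 * sqrt (2 * pi) * e\<^sup>2 * (G\<^sup>2 * sqrt G) * decay\<bar>"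
      unfolding sqrt_pi_eqs p_def[symmetric] s_def[symmetric] using p s(1) G_pos e_pos decay_pos by (simp add: abs_mult)
    finally show "\<bar>2 * harmonic_coeff 1 (-3) - 2 * melnikov_term 1 0 3\<bar> \<le> 9000 / G * \<bar>19/8 * sqrt (2 * pi) * e\<^sup>2 * (G\<^sup>2 * sqrt G) * decay\<bar>" .
  qed (rule e_square_relative_small)
qed

section \<open>The mean over the orbital phase\<close>

lemma melnikov_term_0: "melnikov_term 0 l m = melnikov_weight l m * Re (orbit_coeff 0 l m) * Re (parab_integral 0 l m)"
  by (simp add: melnikov_term_def)

lemma melnikov_term_0_axis: "melnikov_term 0 l 0 = 0"
proof (cases "l = 0")
  case True
  then show ?thesis by (simp add: melnikov_term_eq_0)
next
  case False
  then show ?thesis by (simp add: melnikov_term_def parab_integral_0_l_0)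
qed

text \<open>Without oscillation there is no loss from the saddle, and a step in \<open>j\<close> gains \<open>25 / G^4\<close>.\<close>

lemma harmonic_0_tail:
  assumes n: "1 \<le> n"
  shows "\<bar>harmonic_coeff 0 (int K) - (\<Sum>j<n. melnikov_term 0 (j + K) j)\<bar> \<le> 40/7 * G * (25 / G ^ 4) ^ n * (5 * e / G\<^sup>2) ^ K"
proof -
  define C where "C = 5 * G * (25 / G ^ 4) ^ n * (5 * e / G\<^sup>2) ^ K"
  have C: "0 \<le> C" using G_pos e_pos by (simp add: C_def)
  have t: "\<bar>melnikov_term 0 (j + n + K) (j + n)\<bar> \<le> C * (1/8) ^ j" for j
  proof -
    have "norm (parab_integral (of_int 0 * G ^ 3 / 2) (j + n + K) (j + n)) \<le> 2"
      by (rule parab_integral_norm_le) (use n in simp)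
    from abs_melnikov_term_le[OF this]
    have "\<bar>melnikov_term 0 (j + n + K) (j + n)\<bar> \<le> 5 * G * (5 / G\<^sup>2) ^ (j + n + K + (j + n)) * e ^ K" by (simp add: mult_ac)
    also have "(5 / G\<^sup>2) ^ (j + n + K + (j + n)) = (25 / G ^ 4) ^ (j + n) * (5 / G\<^sup>2) ^ K"
    proof -
      have q: "5 / G\<^sup>2 * (5 / G\<^sup>2) = 25 / G ^ 4" by (simp add: power2_eq_square eval_nat_numeral)
      show ?thesis unfolding power_add q[symmetric] power_mult_distrib by (simp only: mult_ac)
    qed
    also have "5 * G * ((25 / G ^ 4) ^ (j + n) * (5 / G\<^sup>2) ^ K) * e ^ K = C * (25 / G ^ 4) ^ j"
    proof -
      have "(5 * e / G\<^sup>2) ^ K = (5 / G\<^sup>2) ^ K * e ^ K" unfolding power_mult_distrib[symmetric] by simp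
      then show ?thesis unfolding C_def power_add by (simp only: mult_ac)
    qed
    also have "\<dots> \<le> C * (1/8) ^ j" using C ratio_le_half G_pos by (intro mult_left_mono power_mono) auto
    finally show ?thesis .
  qed
  have "((\<lambda>j. melnikov_term 0 (j + K) j) has_sum harmonic_coeff 0 (int K)) UNIV"
    using harmonic_coeff_has_sum[of 0 "int K"] by simp
  from abs_has_sum_nat_tail_le[OF this t] show ?thesis by (simp add: C_def)
qed

lemma harmonic_0_0_relative_error:
  "\<bar>harmonic_coeff 0 0 / (pi / (2 * G ^ 3)) - 1\<bar> \<le> 3/2 * e\<^sup>2 + 2 * 0 + 2 ^ 12 / G ^ 4"
proof (rule relative_error_product)
  show "pi / (2 * G ^ 3) \<noteq> 0" using G_pos by simp
  show "melnikov_term 0 1 1 = pi / (2 * G ^ 3) * ((1 + 3/2 * e\<^sup>2) * (1 + 0))"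
    using G_pos unfolding melnikov_term_0 orbit_coeff_0_1_1 parab_integral_0_1_1 melnikov_weight_values by (simp add: field_simps)
  have "(\<Sum>j<2. melnikov_term 0 (j + 0) j) = melnikov_term 0 1 1" by (simp add: eval_nat_numeral melnikov_term_0_axis)
  then have "\<bar>harmonic_coeff 0 0 - melnikov_term 0 1 1\<bar> \<le> 40/7 * G * (25 / G ^ 4)\<^sup>2"
    using harmonic_0_tail[of 2 0] by simp
  also have "\<dots> = 25000/7 * (1 / G ^ 7)" using G_pos by (simp add: field_simps eval_nat_numeral)
  also have "\<dots> \<le> 6144 * (1 / G ^ 7)" using G_pos by (intro mult_right_mono) auto
  also have "\<dots> = 2 ^ 12 / G ^ 4 * (3 / (2 * G ^ 3))" using G_pos by (simp add: field_simps flip: power_add)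
  also have "\<dots> \<le> 2 ^ 12 / G ^ 4 * \<bar>pi / (2 * G ^ 3)\<bar>"
    using G_pos pi_gt3 by (intro mult_left_mono) (auto intro!: divide_right_mono)
  finally show "\<bar>harmonic_coeff 0 0 - melnikov_term 0 1 1\<bar> \<le> 2 ^ 12 / G ^ 4 * \<bar>pi / (2 * G ^ 3)\<bar>" .
qed (use e_square_relative_small in auto)

lemma harmonic_0_1_relative_error:
  "\<bar>2 * harmonic_coeff 0 1 / (- (15 * pi * e / (8 * G ^ 5))) - 1\<bar> \<le> 3/4 * e\<^sup>2 + 2 * 0 + 2 ^ 13 / G ^ 4"
proof (rule relative_error_product)
  show "- (15 * pi * e / (8 * G ^ 5)) \<noteq> 0" using G_pos e_pos by simp
  show "2 * melnikov_term 0 2 1 = - (15 * pi * e / (8 * G ^ 5)) * ((1 + 3/4 * e\<^sup>2) * (1 + 0))"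
    using G_pos unfolding melnikov_term_0 orbit_coeff_0_2_1 parab_integral_0_2_1 melnikov_weight_values by (simp add: field_simps)
  have "(\<Sum>j<2. melnikov_term 0 (j + 1) j) = melnikov_term 0 2 1" by (simp add: eval_nat_numeral melnikov_term_0_axis)
  then have "\<bar>harmonic_coeff 0 1 - melnikov_term 0 2 1\<bar> \<le> 40/7 * G * (25 / G ^ 4)\<^sup>2 * (5 * e / G\<^sup>2)"
    using harmonic_0_tail[of 2 1] by simp
  then have "\<bar>2 * harmonic_coeff 0 1 - 2 * melnikov_term 0 2 1\<bar> \<le> 2 * (40/7 * G * (25 / G ^ 4)\<^sup>2 * (5 * e / G\<^sup>2))"
    by (simp only: right_diff_distrib[symmetric] abs_mult) simp
  also have "\<dots> = 250000/7 * (e / G ^ 9)" using G_pos by (simp add: field_simps eval_nat_numeral)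
  also have "\<dots> \<le> 46080 * (e / G ^ 9)" using G_pos e_pos by (intro mult_right_mono) auto
  also have "\<dots> = 2 ^ 13 / G ^ 4 * (15 * 3 * e / (8 * G ^ 5))" using G_pos by (simp add: field_simps flip: power_add)
  also have "\<dots> \<le> 2 ^ 13 / G ^ 4 * (15 * pi * e / (8 * G ^ 5))"
    using G_pos e_pos pi_gt3 by (intro mult_left_mono divide_right_mono mult_right_mono) auto
  also have "\<dots> = 2 ^ 13 / G ^ 4 * \<bar>- (15 * pi * e / (8 * G ^ 5))\<bar>" using G_pos e_pos by simp
  finally show "\<bar>2 * harmonic_coeff 0 1 - 2 * melnikov_term 0 2 1\<bar> \<le> 2 ^ 13 / G ^ 4 * \<bar>- (15 * pi * e / (8 * G ^ 5))\<bar>" .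
qed (use e_square_relative_small in auto)

text \<open>For \<open>k \<ge> 2\<close> the series in \<open>j\<close> starts at \<open>j = 1\<close>, so the coefficient is of size \<open>e^k G^(-3-2k)\<close>.\<close>

lemma abs_zeroth_harmonic_error_le:
  "\<bar>half_harmonic \<alpha> s 0 - harmonic_coeff 0 0 - 2 * harmonic_coeff 0 1 * cos \<alpha>\<bar> \<le> 2 ^ 14 * e\<^sup>2 / G ^ 7"
proof -
  define g where "g = (\<lambda>k. harmonic_coeff 0 k * cos (of_int k * \<alpha>))"
  define C where "C = 25000/7 * (e\<^sup>2 / G ^ 7)"
  define T where "T = half_harmonic \<alpha> s 0 - harmonic_coeff 0 0 - 2 * harmonic_coeff 0 1 * cos \<alpha>"
  have "(g has_sum ((half_harmonic \<alpha> s 0 - harmonic_coeff 0 0) / 2 - (\<Sum>k\<in>{1}. g k))) ({1..} - {1})"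
    using harmonic_0_has_sum[of \<alpha> s] unfolding g_def by (intro has_sum_Diff has_sum_finite) auto
  moreover have "(half_harmonic \<alpha> s 0 - harmonic_coeff 0 0) / 2 - (\<Sum>k\<in>{1}. g k) = T / 2"
    by (simp add: g_def T_def field_simps)
  ultimately have S: "(g has_sum (T / 2)) ({1..} - {1})" by (simp only:)
  have C0: "0 \<le> C" using G_pos by (simp add: C_def)
  have "\<bar>T / 2\<bar> \<le> C * ((1 + 1/8) / (1 - 1/8))"
  proof (rule abs_has_sum_int_le[OF S])
    fix k :: int assume k: "k \<in> {1..} - {1}"
    define K where "K = nat (k - 2)"
    have kK: "k = int (2 + K)" using k by (simp add: K_def)
    have "\<bar>g k\<bar> \<le> \<bar>harmonic_coeff 0 k\<bar> * 1" unfolding g_def abs_mult by (intro mult_left_mono) auto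
    also have "\<dots> \<le> 40/7 * G * (25 / G ^ 4) * (5 * e / G\<^sup>2) ^ (2 + K)"
      using harmonic_0_tail[of 1 "2 + K"] unfolding kK by (simp add: melnikov_term_0_axis)
    also have "\<dots> = C * (5 * e / G\<^sup>2) ^ K"
      using G_pos unfolding power_add C_def by (simp add: field_simps eval_nat_numeral)
    also have "\<dots> \<le> C * (1/8) ^ K"
    proof (intro mult_left_mono power_mono C0)
      have "5 / G\<^sup>2 * e \<le> 1/8 * 1" using ratio_le_half e_pos e_small by (intro mult_mono) auto
      then show "5 * e / G\<^sup>2 \<le> 1/8" by simp
    qed (use e_pos in auto)
    finally show "\<bar>g k\<bar> \<le> C * (1/8) ^ nat \<bar>k - 2\<bar>" by (simp add: kK)
  qed (use C0 in auto)
  then have "\<bar>T\<bar> \<le> 18/7 * C" by simp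
  also have "\<dots> = 450000/49 * (e\<^sup>2 / G ^ 7)" by (simp add: C_def)
  also have "\<dots> \<le> 2 ^ 14 * (e\<^sup>2 / G ^ 7)" using G_pos by (intro mult_right_mono) auto
  finally show ?thesis by (simp add: T_def)
qed

end

section \<open>The expansion of the potential\<close>

lemma powr_half_odd:
  assumes "0 < (x::real)"
  shows "x powr (3/2) = x * sqrt x" "x powr (5/2) = x\<^sup>2 * sqrt x" "x powr (7/2) = x ^ 3 * sqrt x" "x powr (- 3/2) = 1 / (x * sqrt x)"
proof -
  have "x powr (real n + 1/2) = x ^ n * sqrt x" for n
    unfolding powr_add powr_realpow[OF assms] using assms by (simp add: powr_half_sqrt)
  from this[of 1] this[of 2] this[of 3]
  show 1: "x powr (3/2) = x * sqrt x" "x powr (5/2) = x\<^sup>2 * sqrt x" "x powr (7/2) = x ^ 3 * sqrt x" by simp_all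
  show "x powr (- 3/2) = 1 / (x * sqrt x)" using powr_minus_divide[of x "3/2"] 1 by simp
qed

lemma error_factor:
  fixes X :: real
  assumes "M \<noteq> 0"
  shows "X = M * (1 + (X / M - 1))"
  using assms by simp

theorem theorem8:
  fixes eJ G :: real and f :: "real \<Rightarrow> real"
  assumes "0 < eJ" "eJ < 1" "G \<ge> 32" "eJ * G \<le> 1/8"
    and "is_true_anomaly eJ f"
  shows
    "(\<forall>\<alpha> s. integrable lborel (melnikov_integrand f \<alpha> G s eJ)) \<and>
     (\<forall>\<alpha> s. ((\<lambda>(q, k). complex_of_real (melnikov_coeff f G eJ q k)
                        * exp (\<i> * complex_of_real (of_int q * s + of_int k * \<alpha>)))
              has_sum complex_of_real (melnikov f \<alpha> G s eJ)) UNIV) \<and>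
     (\<forall>\<alpha> s. melnikov f \<alpha> G s eJ =
        melnikov_0 f \<alpha> G eJ + melnikov_harmonic f 1 \<alpha> G s eJ + melnikov_ge2 f \<alpha> G s eJ) \<and>
     (\<exists>(E00::real) (E01::real) (E11::real) (E12::real) (E13::real)
        (Err0 :: real \<Rightarrow> real) (Err1 :: real \<Rightarrow> real \<Rightarrow> real).
        (\<forall>\<alpha>. melnikov_0 f \<alpha> G eJ =
           melnikov_coeff f G eJ 0 0 + 2 * melnikov_coeff f G eJ 0 1 * cos \<alpha> + Err0 \<alpha>) \<and>
        (\<forall>\<alpha> s. melnikov_harmonic f 1 \<alpha> G s eJ =
           2 * melnikov_coeff f G eJ 1 (-1) * cos (s - \<alpha>)
           + 2 * melnikov_coeff f G eJ 1 (-2) * cos (s - 2 * \<alpha>)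
           + 2 * melnikov_coeff f G eJ 1 (-3) * cos (s - 3 * \<alpha>)
           + Err1 \<alpha> s) \<and>
        melnikov_coeff f G eJ 0 0 = pi / (2 * G^3) * (1 + E00) \<and>
        2 * melnikov_coeff f G eJ 0 1 = - (15 * pi * eJ / (8 * G^5)) * (1 + E01) \<and>
        2 * melnikov_coeff f G eJ 1 (-1) =
          sqrt (pi / (8 * G)) * exp (- (G^3 / 3)) * (1 + E11) \<and>
        2 * melnikov_coeff f G eJ 1 (-2) =
          - 3 * sqrt (2 * pi) * eJ * G powr (3/2) * exp (- (G^3 / 3)) * (1 + E12) \<and>
        2 * melnikov_coeff f G eJ 1 (-3) =
          19/8 * sqrt (2 * pi) * eJ\<^sup>2 * G powr (5/2) * exp (- (G^3 / 3)) * (1 + E13) \<and>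
        \<bar>E00\<bar> \<le> 2^12 / G^4 + 2^2 * 49 * eJ\<^sup>2 \<and>
        \<bar>E01\<bar> \<le> 2^13 / G^4 + eJ\<^sup>2 \<and>
        \<bar>E11\<bar> \<le> 2^21 / G + 2 * 49 * eJ\<^sup>2 \<and>
        \<bar>E12\<bar> \<le> 2^17 / G + 49/3 * eJ \<and>
        \<bar>E13\<bar> \<le> 2^17 / G + 15 * eJ \<and>
        (\<forall>\<alpha>. \<bar>Err0 \<alpha>\<bar> \<le> 2^14 * eJ\<^sup>2 / G^7) \<and>
        (\<forall>\<alpha> s. \<bar>Err1 \<alpha> s\<bar> \<le>
           2^18 * eJ * exp (- (G^3 / 3)) * (eJ\<^sup>2 * G powr (7/2) + G powr (-3/2)))) \<and>
     (\<forall>\<alpha> s. \<bar>melnikov_ge2 f \<alpha> G s eJ\<bar> \<le> 2^28 * G powr (3/2) * exp (- (2 * G^3 / 3)))"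
proof -
  have "eJ * 32 \<le> eJ * G" using assms by (intro mult_left_mono) auto
  then have "eJ \<le> 1/256" using assms by linarith
  then interpret melnikov_problem eJ f G
    by unfold_locales (use assms in auto)
  have Gp: "0 < G" using assms by simp
  note powr = powr_half_odd[OF Gp]
  note coeff = melnikov_coeff_eq
  have decay: "exp (- (G ^ 3 / 3)) = decay" by (simp add: decay_def)
  have decay2: "exp (- (2 * G ^ 3 / 3)) = decay\<^sup>2"
    unfolding decay_def power2_eq_square exp_add[symmetric] by simp
  define E00 where "E00 = harmonic_coeff 0 0 / (pi / (2 * G ^ 3)) - 1"
  define E01 where "E01 = 2 * harmonic_coeff 0 1 / (- (15 * pi * eJ / (8 * G ^ 5))) - 1"
  define E11 where "E11 = 2 * harmonic_coeff 1 (-1) / (sqrt (pi / (8 * G)) * decay) - 1"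
  define E12 where "E12 = 2 * harmonic_coeff 1 (-2) / (- 3 * sqrt (2 * pi) * eJ * (G * sqrt G) * decay) - 1"
  define E13 where "E13 = 2 * harmonic_coeff 1 (-3) / (19/8 * sqrt (2 * pi) * eJ\<^sup>2 * (G\<^sup>2 * sqrt G) * decay) - 1"
  define Err0 where "Err0 = (\<lambda>\<alpha>. half_harmonic \<alpha> 0 0 - harmonic_coeff 0 0 - 2 * harmonic_coeff 0 1 * cos \<alpha>)"
  have E: "\<bar>E00\<bar> \<le> 2^12 / G^4 + 2^2 * 49 * eJ\<^sup>2" "\<bar>E01\<bar> \<le> 2^13 / G^4 + eJ\<^sup>2"
    "\<bar>E11\<bar> \<le> 2^21 / G + 2 * 49 * eJ\<^sup>2" "\<bar>E12\<bar> \<le> 2^17 / G + 49/3 * eJ" "\<bar>E13\<bar> \<le> 2^17 / G + 15 * eJ"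
  proof -
    have G: "x / G \<le> y / G" if "x \<le> y" for x y :: real using that Gp by (intro divide_right_mono) auto
    have e2: "0 \<le> eJ\<^sup>2" and n: "(2::real)\<^sup>2 * 49 = 196" by simp_all
    show "\<bar>E00\<bar> \<le> 2^12 / G^4 + 2^2 * 49 * eJ\<^sup>2" using harmonic_0_0_relative_error e2 unfolding E00_def n by linarith
    show "\<bar>E01\<bar> \<le> 2^13 / G^4 + eJ\<^sup>2" using harmonic_0_1_relative_error e2 unfolding E01_def by linarith
    have "2 * (4 / G) + 170000 / G = 170008 / G" "2 * (4 / G) + 3000 / G = 3008 / G" "2 * (4 / G) + 9000 / G = 9008 / G"
      by (simp_all flip: add_divide_distrib)
    moreover have "170008 / G \<le> 2^21 / G" "3008 / G \<le> 2^17 / G" "9008 / G \<le> 2^17 / G" by (rule G, simp)+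
    ultimately show "\<bar>E11\<bar> \<le> 2^21 / G + 2 * 49 * eJ\<^sup>2" "\<bar>E12\<bar> \<le> 2^17 / G + 49/3 * eJ" "\<bar>E13\<bar> \<le> 2^17 / G + 15 * eJ"
      using harmonic_1_1_relative_error harmonic_1_2_relative_error harmonic_1_3_relative_error e2 assms(1)
      unfolding E11_def E12_def E13_def by linarith+
  qed
  have L: "melnikov_coeff f G eJ 0 0 = pi / (2 * G^3) * (1 + E00)"
    "2 * melnikov_coeff f G eJ 0 1 = - (15 * pi * eJ / (8 * G^5)) * (1 + E01)"
    "2 * melnikov_coeff f G eJ 1 (-1) = sqrt (pi / (8 * G)) * exp (- (G^3 / 3)) * (1 + E11)"
    "2 * melnikov_coeff f G eJ 1 (-2) = - 3 * sqrt (2 * pi) * eJ * G powr (3/2) * exp (- (G^3 / 3)) * (1 + E12)"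
    "2 * melnikov_coeff f G eJ 1 (-3) = 19/8 * sqrt (2 * pi) * eJ\<^sup>2 * G powr (5/2) * exp (- (G^3 / 3)) * (1 + E13)"
    unfolding coeff powr decay E00_def E01_def E11_def E12_def E13_def
    by (rule error_factor, use Gp decay_pos assms(1) in simp)+
  have "((\<lambda>(q, k). complex_of_real (melnikov_coeff f G eJ q k) * exp (\<i> * complex_of_real (of_int q * s + of_int k * \<alpha>)))
      has_sum complex_of_real (melnikov f \<alpha> G s eJ)) UNIV" for \<alpha> s
    unfolding coeff cis_conv_exp[symmetric] by (rule harmonic_coeff_series)
  moreover have "melnikov f \<alpha> G s eJ = melnikov_0 f \<alpha> G eJ + melnikov_harmonic f 1 \<alpha> G s eJ + melnikov_ge2 f \<alpha> G s eJ" for \<alpha> s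
    unfolding melnikov_0_eq[of \<alpha> s] melnikov_harmonic_eq melnikov_ge2_eq by simp
  moreover have "melnikov_0 f \<alpha> G eJ = melnikov_coeff f G eJ 0 0 + 2 * melnikov_coeff f G eJ 0 1 * cos \<alpha> + Err0 \<alpha>" for \<alpha>
    unfolding melnikov_0_eq[of \<alpha> 0] coeff Err0_def by simp
  moreover have "melnikov_harmonic f 1 \<alpha> G s eJ = 2 * melnikov_coeff f G eJ 1 (-1) * cos (s - \<alpha>)
      + 2 * melnikov_coeff f G eJ 1 (-2) * cos (s - 2 * \<alpha>) + 2 * melnikov_coeff f G eJ 1 (-3) * cos (s - 3 * \<alpha>)
      + first_harmonic_error \<alpha> s" for \<alpha> s
    unfolding melnikov_harmonic_eq coeff first_harmonic_error_def by (simp add: algebra_simps)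
  moreover have "\<bar>Err0 \<alpha>\<bar> \<le> 2^14 * eJ\<^sup>2 / G^7" for \<alpha>
    unfolding Err0_def by (rule abs_zeroth_harmonic_error_le)
  moreover have "\<bar>first_harmonic_error \<alpha> s\<bar> \<le> 2^18 * eJ * exp (- (G^3 / 3)) * (eJ\<^sup>2 * G powr (7/2) + G powr (-3/2))" for \<alpha> s
    unfolding powr decay by (rule abs_first_harmonic_error_le)
  moreover have "\<bar>melnikov_ge2 f \<alpha> G s eJ\<bar> \<le> 2^28 * G powr (3/2) * exp (- (2 * G^3 / 3))" for \<alpha> s
    unfolding powr decay2 by (rule abs_melnikov_ge2_le)
  moreover note integrable_melnikov_integrand
  ultimately show ?thesis
    using E L
    by (intro conjI allI exI[where x=E00] exI[where x=E01] exI[where x=E11] exI[where x=E12] exI[where x=E13]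
        exI[where x=Err0] exI[where x=first_harmonic_error]) assumption+
qed

end
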